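(* Let $r,n\geq 2$ be integers and let $0<R\leq 1$. Then the canonical inclusion $i:\mathbb{S}^{n-1}(R)\hookrightarrow\mathbb{S}^n$ is a proper $r$-harmonic submanifold of $\mathbb{S}^n$ if and only if $R=1/\sqrt{r}$.
   Context: $\mathbb{S}^m(R)$ denotes the Euclidean sphere of radius $R$ in $\mathbb{R}^{m+1}$ with its induced metric, and $\mathbb{S}^m=\mathbb{S}^m(1)$. The canonical inclusion $\mathbb{S}^{n-1}(R)\hookrightarrow\mathbb{S}^n\subset\mathbb{R}^n\times\mathbb{R}$ is $x\mapsto(x,\sqrt{1-R^2})$ (up to an isometry of $\mathbb{S}^n$); it is an isometric immersion. Let $\varphi:(M,g_M)\to(N,g_N)$ be a smooth map between Riemannian manifolds, $M$ compact, with $\nabla^\varphi$ the induced connection on $\varphi^{-1}TN$. The tension field is $\tau(\varphi)=\operatorname{trace}\nabla d\varphi\in\Gamma(\varphi^{-1}TN)$; $\varphi$ is harmonic if $\tau(\varphi)=0$. The rough Laplacian on sections of $\varphi^{-1}TN$ is $\overline{\Delta}=-\sum_{i}\{\nabla^{\varphi}_{e_i}\nabla^{\varphi}_{e_i}-\nabla^{\varphi}_{\nabla^M_{e_i}e_i}\}$, where $\{e_i\}$ is a local orthonormal frame on $M$. For $s\geq 1$ the $r$-energy ($r\ge 2$) is $$E_{2s}(\varphi)=\frac12\int_M\langle\overline{\Delta}^{s-1}\tau(\varphi),\overline{\Delta}^{s-1}\tau(\varphi)\rangle\,dv_M,\qquad E_{2s+1}(\varphi)=\frac12\int_M\sum_j\langle\nabla^\varphi_{e_j}\overline{\Delta}^{s-1}\tau(\varphi),\nabla^\varphi_{e_j}\overline{\Delta}^{s-1}\tau(\varphi)\rangle\,dv_M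 .$$ The map $\varphi$ is $r$-harmonic if $\frac{d}{dt}E_r(\varphi_t)|_{t=0}=0$ for all smooth variations $\varphi_t$ of $\varphi=\varphi_0$. An immersed submanifold (with the induced metric) is a proper $r$-harmonic submanifold if the immersion is an $r$-harmonic map which is not harmonic (equivalently, the submanifold is not minimal). *)

theory Defs
  imports "HOL-Analysis.Analysis"
begin

text \<open>
  All Riemannian manifolds are subsets of Euclidean spaces with the induced metric: tangent
  vectors at a point of M are vectors of the ambient space, the metric is the ambient inner
  product, and a section of the pull-back bundle of TN along a map from M to N is a function V
  on the ambient space of M (only its values on M matter) with V p tangent to N at the image
  of p.
\<close>

subsection \<open>Smooth maps on subsets of Euclidean spaces\<close>

primrec Ck_on :: "nat \<Rightarrow> 'a::euclidean_space set \<Rightarrow> ('a \<Rightarrow> 'b::euclidean_space) \<Rightarrow> bool" where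
  "Ck_on 0 U f \<longleftrightarrow> continuous_on U f"
| "Ck_on (Suc k) U f \<longleftrightarrow>
     f differentiable_on U \<and> (\<forall>v. Ck_on k U (\<lambda>x. frechet_derivative f (at x) v))"

text \<open>On a set that is not open, a smooth function is one with local smooth extensions.\<close>

definition smooth_on :: "'a::euclidean_space set \<Rightarrow> ('a \<Rightarrow> 'b::euclidean_space) \<Rightarrow> bool" where
  "smooth_on S f \<longleftrightarrow>
     (\<forall>p\<in>S. \<exists>U F. open U \<and> p \<in> U \<and> (\<forall>k. Ck_on k U F) \<and> (\<forall>x\<in>S \<inter> U. F x = f x))"

definition smooth_map ::
  "'a::euclidean_space set \<Rightarrow> 'b::euclidean_space set \<Rightarrow> ('a \<Rightarrow> 'b) \<Rightarrow> bool" where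
  "smooth_map M N \<phi> \<longleftrightarrow> smooth_on M \<phi> \<and> \<phi> ` M \<subseteq> N"

definition tangent_space :: "'a::euclidean_space set \<Rightarrow> 'a \<Rightarrow> 'a set" where
  "tangent_space M p = {v. \<exists>(\<gamma> :: real \<Rightarrow> 'a) \<epsilon>. 0 < \<epsilon> \<and> smooth_map {-\<epsilon><..<\<epsilon>} M \<gamma> \<and>
     \<gamma> 0 = p \<and> (\<gamma> has_vector_derivative v) (at 0)}"

text \<open>
  A derivative within M is determined only on vectors tangent to M; it is only ever applied to
  such vectors.
\<close>

definition differential ::
  "'a::euclidean_space set \<Rightarrow> ('a \<Rightarrow> 'b::euclidean_space) \<Rightarrow> ('a \<Rightarrow> 'a) \<Rightarrow> 'a \<Rightarrow> 'b" where
  "differential M f X = (\<lambda>p. frechet_derivative f (at p within M) (X p))"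

definition isometric_immersion ::
  "'a::euclidean_space set \<Rightarrow> 'b::euclidean_space set \<Rightarrow> ('a \<Rightarrow> 'b) \<Rightarrow> bool" where
  "isometric_immersion M N \<phi> \<longleftrightarrow> smooth_map M N \<phi> \<and>
     (\<forall>p\<in>M. \<forall>v\<in>tangent_space M p. \<forall>w\<in>tangent_space M p.
        frechet_derivative \<phi> (at p within M) v \<bullet> frechet_derivative \<phi> (at p within M) w = v \<bullet> w)"


subsection \<open>Connections, tension field and rough Laplacian\<close>

text \<open>
  The Levi-Civita connection of an induced metric is the tangential part of the ambient
  derivative, and the same holds for the connection it induces on the pull-back bundle.
  On the closed linear subspace of tangent vectors, the closest point is the orthogonal
  projection.
\<close>

definition pullback_connection ::
  "'a::euclidean_space set \<Rightarrow> 'b::euclidean_space set \<Rightarrow> ('a \<Rightarrow> 'b) \<Rightarrow>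
    ('a \<Rightarrow> 'a) \<Rightarrow> ('a \<Rightarrow> 'b) \<Rightarrow> 'a \<Rightarrow> 'b" where
  "pullback_connection M N \<phi> X V =
     (\<lambda>p. closest_point (tangent_space N (\<phi> p)) (differential M V X p))"

definition levi_civita ::
  "'a::euclidean_space set \<Rightarrow> ('a \<Rightarrow> 'a) \<Rightarrow> ('a \<Rightarrow> 'a) \<Rightarrow> 'a \<Rightarrow> 'a" where
  "levi_civita M X Y = pullback_connection M M (\<lambda>x. x) X Y"

definition local_orthonormal_frame ::
  "'a::euclidean_space set \<Rightarrow> 'a \<Rightarrow> (nat \<Rightarrow> 'a \<Rightarrow> 'a) \<Rightarrow> bool" where
  "local_orthonormal_frame M p e \<longleftrightarrow>
     (let m = dim (tangent_space M p) in
      \<exists>U. open U \<and> p \<in> U \<and> (\<forall>i<m. smooth_on (M \<inter> U) (e i)) \<and>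
        (\<forall>q\<in>M \<inter> U. span ((\<lambda>i. e i q) ` {..<m}) = tangent_space M q \<and>
          (\<forall>i<m. \<forall>j<m. e i q \<bullet> e j q = (if i = j then 1 else 0))))"

text \<open>The traces below do not depend on the frame chosen around each point.\<close>

definition frame_at :: "'a::euclidean_space set \<Rightarrow> 'a \<Rightarrow> nat \<Rightarrow> 'a \<Rightarrow> 'a" where
  "frame_at M p = (SOME e. local_orthonormal_frame M p e)"

text \<open>\<open>second_derivative M N \<phi> X Y\<close> is \<open>(\<nabla>d\<phi>)(X, Y)\<close>.\<close>

definition second_derivative ::
  "'a::euclidean_space set \<Rightarrow> 'b::euclidean_space set \<Rightarrow> ('a \<Rightarrow> 'b) \<Rightarrow>
    ('a \<Rightarrow> 'a) \<Rightarrow> ('a \<Rightarrow> 'a) \<Rightarrow> 'a \<Rightarrow> 'b" where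
  "second_derivative M N \<phi> X Y =
     (\<lambda>p. pullback_connection M N \<phi> X (differential M \<phi> Y) p
        - differential M \<phi> (levi_civita M X Y) p)"

definition tension_field ::
  "'a::euclidean_space set \<Rightarrow> 'b::euclidean_space set \<Rightarrow> ('a \<Rightarrow> 'b) \<Rightarrow> 'a \<Rightarrow> 'b" where
  "tension_field M N \<phi> p =
     (let e = frame_at M p in
      \<Sum>i<dim (tangent_space M p). second_derivative M N \<phi> (e i) (e i) p)"

definition rough_laplacian ::
  "'a::euclidean_space set \<Rightarrow> 'b::euclidean_space set \<Rightarrow> ('a \<Rightarrow> 'b) \<Rightarrow> ('a \<Rightarrow> 'b) \<Rightarrow> 'a \<Rightarrow> 'b" where
  "rough_laplacian M N \<phi> V p =
     (let e = frame_at M p in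
      - (\<Sum>i<dim (tangent_space M p).
           pullback_connection M N \<phi> (e i) (pullback_connection M N \<phi> (e i) V) p
         - pullback_connection M N \<phi> (levi_civita M (e i) (e i)) V p))"

definition harmonic_map ::
  "'a::euclidean_space set \<Rightarrow> 'b::euclidean_space set \<Rightarrow> ('a \<Rightarrow> 'b) \<Rightarrow> bool" where
  "harmonic_map M N \<phi> \<longleftrightarrow> smooth_map M N \<phi> \<and> (\<forall>p\<in>M. tension_field M N \<phi> p = 0)"


subsection \<open>The r-energy and r-harmonic maps\<close>

text \<open>
  In the following, \<open>\<mu>\<close> is the Riemannian volume measure of the compact manifold M.
  Both \<open>r = 2 * s\<close> and \<open>r = 2 * s + 1\<close> give \<open>s = r div 2\<close>.
\<close>

definition r_energy ::
  "'a::euclidean_space measure \<Rightarrow> 'a set \<Rightarrow> 'b::euclidean_space set \<Rightarrow> nat \<Rightarrow> ('a \<Rightarrow> 'b) \<Rightarrow> real"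
where
  "r_energy \<mu> M N r \<phi> =
     (let W = (rough_laplacian M N \<phi> ^^ (r div 2 - 1)) (tension_field M N \<phi>) in
      if even r then 1 / 2 * (LINT p|\<mu>. W p \<bullet> W p)
      else 1 / 2 * (LINT p|\<mu>. (\<Sum>j<dim (tangent_space M p).
             pullback_connection M N \<phi> (frame_at M p j) W p
           \<bullet> pullback_connection M N \<phi> (frame_at M p j) W p)))"

definition smooth_variation ::
  "'a::euclidean_space set \<Rightarrow> 'b::euclidean_space set \<Rightarrow> ('a \<Rightarrow> 'b) \<Rightarrow> (real \<Rightarrow> 'a \<Rightarrow> 'b) \<Rightarrow> bool"
where
  "smooth_variation M N \<phi> \<Phi> \<longleftrightarrow>
     (\<exists>\<epsilon>>0. smooth_map (M \<times> {-\<epsilon><..<\<epsilon>}) N (\<lambda>(x, t). \<Phi> t x)) \<and> (\<forall>x\<in>M. \<Phi> 0 x = \<phi> x)"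

definition r_harmonic_map ::
  "'a::euclidean_space measure \<Rightarrow> 'a set \<Rightarrow> 'b::euclidean_space set \<Rightarrow> nat \<Rightarrow> ('a \<Rightarrow> 'b) \<Rightarrow> bool"
where
  "r_harmonic_map \<mu> M N r \<phi> \<longleftrightarrow> smooth_map M N \<phi> \<and>
     (\<forall>\<Phi>. smooth_variation M N \<phi> \<Phi> \<longrightarrow>
        ((\<lambda>t. r_energy \<mu> M N r (\<Phi> t)) has_real_derivative 0) (at 0))"

definition proper_r_harmonic_submanifold ::
  "'a::euclidean_space measure \<Rightarrow> 'a set \<Rightarrow> 'b::euclidean_space set \<Rightarrow> nat \<Rightarrow> ('a \<Rightarrow> 'b) \<Rightarrow> bool"
where
  "proper_r_harmonic_submanifold \<mu> M N r \<phi> \<longleftrightarrow>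
     isometric_immersion M N \<phi> \<and> r_harmonic_map \<mu> M N r \<phi> \<and> \<not> harmonic_map M N \<phi>"


subsection \<open>Spheres\<close>

text \<open>
  The Riemannian volume of a Borel subset A of the sphere of radius R in an n-dimensional space
  is \<open>n / R\<close> times the Lebesgue measure of the cone over A, that is, of the points of the
  punctured ball of radius R whose radial projection to the sphere lies in A.
\<close>

definition sphere_volume :: "real \<Rightarrow> 'a::euclidean_space measure" where
  "sphere_volume R = scale_measure (ennreal (DIM('a) / R))
     (distr (restrict_space lborel (ball 0 R - {0})) (restrict_space borel (sphere 0 R))
        (\<lambda>x. (R / norm x) *\<^sub>R x))"

definition canonical_inclusion :: "real \<Rightarrow> 'a::euclidean_space \<Rightarrow> 'a \<times> real" where
  "canonical_inclusion R x = (x, sqrt (1 - R\<^sup>2))"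

end

theory Submission
  imports Defs
begin

text \<open>
  The rotation fields \<open>A x = (x \<bullet> b) d - (x \<bullet> d) b\<close> are Killing fields of the sphere of radius R.
  Summed over all basis vectors b and d, their squares give \<open>2 R\<^sup>2\<close> times the metric and their
  accelerations are normal, so the tension field and the rough Laplacian are sums of second
  derivatives along rotation fields; as rotations preserve the volume, such derivatives integrate to
  zero, which replaces the divergence theorem.

  Put \<open>c = sqrt (1 - R\<^sup>2)\<close>, \<open>m = n - 1\<close>, and let \<open>\<omega>\<close> be the unit normal of the small sphere. The k-th
  iterated Laplacian of the tension field of the inclusion is \<open>- (m / R\<^sup>2)\<^bsup>k+1\<^esup> R c\<^bsup>2k+1\<^esup> \<omega>\<close>, and for
  a variation with velocity v the integral of the normal component of its t-derivative is a constant
  times the integral of \<open>v \<bullet> \<omega>\<close>, by a recursion in k. Hence the r-energy has derivative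
  \<open>(m / R\<^sup>2)\<^bsup>r\<^esup> R c\<^bsup>2r-3\<^esup> (1 - r R\<^sup>2)\<close> times that integral. It vanishes for all variations if and only
  if \<open>c = 0\<close>, where the inclusion is harmonic, or \<open>r R\<^sup>2 = 1\<close>.
\<close>

subsection \<open>Smooth functions on open sets\<close>

text \<open>The definitions differentiate within the sphere, where a derivative is determined only
  on tangent vectors, and take traces in a frame chosen anew at every point. Iterates of
  \<open>rough_laplacian\<close> are therefore neither visibly smooth nor open to a further
  derivative in t. Hence every field is represented by a smooth field on the punctured space.
  Rotation fields are defined there globally and do not depend on t, so the iterates become
  compositions of smooth operators, and the derivatives along rotations commute with the derivative
  in t.

  Tangential parts of a variation never enter: at time 0 every iterate is a multiple of
  \<open>\<omega>\<close>, so the product rule pairs the t-derivative of the other factor with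
  \<open>\<omega>\<close> alone. The factor 1 - r R^2 arises by counting. Relative to the common
  powers, the variation of the k-th iterate carries c^2 - (2k + 1) R^2: one R^2 from the first
  Laplacian, which acts on the map itself, and two from each later one. Adding this for the two
  indices i and j of the energy, where i + j + 2 = r, and using c^2 + R^2 = 1 gives 2 (1 - r
  R^2).\<close>

lemma frechet_derivative_eqI:
  "(f has_derivative f') (at x) \<Longrightarrow> frechet_derivative f (at x) = f'"
  using frechet_derivative_at by metis

lemma Ck_on_cong:
  assumes "open U" "\<And>x. x \<in> U \<Longrightarrow> f x = g x" "Ck_on k U f"
  shows "Ck_on k U g"
  using assms(2,3)
proof (induction k arbitrary: f g)
  case 0
  then show ?case using continuous_on_cong[of U U f g] by simp
next
  case (Suc k)
  have "f differentiable_on U" using Suc.prems by simp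
  then have d: "f differentiable (at x)" if "x \<in> U" for x
    using differentiable_on_eq_differentiable_at[OF assms(1)] that by auto
  have "frechet_derivative f (at x) = frechet_derivative g (at x)" if "x \<in> U" for x
    using frechet_derivative_transform_within_open[OF d[OF that] assms(1) that] Suc.prems(1) by auto
  then have "Ck_on k U (\<lambda>x. frechet_derivative g (at x) v)" for v
    using Suc.IH[of "\<lambda>x. frechet_derivative f (at x) v" "\<lambda>x. frechet_derivative g (at x) v"] Suc.prems
    by simp
  moreover have "g differentiable_on U"
    using Suc.prems(1) \<open>f differentiable_on U\<close> by (auto simp: differentiable_on_def intro: differentiable_transform_within[of _ _ _ 1])
  ultimately show ?case by simp
qed

lemma Ck_on_SucI:
  assumes "open U" "\<And>x. x \<in> U \<Longrightarrow> (f has_derivative f' x) (at x)" "\<And>v. Ck_on k U (\<lambda>x. f' x v)"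
  shows "Ck_on (Suc k) U f"
proof -
  have "f differentiable_on U"
    using assms(1,2) by (auto simp: differentiable_on_eq_differentiable_at differentiable_def)
  moreover have "Ck_on k U (\<lambda>x. frechet_derivative f (at x) v)" for v
    using assms(3)[of v] by (rule Ck_on_cong[OF assms(1), rotated]) (simp add: frechet_derivative_eqI[OF assms(2)])
  ultimately show ?thesis by simp
qed

lemma Ck_on_SucD:
  assumes "Ck_on (Suc k) U f" "open U" "x \<in> U"
  shows "(f has_derivative frechet_derivative f (at x)) (at x)"
  using assms by (auto simp: differentiable_on_eq_differentiable_at frechet_derivative_works[symmetric])

lemma Ck_on_lower: "Ck_on (Suc k) U f \<Longrightarrow> Ck_on k U f"
proof (induction k arbitrary: f)
  case 0
  then show ?case by (simp add: differentiable_imp_continuous_on)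
next
  case (Suc k)
  then show ?case by (metis Ck_on.simps(2))
qed

lemma Ck_on_subset: "Ck_on k U f \<Longrightarrow> V \<subseteq> U \<Longrightarrow> Ck_on k V f"
  by (induction k arbitrary: f) (auto intro: continuous_on_subset differentiable_on_subset)

lemma Ck_on_local:
  assumes "open U" "\<And>x. x \<in> U \<Longrightarrow> \<exists>V. open V \<and> x \<in> V \<and> V \<subseteq> U \<and> Ck_on k V f"
  shows "Ck_on k U f"
  using assms(2)
proof (induction k arbitrary: f)
  case 0
  then show ?case
    by (simp add: continuous_on_eq_continuous_at assms(1)) (metis continuous_on_eq_continuous_at)
next
  case (Suc k)
  have "f differentiable (at x)" if "x \<in> U" for x
    using Suc.prems[OF that] by (auto simp: differentiable_on_eq_differentiable_at)
  moreover have "Ck_on k U (\<lambda>x. frechet_derivative f (at x) v)" for v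
    using Suc.prems by (intro Suc.IH) fastforce
  ultimately show ?case by (auto simp: differentiable_on_eq_differentiable_at assms(1))
qed

lemma Ck_on_const: "open U \<Longrightarrow> Ck_on k U (\<lambda>x. c)"
  by (induction k arbitrary: c) (auto intro!: Ck_on_SucI[of _ _ "\<lambda>x v. 0"] simp del: Ck_on.simps(2))

lemma Ck_on_bounded_linear:
  assumes "open U" "bounded_linear f"
  shows "Ck_on k U f"
proof (cases k)
  case 0
  then show ?thesis by (simp add: linear_continuous_on assms)
next
  case (Suc k)
  show ?thesis unfolding Suc
    by (rule Ck_on_SucI[where f'="\<lambda>x. f"]) (auto intro: Ck_on_const bounded_linear_imp_has_derivative assms)
qed

lemma Ck_on_add:
  assumes "open U" "Ck_on k U f" "Ck_on k U g"
  shows "Ck_on k U (\<lambda>x. f x + g x)"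
  using assms(2,3)
proof (induction k arbitrary: f g)
  case 0
  then show ?case by (auto intro: continuous_on_add)
next
  case (Suc k)
  show ?case
    by (rule Ck_on_SucI[OF assms(1) has_derivative_add[OF Ck_on_SucD Ck_on_SucD]])
      (use Suc assms(1) in auto)
qed

lemma Ck_on_sum:
  assumes "open U" "\<And>i. i \<in> I \<Longrightarrow> Ck_on k U (f i)"
  shows "Ck_on k U (\<lambda>x. \<Sum>i\<in>I. f i x)"
  using assms(2)
  by (induction I rule: infinite_finite_induct) (auto intro!: Ck_on_add Ck_on_const assms(1))

text \<open>The product rule leaves one factor undifferentiated; lowering its order with
  \<open>Ck_on_lower\<close> makes the induction hypothesis applicable to both summands.\<close>

lemma Ck_on_bilinear:
  fixes pr :: "'b::euclidean_space \<Rightarrow> 'c::euclidean_space \<Rightarrow> 'd::euclidean_space"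
  assumes "bounded_bilinear pr" "open U" "Ck_on k U f" "Ck_on k U g"
  shows "Ck_on k U (\<lambda>x. pr (f x) (g x))"
  using assms(3,4)
proof (induction k arbitrary: f g)
  case 0
  then show ?case by (auto intro: bounded_bilinear.continuous_on[OF assms(1)])
next
  case (Suc k)
  show ?case
  proof (rule Ck_on_SucI[OF assms(2) bounded_bilinear.FDERIV[OF assms(1) Ck_on_SucD Ck_on_SucD]])
    show "Ck_on k U (\<lambda>x. pr (f x) (frechet_derivative g (at x) v)
        + pr (frechet_derivative f (at x) v) (g x))" for v
      using Suc.prems Ck_on_lower[OF Suc.prems(1)] Ck_on_lower[OF Suc.prems(2)]
      by (intro Ck_on_add assms(2) Suc.IH) auto
  qed (use Suc assms(2) in auto)
qed

lemmas Ck_on_inner = Ck_on_bilinear[OF bounded_bilinear_inner]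
lemmas Ck_on_scaleR = Ck_on_bilinear[OF bounded_bilinear_scaleR]

lemma linear_Basis_expansion:
  assumes "linear D"
  shows "D w = (\<Sum>b\<in>Basis. (w \<bullet> b) *\<^sub>R D b)"
proof -
  have "D w = D (\<Sum>b\<in>Basis. (w \<bullet> b) *\<^sub>R b)"
    by (simp add: euclidean_representation)
  also have "\<dots> = (\<Sum>b\<in>Basis. (w \<bullet> b) *\<^sub>R D b)"
    using assms by (simp add: linear_sum linear_cmul)
  finally show ?thesis .
qed

text \<open>\<open>Ck_on\<close> speaks of derivatives in fixed directions, but the chain rule
  differentiates g in a direction that moves with x. Expanding that direction in the basis leaves
  scalar coefficients times derivatives of g in fixed directions, which the induction
  covers.\<close>

lemma Ck_on_compose:
  assumes "open U" "open V" "f ` U \<subseteq> V" "Ck_on k U f" "Ck_on k V g"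
  shows "Ck_on k U (\<lambda>x. g (f x))"
  using assms(4,5)
proof (induction k arbitrary: g)
  case 0
  then show ?case using continuous_on_compose2[of V g U f] assms(3) by simp
next
  case (Suc k)
  have Dg: "(g has_derivative frechet_derivative g (at (f x))) (at (f x))" if "x \<in> U" for x
    using Ck_on_SucD[OF Suc.prems(2) assms(2), of "f x"] assms(3) that by blast
  have comp: "((\<lambda>x. g (f x)) has_derivative
      (\<lambda>v. \<Sum>b\<in>Basis. (frechet_derivative f (at x) v \<bullet> b) *\<^sub>R frechet_derivative g (at (f x)) b)) (at x)"
    if "x \<in> U" for x
  proof -
    have "((\<lambda>x. g (f x)) has_derivative
        (\<lambda>v. frechet_derivative g (at (f x)) (frechet_derivative f (at x) v))) (at x)"
      using diff_chain_at[OF Ck_on_SucD[OF Suc.prems(1) assms(1) that] Dg[OF that]] by (simp add: o_def)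
    then show ?thesis
      by (rule has_derivative_eq_rhs) (rule ext, rule linear_Basis_expansion[OF has_derivative_linear[OF Dg[OF that]]])
  qed
  have "Ck_on k U f" using Suc.prems(1) by (rule Ck_on_lower)
  then show ?case
    using Suc.prems by (intro Ck_on_SucI[OF assms(1) comp] Ck_on_sum Ck_on_scaleR Ck_on_inner Ck_on_const assms(1) Suc.IH) auto
qed

lemma Ck_on_Pair:
  assumes "open U" "Ck_on k U f" "Ck_on k U g"
  shows "Ck_on k U (\<lambda>x. (f x, g x))"
proof -
  have 1: "bounded_linear (\<lambda>x. (x, 0))" and 2: "bounded_linear (\<lambda>x. (0, x))"
    by (auto intro!: bounded_linear_Pair bounded_linear_ident bounded_linear_zero)
  have "Ck_on k U (\<lambda>x. (f x, 0) + (0, g x))"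
    using assms by (intro Ck_on_add Ck_on_compose[OF _ _ _ _ Ck_on_bounded_linear[OF open_UNIV 1], of U f]
      Ck_on_compose[OF _ _ _ _ Ck_on_bounded_linear[OF open_UNIV 2], of U g]) auto
  then show ?thesis by simp
qed

text \<open>The exponent stays arbitrary in the induction because each derivative lowers it by
  one.\<close>

lemma Ck_on_powr: "Ck_on k {0<..} (\<lambda>x::real. x powr a)"
proof (induction k arbitrary: a)
  case 0
  then show ?case by (auto intro!: continuous_intros)
next
  case (Suc k)
  have *: "((\<lambda>x::real. x powr a) has_derivative (\<lambda>v. (a * v) *\<^sub>R x powr (a - 1))) (at x)" if "x > 0" for x
    using has_real_derivative_powr[OF that, of a] unfolding has_field_derivative_def
    by (rule has_derivative_eq_rhs) (auto simp: fun_eq_iff)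
  show ?case
    by (rule Ck_on_SucI[OF open_greaterThan *], simp, intro Ck_on_scaleR Ck_on_const Suc open_greaterThan)
qed

lemma Ck_on_cos_sin: "Ck_on k UNIV (cos :: real \<Rightarrow> real) \<and> Ck_on k UNIV (sin :: real \<Rightarrow> real)"
proof (induction k)
  case 0
  then show ?case by (auto intro!: continuous_intros)
next
  case (Suc k)
  have 1: "((cos::real\<Rightarrow>real) has_derivative (\<lambda>v. (-v) *\<^sub>R sin x)) (at x)" for x
    using DERIV_cos[of x] unfolding has_field_derivative_def
    by (rule has_derivative_eq_rhs) (auto simp: fun_eq_iff)
  have 2: "((sin::real\<Rightarrow>real) has_derivative (\<lambda>v. v *\<^sub>R cos x)) (at x)" for x
    using DERIV_sin[of x] unfolding has_field_derivative_def
    by (rule has_derivative_eq_rhs) (auto simp: fun_eq_iff)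
  show ?case
    using Suc by (auto intro!: Ck_on_SucI[OF open_UNIV 1] Ck_on_SucI[OF open_UNIV 2] Ck_on_scaleR Ck_on_const simp del: Ck_on.simps)
qed


section \<open>Calculus of smooth functions on open sets\<close>

definition Cinf_on :: "'a::euclidean_space set \<Rightarrow> ('a \<Rightarrow> 'b::euclidean_space) \<Rightarrow> bool" where
  "Cinf_on U f \<longleftrightarrow> open U \<and> (\<forall>k. Ck_on k U f)"

lemma Cinf_on_open: "Cinf_on U f \<Longrightarrow> open U"
  by (simp add: Cinf_on_def)

lemma Cinf_on_cong: "Cinf_on U f \<Longrightarrow> (\<And>x. x \<in> U \<Longrightarrow> f x = g x) \<Longrightarrow> Cinf_on U g"
  unfolding Cinf_on_def using Ck_on_cong by blast

lemma Cinf_on_subset: "Cinf_on U f \<Longrightarrow> open V \<Longrightarrow> V \<subseteq> U \<Longrightarrow> Cinf_on V f"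
  unfolding Cinf_on_def using Ck_on_subset by blast

lemma Cinf_on_local:
  assumes "open U" "\<And>x. x \<in> U \<Longrightarrow> \<exists>V. x \<in> V \<and> V \<subseteq> U \<and> Cinf_on V f"
  shows "Cinf_on U f"
  unfolding Cinf_on_def
proof (intro conjI allI assms(1) Ck_on_local)
  show "\<exists>V. open V \<and> x \<in> V \<and> V \<subseteq> U \<and> Ck_on k V f" if "x \<in> U" for k x
    using assms(2)[OF that] by (auto simp: Cinf_on_def)
qed

lemma Cinf_on_has_derivative:
  "Cinf_on U f \<Longrightarrow> x \<in> U \<Longrightarrow> (f has_derivative frechet_derivative f (at x)) (at x)"
  unfolding Cinf_on_def by (metis Ck_on_SucD)

lemma Cinf_on_continuous: "Cinf_on U f \<Longrightarrow> continuous_on U f"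
  unfolding Cinf_on_def by (metis Ck_on.simps(1))

lemma Cinf_on_frechet: "Cinf_on U f \<Longrightarrow> Cinf_on U (\<lambda>x. frechet_derivative f (at x) v)"
  unfolding Cinf_on_def by (metis Ck_on.simps(2))

lemma Cinf_on_const: "open U \<Longrightarrow> Cinf_on U (\<lambda>x. c)"
  by (simp add: Cinf_on_def Ck_on_const)

lemma Cinf_on_bounded_linear: "open U \<Longrightarrow> bounded_linear f \<Longrightarrow> Cinf_on U f"
  by (simp add: Cinf_on_def Ck_on_bounded_linear)

lemma Cinf_on_add: "Cinf_on U f \<Longrightarrow> Cinf_on U g \<Longrightarrow> Cinf_on U (\<lambda>x. f x + g x)"
  by (simp add: Cinf_on_def Ck_on_add)

lemma Cinf_on_inner: "Cinf_on U f \<Longrightarrow> Cinf_on U g \<Longrightarrow> Cinf_on U (\<lambda>x. f x \<bullet> g x)"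
  by (simp add: Cinf_on_def Ck_on_inner)

lemma Cinf_on_scaleR: "Cinf_on U f \<Longrightarrow> Cinf_on U g \<Longrightarrow> Cinf_on U (\<lambda>x. f x *\<^sub>R g x)"
  by (simp add: Cinf_on_def Ck_on_scaleR)

lemma Cinf_on_mult: "Cinf_on U f \<Longrightarrow> Cinf_on U g \<Longrightarrow> Cinf_on U (\<lambda>x. f x * g x :: real)"
  using Cinf_on_scaleR[of U f g] by simp

lemma Cinf_on_minus: "Cinf_on U f \<Longrightarrow> Cinf_on U (\<lambda>x. - f x)"
  using Cinf_on_scaleR[of U "\<lambda>x. -1" f] by (simp add: Cinf_on_const Cinf_on_open)

lemma Cinf_on_diff: "Cinf_on U f \<Longrightarrow> Cinf_on U g \<Longrightarrow> Cinf_on U (\<lambda>x. f x - g x)"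
  using Cinf_on_add[of U f "\<lambda>x. - g x"] by (simp add: Cinf_on_minus)

lemma Cinf_on_sum: "open U \<Longrightarrow> (\<And>i. i \<in> I \<Longrightarrow> Cinf_on U (f i)) \<Longrightarrow> Cinf_on U (\<lambda>x. \<Sum>i\<in>I. f i x)"
  by (simp add: Cinf_on_def Ck_on_sum)

lemma Cinf_on_Pair: "Cinf_on U f \<Longrightarrow> Cinf_on U g \<Longrightarrow> Cinf_on U (\<lambda>x. (f x, g x))"
  by (simp add: Cinf_on_def Ck_on_Pair)

lemma Cinf_on_compose:
  "Cinf_on V g \<Longrightarrow> Cinf_on U f \<Longrightarrow> (\<And>x. x \<in> U \<Longrightarrow> f x \<in> V) \<Longrightarrow> Cinf_on U (\<lambda>x. g (f x))"
  unfolding Cinf_on_def by (auto intro!: Ck_on_compose[of U V f _ g])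

lemma Cinf_on_linear_compose:
  "bounded_linear L \<Longrightarrow> Cinf_on U f \<Longrightarrow> Cinf_on U (\<lambda>x. L (f x))"
  by (rule Cinf_on_compose[OF Cinf_on_bounded_linear[OF open_UNIV]]) auto

lemma Cinf_on_ident: "open U \<Longrightarrow> Cinf_on U (\<lambda>x. x)"
  by (simp add: Cinf_on_bounded_linear)

lemma Cinf_on_fst: "open U \<Longrightarrow> Cinf_on U fst"
  and Cinf_on_snd: "open U \<Longrightarrow> Cinf_on U snd"
  by (auto intro: Cinf_on_bounded_linear bounded_linear_fst bounded_linear_snd)

lemma Cinf_on_cos: "Cinf_on U f \<Longrightarrow> Cinf_on U (\<lambda>x. cos (f x :: real))"
  and Cinf_on_sin: "Cinf_on U f \<Longrightarrow> Cinf_on U (\<lambda>x. sin (f x :: real))"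
  using Cinf_on_compose[of UNIV cos U f] Cinf_on_compose[of UNIV sin U f]
  by (simp_all add: Cinf_on_def Ck_on_cos_sin)

lemma Cinf_on_powr:
  fixes f :: "'a::euclidean_space \<Rightarrow> real"
  shows "Cinf_on U f \<Longrightarrow> (\<And>x. x \<in> U \<Longrightarrow> f x > 0) \<Longrightarrow> Cinf_on U (\<lambda>x. f x powr a)"
  using Cinf_on_compose[of "{0::real<..}" "\<lambda>x. x powr a" U f] by (simp add: Cinf_on_def Ck_on_powr)

lemma Cinf_on_inverse:
  fixes f :: "'a::euclidean_space \<Rightarrow> real"
  assumes "Cinf_on U f" "\<And>x. x \<in> U \<Longrightarrow> f x > 0"
  shows "Cinf_on U (\<lambda>x. inverse (f x))"
  by (rule Cinf_on_cong[OF Cinf_on_powr[OF assms, of "-1"]]) (use assms(2) in \<open>auto simp: powr_minus powr_one less_imp_le\<close>)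

text \<open>The inverse norm is the power -1/2 of the squared norm. It makes the radial retraction
  onto a sphere smooth away from the origin.\<close>

lemma Cinf_on_inverse_norm:
  assumes "Cinf_on U f" "\<And>x. x \<in> U \<Longrightarrow> f x \<noteq> 0"
  shows "Cinf_on U (\<lambda>x. inverse (norm (f x)))"
proof (rule Cinf_on_cong[OF Cinf_on_powr[OF Cinf_on_inner[OF assms(1) assms(1)], of "-1/2"]])
  show "(f x \<bullet> f x) powr (- 1 / 2) = inverse (norm (f x))" if "x \<in> U" for x
    by (simp add: powr_minus powr_half_sqrt norm_eq_sqrt_inner)
qed (use assms(2) in auto)

lemma linear_Basis_sum:
  "linear D \<Longrightarrow> (\<Sum>b\<in>Basis. (w \<bullet> b) *\<^sub>R D b) = D w"
  using linear_Basis_expansion[of D w] by simp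

lemma Cinf_on_frechet_field:
  assumes "Cinf_on U f" "Cinf_on U w"
  shows "Cinf_on U (\<lambda>x. frechet_derivative f (at x) (w x))"
proof (rule Cinf_on_cong)
  show "Cinf_on U (\<lambda>x. \<Sum>b\<in>Basis. (w x \<bullet> b) *\<^sub>R frechet_derivative f (at x) b)"
    using assms by (intro Cinf_on_sum Cinf_on_scaleR Cinf_on_inner Cinf_on_frechet Cinf_on_const) (auto simp: Cinf_on_open)
qed (auto intro!: linear_Basis_sum has_derivative_linear Cinf_on_has_derivative[OF assms(1)])

text \<open>Product rule for \<open>x \<mapsto> D f(x) (w x)\<close>: the first summand differentiates with \<open>w\<close> frozen.\<close>

lemma has_derivative_frechet_field:
  assumes "Cinf_on U f" "x \<in> U" "(w has_derivative w') (at x)"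
  shows "((\<lambda>y. frechet_derivative f (at y) (w y)) has_derivative
    (\<lambda>v. frechet_derivative (\<lambda>y. frechet_derivative f (at y) (w x)) (at x) v
       + frechet_derivative f (at x) (w' v))) (at x)"
proof -
  let ?D = "\<lambda>y. frechet_derivative f (at y)"
  note lin = has_derivative_linear[OF Cinf_on_has_derivative[OF assms(1)]]
  have D: "((\<lambda>y. ?D y b) has_derivative frechet_derivative (\<lambda>y. ?D y b) (at x)) (at x)" for b
    using Cinf_on_has_derivative[OF Cinf_on_frechet[OF assms(1)] assms(2)] .
  have main: "((\<lambda>y. \<Sum>b\<in>Basis. (w y \<bullet> b) *\<^sub>R ?D y b) has_derivative
     (\<lambda>v. \<Sum>b\<in>Basis. (w x \<bullet> b) *\<^sub>R frechet_derivative (\<lambda>y. ?D y b) (at x) v + (w' v \<bullet> b) *\<^sub>R ?D x b)) (at x)"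
    by (auto intro!: derivative_eq_intros D assms(3))
  \<comment> \<open>With the direction held fixed, the second derivative is linear in that
    direction. This identifies the first half of the sum in \<open>main\<close> without reference to
    a basis.\<close>
  have frozen: "frechet_derivative (\<lambda>y. ?D y u) (at x) v
     = (\<Sum>b\<in>Basis. (u \<bullet> b) *\<^sub>R frechet_derivative (\<lambda>y. ?D y b) (at x) v)" for u v
  proof -
    have "((\<lambda>y. \<Sum>b\<in>Basis. (u \<bullet> b) *\<^sub>R ?D y b) has_derivative
     (\<lambda>v. \<Sum>b\<in>Basis. (u \<bullet> b) *\<^sub>R frechet_derivative (\<lambda>y. ?D y b) (at x) v)) (at x)"
      by (auto intro!: derivative_eq_intros D)
    then have "((\<lambda>y. ?D y u) has_derivative
     (\<lambda>v. \<Sum>b\<in>Basis. (u \<bullet> b) *\<^sub>R frechet_derivative (\<lambda>y. ?D y b) (at x) v)) (at x)"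
      by (rule has_derivative_transform_within_open[OF _ Cinf_on_open[OF assms(1)] assms(2)])
        (simp add: linear_Basis_sum[OF lin])
    then show ?thesis by (simp add: frechet_derivative_eqI)
  qed
  have "((\<lambda>y. ?D y (w y)) has_derivative
     (\<lambda>v. \<Sum>b\<in>Basis. (w x \<bullet> b) *\<^sub>R frechet_derivative (\<lambda>y. ?D y b) (at x) v + (w' v \<bullet> b) *\<^sub>R ?D x b)) (at x)"
    by (rule has_derivative_transform_within_open[OF main Cinf_on_open[OF assms(1)] assms(2)])
      (simp add: linear_Basis_sum[OF lin])
  moreover have "(\<Sum>b\<in>Basis. (w x \<bullet> b) *\<^sub>R frechet_derivative (\<lambda>y. ?D y b) (at x) v + (w' v \<bullet> b) *\<^sub>R ?D x b)
     = frechet_derivative (\<lambda>y. ?D y (w x)) (at x) v + ?D x (w' v)" for v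
    unfolding sum.distrib frozen[of "w x" v] linear_Basis_sum[OF lin[OF assms(2)]] ..
  ultimately show ?thesis by (simp add: fun_eq_iff)
qed

section \<open>Symmetry of second derivatives\<close>

lemma second_difference_eq:
  fixes f :: "'a::euclidean_space \<Rightarrow> real"
  assumes f: "Cinf_on U f" and "h > 0" and sub: "ball z e \<subseteq> U" and small: "h * (norm u + norm v) < e"
  shows "\<exists>y. dist y z \<le> h * (norm u + norm v) \<and>
    f (z + h *\<^sub>R u + h *\<^sub>R v) - f (z + h *\<^sub>R u) - f (z + h *\<^sub>R v) + f z
      = h\<^sup>2 * frechet_derivative (\<lambda>y. frechet_derivative f (at y) u) (at y) v"
proof -
  let ?D = "\<lambda>y. frechet_derivative f (at y)"
  have near: "dist (z + s *\<^sub>R u + t *\<^sub>R v) z \<le> h * (norm u + norm v)" if "0 \<le> s" "s \<le> h" "0 \<le> t" "t \<le> h" for s t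
  proof -
    have "dist (z + s *\<^sub>R u + t *\<^sub>R v) z = norm (s *\<^sub>R u + t *\<^sub>R v)" by (simp add: dist_norm)
    also have "\<dots> \<le> s * norm u + t * norm v" using norm_triangle_ineq[of "s *\<^sub>R u" "t *\<^sub>R v"] that by simp
    also have "\<dots> \<le> h * norm u + h * norm v" by (intro add_mono mult_right_mono that) auto
    finally show ?thesis by (simp add: algebra_simps)
  qed
  have mem: "z + s *\<^sub>R u + t *\<^sub>R v \<in> U" if "0 \<le> s" "s \<le> h" "0 \<le> t" "t \<le> h" for s t
    using near[OF that] small sub by (auto simp: subset_iff dist_commute)
  have along: "((\<lambda>s. g (w + s *\<^sub>R d)) has_real_derivative frechet_derivative g (at (w + s *\<^sub>R d)) d) (at s)"
    if "Cinf_on U g" "w + s *\<^sub>R d \<in> U" for g :: "'a \<Rightarrow> real" and w d s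
  proof -
    have "((\<lambda>s. g (w + s *\<^sub>R d)) has_derivative (\<lambda>r. frechet_derivative g (at (w + s *\<^sub>R d)) (r *\<^sub>R d))) (at s)"
      by (rule has_derivative_compose[where g=g and f="\<lambda>s. w + s *\<^sub>R d", OF _ Cinf_on_has_derivative[OF that]])
        (auto intro!: derivative_eq_intros)
    then show ?thesis
      unfolding has_field_derivative_def
      by (rule has_derivative_eq_rhs)
        (auto simp: fun_eq_iff linear_cmul[OF has_derivative_linear[OF Cinf_on_has_derivative[OF that]]])
  qed
  \<comment> \<open>The second difference is the increment over the interval from 0 to h of this
    function of s, so the mean value theorem in direction u applies; a second use in direction v
    produces the mixed derivative.\<close>
  have 1: "((\<lambda>s. f (z + h *\<^sub>R v + s *\<^sub>R u) - f (z + s *\<^sub>R u)) has_real_derivative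
     ?D (z + h *\<^sub>R v + s *\<^sub>R u) u - ?D (z + s *\<^sub>R u) u) (at s)" if "0 \<le> s" "s \<le> h" for s
    using mem[OF that, of h] mem[OF that, of 0] \<open>h > 0\<close>
    by (intro DERIV_diff along f) (auto simp: algebra_simps)
  obtain s where s: "0 < s" "s < h" and
    "f (z + h *\<^sub>R v + h *\<^sub>R u) - f (z + h *\<^sub>R u) - (f (z + h *\<^sub>R v + 0 *\<^sub>R u) - f (z + 0 *\<^sub>R u))
      = (h - 0) * (?D (z + h *\<^sub>R v + s *\<^sub>R u) u - ?D (z + s *\<^sub>R u) u)"
    using MVT2[OF \<open>h > 0\<close> 1] by blast
  then have e1: "f (z + h *\<^sub>R u + h *\<^sub>R v) - f (z + h *\<^sub>R u) - f (z + h *\<^sub>R v) + f z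
      = h * (?D (z + s *\<^sub>R u + h *\<^sub>R v) u - ?D (z + s *\<^sub>R u) u)"
    by (simp add: algebra_simps)
  have 2: "((\<lambda>t. ?D (z + s *\<^sub>R u + t *\<^sub>R v) u) has_real_derivative
     frechet_derivative (\<lambda>y. ?D y u) (at (z + s *\<^sub>R u + t *\<^sub>R v)) v) (at t)" if "0 \<le> t" "t \<le> h" for t
    using mem[of s t] that s by (intro along Cinf_on_frechet f) auto
  obtain t where t: "0 < t" "t < h" and
    "?D (z + s *\<^sub>R u + h *\<^sub>R v) u - ?D (z + s *\<^sub>R u + 0 *\<^sub>R v) u
     = (h - 0) * frechet_derivative (\<lambda>y. ?D y u) (at (z + s *\<^sub>R u + t *\<^sub>R v)) v"
    using MVT2[OF \<open>h > 0\<close> 2] by blast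
  then show ?thesis
    using e1 near[of s t] s by (auto intro!: exI[of _ "z + s *\<^sub>R u + t *\<^sub>R v"] simp: power2_eq_square)
qed

text \<open>The second difference is symmetric in u and v. Evaluated in both orders it equates the
  two mixed derivatives at two possibly different points near z, and continuity moves both points to
  z.\<close>

lemma Cinf_on_mixed_derivative_real:
  fixes f :: "'a::euclidean_space \<Rightarrow> real"
  assumes f: "Cinf_on U f" and z: "z \<in> U"
  shows "frechet_derivative (\<lambda>y. frechet_derivative f (at y) u) (at z) v
       = frechet_derivative (\<lambda>y. frechet_derivative f (at y) v) (at z) u"
proof -
  define g where "g = (\<lambda>u v y. frechet_derivative (\<lambda>y. frechet_derivative f (at y) u) (at y) v)"
  have "isCont (g u v) z" for u v
    unfolding g_def using f z
    by (metis Cinf_on_continuous Cinf_on_frechet Cinf_on_open continuous_on_eq_continuous_at)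
  then have cont: "\<exists>d>0. \<forall>y. dist y z < d \<longrightarrow> \<bar>g u v y - g u v z\<bar> < \<epsilon>" if "\<epsilon> > 0" for u v \<epsilon>
    using that unfolding continuous_at_eps_delta dist_real_def by metis
  obtain e where e: "e > 0" "ball z e \<subseteq> U"
    using z Cinf_on_open[OF f] openE by blast
  have "\<bar>g u v z - g v u z\<bar> \<le> \<epsilon>" if "\<epsilon> > 0" for \<epsilon>
  proof -
    have half: "\<epsilon> / 2 > 0" using that by simp
    obtain d1 where d1: "d1 > 0" "\<And>y. dist y z < d1 \<Longrightarrow> \<bar>g u v y - g u v z\<bar> < \<epsilon> / 2"
      using cont[OF half, of u v] by blast
    obtain d2 where d2: "d2 > 0" "\<And>y. dist y z < d2 \<Longrightarrow> \<bar>g v u y - g v u z\<bar> < \<epsilon> / 2"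
      using cont[OF half, of v u] by blast
    define m where "m = min e (min d1 d2)"
    \<comment> \<open>The summand 1 keeps the denominator positive when both directions vanish; the
      factor 1/2 makes the distance bound strict.\<close>
    define h where "h = m / 2 / (norm u + norm v + 1)"
    have "m > 0" using e d1 d2 by (simp add: m_def)
    have pos: "norm u + norm v + 1 > 0" by (simp add: add_nonneg_pos)
    then have "h > 0" using \<open>m > 0\<close> by (simp add: h_def)
    have "h * (norm u + norm v) \<le> h * (norm u + norm v + 1)" using \<open>h > 0\<close> by simp
    also have "\<dots> = m / 2" using pos unfolding h_def by (metis less_irrefl nonzero_eq_divide_eq)
    finally have hm: "h * (norm u + norm v) < m" using \<open>m > 0\<close> by simp
    then have he: "h * (norm u + norm v) < e" by (simp add: m_def)
    obtain y1 where y1: "dist y1 z \<le> h * (norm u + norm v)"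
      "f (z + h *\<^sub>R u + h *\<^sub>R v) - f (z + h *\<^sub>R u) - f (z + h *\<^sub>R v) + f z = h\<^sup>2 * g u v y1"
      using second_difference_eq[OF f \<open>h > 0\<close> e(2) he] unfolding g_def by blast
    have he': "h * (norm v + norm u) < e" using he by (simp add: add.commute)
    obtain y2 where y2: "dist y2 z \<le> h * (norm v + norm u)"
      "f (z + h *\<^sub>R v + h *\<^sub>R u) - f (z + h *\<^sub>R v) - f (z + h *\<^sub>R u) + f z = h\<^sup>2 * g v u y2"
      using second_difference_eq[OF f \<open>h > 0\<close> e(2) he'] unfolding g_def by blast
    have "f (z + h *\<^sub>R v + h *\<^sub>R u) = f (z + h *\<^sub>R u + h *\<^sub>R v)" by (simp add: add.commute add.left_commute)
    then have "h\<^sup>2 * g u v y1 = h\<^sup>2 * g v u y2"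
      using y1(2) y2(2) by linarith
    then have "g u v y1 = g v u y2" using \<open>h > 0\<close> by simp
    moreover have "dist y1 z < d1" "dist y2 z < d2"
      using y1 y2 hm by (auto simp: m_def add.commute)
    ultimately show ?thesis
      using d1(2)[of y1] d2(2)[of y2] by linarith
  qed
  then have "\<bar>g u v z - g v u z\<bar> \<le> 0" by (rule field_le_epsilon) simp
  then show ?thesis by (simp add: g_def)
qed

text \<open>The mean value theorem behind the real case has no vector-valued form, so the components
  are treated one at a time.\<close>

lemma Cinf_on_mixed_derivative:
  fixes f :: "'a::euclidean_space \<Rightarrow> 'b::euclidean_space"
  assumes f: "Cinf_on U f" and z: "z \<in> U"
  shows "frechet_derivative (\<lambda>y. frechet_derivative f (at y) u) (at z) v
       = frechet_derivative (\<lambda>y. frechet_derivative f (at y) v) (at z) u"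
proof (rule euclidean_eqI)
  fix b :: 'b assume "b \<in> Basis"
  have fb: "Cinf_on U (\<lambda>y. f y \<bullet> b)"
    using f by (intro Cinf_on_inner Cinf_on_const Cinf_on_open)
  have 1: "frechet_derivative (\<lambda>y. f y \<bullet> b) (at y) u = frechet_derivative f (at y) u \<bullet> b" if "y \<in> U" for y u
    using frechet_derivative_eqI[OF has_derivative_inner_left[OF Cinf_on_has_derivative[OF f that]], of b] by simp
  have 2: "frechet_derivative (\<lambda>y. frechet_derivative (\<lambda>y. f y \<bullet> b) (at y) u) (at z) v
      = frechet_derivative (\<lambda>y. frechet_derivative f (at y) u) (at z) v \<bullet> b" for u v
  proof -
    have "((\<lambda>y. frechet_derivative (\<lambda>y. f y \<bullet> b) (at y) u) has_derivative
       (\<lambda>v. frechet_derivative (\<lambda>y. frechet_derivative f (at y) u) (at z) v \<bullet> b)) (at z)"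
      by (rule has_derivative_transform_within_open[OF
            has_derivative_inner_left[OF Cinf_on_has_derivative[OF Cinf_on_frechet[OF f] z]] Cinf_on_open[OF f] z])
        (simp add: 1)
    then show ?thesis by (simp add: frechet_derivative_eqI)
  qed
  show "frechet_derivative (\<lambda>y. frechet_derivative f (at y) u) (at z) v \<bullet> b
       = frechet_derivative (\<lambda>y. frechet_derivative f (at y) v) (at z) u \<bullet> b"
    using Cinf_on_mixed_derivative_real[OF fb z, of u v] by (simp add: 2)
qed


subsection \<open>Tangent spaces of spheres\<close>

lemma smooth_onI:
  assumes "Cinf_on U F" "S \<subseteq> U" "\<And>x. x \<in> S \<Longrightarrow> F x = f x"
  shows "smooth_on S f"
  unfolding smooth_on_def
proof (intro ballI exI conjI)
  show "open U" "\<forall>k. Ck_on k U F" using assms(1) by (auto simp: Cinf_on_def)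
qed (use assms(2,3) in auto)

lemma smooth_onE:
  assumes "smooth_on S f" "p \<in> S"
  obtains U F where "p \<in> U" "Cinf_on U F" "\<And>x. x \<in> S \<inter> U \<Longrightarrow> F x = f x"
proof -
  have "\<exists>U F. open U \<and> p \<in> U \<and> (\<forall>k. Ck_on k U F) \<and> (\<forall>x\<in>S \<inter> U. F x = f x)"
    using assms unfolding smooth_on_def by (rule bspec)
  then show ?thesis using that by (elim exE conjE) (simp add: Cinf_on_def)
qed

lemma tangent_spaceE:
  assumes "v \<in> tangent_space S p"
  obtains \<gamma> :: "real \<Rightarrow> 'a::euclidean_space" and \<epsilon> where "0 < \<epsilon>" "smooth_map {-\<epsilon><..<\<epsilon>} S \<gamma>"
    "\<gamma> 0 = p" "(\<gamma> has_vector_derivative v) (at 0)"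
  using assms unfolding tangent_space_def mem_Collect_eq by (elim exE conjE)

lemma tangent_space_sphere:
  fixes p :: "'a::euclidean_space"
  assumes "p \<in> sphere 0 R" "R > 0"
  shows "tangent_space (sphere 0 R) p = {v. p \<bullet> v = 0}"
proof (intro equalityI subsetI)
  fix v assume "v \<in> tangent_space (sphere 0 R) p"
  then obtain \<gamma> :: "real \<Rightarrow> 'a" and \<epsilon> where \<gamma>: "0 < \<epsilon>" "smooth_map {-\<epsilon><..<\<epsilon>} (sphere 0 R) \<gamma>"
     "\<gamma> 0 = p" "(\<gamma> has_vector_derivative v) (at 0)"
    by (rule tangent_spaceE)
  have "((\<lambda>t. \<gamma> t \<bullet> \<gamma> t) has_vector_derivative (\<gamma> 0 \<bullet> v + v \<bullet> \<gamma> 0)) (at 0)"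
    by (rule bounded_bilinear.has_vector_derivative[OF bounded_bilinear_inner \<gamma>(4) \<gamma>(4)])
  moreover have "((\<lambda>t. \<gamma> t \<bullet> \<gamma> t) has_vector_derivative 0) (at 0)"
  proof (rule has_vector_derivative_transform_within_open[of "\<lambda>t. R\<^sup>2" _ _ "{-\<epsilon><..<\<epsilon>}"])
    show "R\<^sup>2 = \<gamma> t \<bullet> \<gamma> t" if "t \<in> {-\<epsilon><..<\<epsilon>}" for t
      using \<gamma>(2) that by (auto simp: smooth_map_def image_subset_iff dot_square_norm)
  qed (use \<gamma>(1) in auto)
  ultimately have "\<gamma> 0 \<bullet> v + v \<bullet> \<gamma> 0 = 0" by (rule vector_derivative_unique_at)
  then show "v \<in> {v. p \<bullet> v = 0}" by (simp add: \<gamma>(3) inner_commute)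
next
  fix v assume v: "v \<in> {v. p \<bullet> v = 0}"
  \<comment> \<open>Since p is orthogonal to v, \<open>q t\<close> is the squared norm of p + t v.
    The curve sought is this straight line projected radially back to the sphere.\<close>
  define q where "q = (\<lambda>t::real. R\<^sup>2 + t * t * (v \<bullet> v))"
  have q: "q t > 0" for t
    using assms(2) by (auto simp: q_def intro!: add_pos_nonneg)
  define \<gamma> where "\<gamma> = (\<lambda>t. (R * q t powr (-1/2)) *\<^sub>R (p + t *\<^sub>R v))"
  have "Cinf_on UNIV q" unfolding q_def
    by (intro Cinf_on_add Cinf_on_mult Cinf_on_const Cinf_on_ident open_UNIV)
  then have "Cinf_on UNIV \<gamma>" unfolding \<gamma>_def
    by (intro Cinf_on_scaleR Cinf_on_mult Cinf_on_powr Cinf_on_add Cinf_on_const Cinf_on_ident open_UNIV) (simp_all add: q)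
  then have "smooth_on {-1<..<1} \<gamma>" by (rule smooth_onI) auto
  moreover have "\<gamma> t \<in> sphere 0 R" for t
  proof -
    have pp: "p \<bullet> p = R\<^sup>2" using assms(1) by (simp add: dot_square_norm)
    have "(p + t *\<^sub>R v) \<bullet> (p + t *\<^sub>R v) = q t"
      using v pp by (simp add: q_def inner_simps inner_commute mult_ac)
    then have "norm (p + t *\<^sub>R v) = sqrt (q t)" by (simp add: norm_eq_sqrt_inner)
    then show ?thesis
      using assms(2) q[of t] by (simp add: \<gamma>_def powr_minus powr_half_sqrt divide_simps)
  qed
  moreover have "\<gamma> 0 = p"
    using assms(2) by (simp add: \<gamma>_def q_def powr_minus powr_half_sqrt)
  moreover have "(\<gamma> has_vector_derivative v) (at 0)"
  proof -
    have "(q has_real_derivative 0) (at 0)" unfolding q_def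
      by (auto intro!: derivative_eq_intros)
    then have "((\<lambda>t. R * q t powr (-1/2)) has_real_derivative 0) (at 0)"
      using q[of 0] by (auto intro!: derivative_eq_intros)
    then have "(\<gamma> has_vector_derivative (R * q 0 powr (-1/2)) *\<^sub>R v + 0 *\<^sub>R (p + 0 *\<^sub>R v)) (at 0)"
      unfolding \<gamma>_def by (intro has_vector_derivative_scaleR) (auto intro!: derivative_eq_intros)
    then show ?thesis
      using assms(2) by (simp add: q_def powr_minus powr_half_sqrt)
  qed
  ultimately show "v \<in> tangent_space (sphere 0 R) p"
    unfolding tangent_space_def smooth_map_def
    by (intro CollectI exI[of _ \<gamma>] exI[of _ 1]) auto
qed

text \<open>A derivative within S need not be unique, and \<open>frechet_derivative\<close> picks
  one by choice. Composed with a curve in S of velocity v, any two candidates give the same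
  derivative of a function of one real variable, so they agree on v. This permits replacing f by any
  differentiable local extension F.\<close>

lemma frechet_derivative_within_tangent:
  assumes F: "(F has_derivative D) (at p)" and U: "open U" "p \<in> U" "\<And>x. x \<in> S \<inter> U \<Longrightarrow> F x = f x"
    and "p \<in> S" "v \<in> tangent_space S p"
  shows "frechet_derivative f (at p within S) v = D v"
proof -
  obtain d where "d > 0" "ball p d \<subseteq> U" using U openE by blast
  have f: "(f has_derivative D) (at p within S)"
    by (rule has_derivative_transform_within[OF has_derivative_at_withinI[OF F] \<open>d > 0\<close> \<open>p \<in> S\<close>])
      (use \<open>ball p d \<subseteq> U\<close> U(3) in \<open>auto simp: subset_iff dist_commute\<close>)
  then have f': "(f has_derivative frechet_derivative f (at p within S)) (at p within S)"
    using differentiable_def frechet_derivative_works by blast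
  obtain \<gamma> \<epsilon> where \<gamma>: "0 < \<epsilon>" "smooth_map {-\<epsilon><..<\<epsilon>} S \<gamma>" "\<gamma> 0 = p"
    "(\<gamma> has_vector_derivative v) (at (0::real))"
    using assms(6) by (rule tangent_spaceE)
  have "((\<lambda>t. f (\<gamma> t)) has_vector_derivative D' v) (at 0)"
    if "(f has_derivative D') (at p within S)" for D'
  proof -
    have "(f has_derivative D') (at (\<gamma> 0) within \<gamma> ` {-\<epsilon><..<\<epsilon>})"
      using that \<gamma> by (auto simp: smooth_map_def intro: has_derivative_subset)
    moreover have "(\<gamma> has_derivative (\<lambda>h. h *\<^sub>R v)) (at 0 within {-\<epsilon><..<\<epsilon>})"
      using \<gamma>(4) unfolding has_vector_derivative_def by (rule has_derivative_at_withinI)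
    ultimately have "(f \<circ> \<gamma> has_derivative D' \<circ> (\<lambda>h. h *\<^sub>R v)) (at 0 within {-\<epsilon><..<\<epsilon>})"
      by (rule diff_chain_within[rotated])
    moreover have "at 0 within {-\<epsilon><..<\<epsilon>} = at 0"
      using \<gamma>(1) by (intro at_within_open) auto
    ultimately show ?thesis
      unfolding has_vector_derivative_def using has_derivative_linear[OF that]
      by (simp add: o_def linear_cmul)
  qed
  from this[OF f] this[OF f'] show ?thesis by (rule vector_derivative_unique_at[symmetric])
qed

text \<open>\<open>proj y\<close> is the orthogonal projection onto the complement of \<open>y\<close> only for unit vectors \<open>y\<close>.\<close>

definition proj :: "'b::real_inner \<Rightarrow> 'b \<Rightarrow> 'b" where
  "proj y w = w - (w \<bullet> y) *\<^sub>R y"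

lemma linear_proj: "linear (proj y)"
  by (rule linearI) (simp_all add: proj_def algebra_simps inner_add_left)

lemmas proj_simps = linear_add[OF linear_proj] linear_diff[OF linear_proj] linear_scale[OF linear_proj]
  linear_0[OF linear_proj] linear_neg[OF linear_proj] linear_sum[OF linear_proj]

lemma proj_self: "norm y = 1 \<Longrightarrow> proj y y = 0"
  by (simp add: proj_def dot_square_norm)

lemma proj_inner_self: "norm y = 1 \<Longrightarrow> proj y w \<bullet> y = 0"
  by (simp add: proj_def dot_square_norm inner_simps)

lemma closest_point_hyperplane:
  fixes y :: "'a::euclidean_space"
  assumes "y \<noteq> 0"
  shows "closest_point {v. y \<bullet> v = 0} w = w - ((w \<bullet> y) / (y \<bullet> y)) *\<^sub>R y"
proof -
  define c where "c = (w \<bullet> y) / (y \<bullet> y)"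
  have c: "y \<bullet> (w - c *\<^sub>R y) = 0" using assms by (simp add: c_def inner_simps inner_commute)
  have "w - c *\<^sub>R y = closest_point {v. y \<bullet> v = 0} w"
  proof (intro closest_point_unique convex_hyperplane closed_hyperplane ballI)
    fix z assume z: "z \<in> {v. y \<bullet> v = 0}"
    have "orthogonal (c *\<^sub>R y) (w - c *\<^sub>R y - z)"
      using z c by (simp add: orthogonal_def inner_diff_right)
    then have "(norm (c *\<^sub>R y + (w - c *\<^sub>R y - z)))\<^sup>2 = (norm (c *\<^sub>R y))\<^sup>2 + (norm (w - c *\<^sub>R y - z))\<^sup>2"
      by (rule norm_add_Pythagorean)
    then have "(norm (c *\<^sub>R y))\<^sup>2 \<le> (norm (w - z))\<^sup>2" by (simp add: algebra_simps)
    then show "dist w (w - c *\<^sub>R y) \<le> dist w z"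
      using power2_le_imp_le[of "norm (c *\<^sub>R y)" "norm (w - z)"] by (simp add: dist_norm)
  qed (use c in simp)
  then show ?thesis by (simp add: c_def)
qed

lemma closest_point_tangent_sphere:
  fixes p :: "'a::euclidean_space"
  assumes "p \<in> sphere 0 R" "R > 0"
  shows "closest_point (tangent_space (sphere 0 R) p) w = w - ((w \<bullet> p) / R\<^sup>2) *\<^sub>R p"
proof -
  have "p \<noteq> 0" "p \<bullet> p = R\<^sup>2" using assms by (auto simp: dot_square_norm)
  then show ?thesis using closest_point_hyperplane[of p w] tangent_space_sphere[OF assms] by simp
qed

lemma closest_point_tangent_unit_sphere:
  "y \<in> sphere 0 1 \<Longrightarrow> closest_point (tangent_space (sphere 0 1) y) w = proj y w"
  using closest_point_tangent_sphere[of y 1 w] by (simp add: proj_def)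

lemma dim_tangent_sphere:
  fixes p :: "'a::euclidean_space"
  assumes "p \<in> sphere 0 R" "R > 0"
  shows "dim (tangent_space (sphere 0 R) p) = DIM('a) - 1"
proof -
  have "p \<noteq> 0" using assms by auto
  then show ?thesis using tangent_space_sphere[OF assms] dim_hyperplane[of p] by simp
qed


subsection \<open>Orthonormal frames and traces\<close>

lemma orthonormal_family:
  fixes u :: "nat \<Rightarrow> 'a::euclidean_space"
  assumes "\<And>i j. i < m \<Longrightarrow> j < m \<Longrightarrow> u i \<bullet> u j = (if i = j then 1 else 0)"
  shows "inj_on u {..<m}" "pairwise orthogonal (u ` {..<m})" "\<And>b. b \<in> u ` {..<m} \<Longrightarrow> norm b = 1"
    "independent (u ` {..<m})"
proof -
  show 1: "inj_on u {..<m}"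
    by (rule inj_onI) (metis assms lessThan_iff zero_neq_one)
  show 2: "pairwise orthogonal (u ` {..<m})"
    using assms by (auto simp: pairwise_def orthogonal_def)
  show 3: "norm b = 1" if "b \<in> u ` {..<m}" for b
    using that assms by (auto simp: norm_eq_sqrt_inner)
  show "independent (u ` {..<m})"
    using 2 3 by (intro pairwise_orthogonal_independent) fastforce+
qed

text \<open>The frame around \<open>p\<close> is the image of an orthonormal basis of the tangent space at \<open>p\<close> under
  the reflections that map \<open>p\<close> to \<open>- q\<close>, for \<open>q\<close> near \<open>p\<close>.\<close>

lemma local_orthonormal_frame_exists:
  fixes p :: "'a::euclidean_space"
  assumes p: "p \<in> sphere 0 R" and R: "R > 0"
  shows "\<exists>e. local_orthonormal_frame (sphere 0 R) p e"
proof -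
  let ?M = "sphere (0::'a) R"
  define m where "m = dim (tangent_space ?M p)"
  have T: "tangent_space ?M q = {v. q \<bullet> v = 0}" if "q \<in> ?M" for q
    using tangent_space_sphere[OF that R] .
  obtain B where B: "B \<subseteq> {v. p \<bullet> v = 0}" "pairwise orthogonal B" "\<And>x. x \<in> B \<Longrightarrow> norm x = 1"
     "independent B" "card B = dim {v. p \<bullet> v = 0}" "span B = {v. p \<bullet> v = 0}"
    using orthonormal_basis_subspace[OF subspace_hyperplane] by metis
  have "finite B" using B(4) by (rule independent_imp_finite)
  then obtain b where b: "bij_betw b {..<m} B"
    using ex_bij_betw_nat_finite[of B] B(5) T[OF p] by (auto simp: m_def atLeast0LessThan)
  have bb: "b i \<bullet> b j = (if i = j then 1 else 0)" if "i < m" "j < m" for i j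
  proof (cases "i = j")
    case True
    then show ?thesis using B(3)[of "b i"] b that by (auto simp: bij_betw_def norm_eq_sqrt_inner)
  next
    case False
    then have "b i \<noteq> b j" using b that by (auto simp: bij_betw_def inj_on_def)
    then have "orthogonal (b i) (b j)"
      using B(2) b that by (intro pairwiseD[of orthogonal B]) (auto simp: bij_betw_def)
    then show ?thesis using False by (simp add: orthogonal_def)
  qed
  have bp: "b i \<bullet> p = 0" if "i < m" for i
    using B(1) b that by (auto simp: bij_betw_def inner_commute)
  \<comment> \<open>On the sphere this excludes exactly the point antipodal to p.\<close>
  define U where "U = {q. 0 < R\<^sup>2 + p \<bullet> q}"
  \<comment> \<open>The reflection of \<open>b i\<close> in the hyperplane orthogonal to p + q: on
    the sphere the squared norm of p + q is 2 (R^2 + p . q), and \<open>b i\<close> is orthogonal to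
    p.\<close>
  define e where "e = (\<lambda>i q. b i - ((b i \<bullet> q) * inverse (R\<^sup>2 + p \<bullet> q)) *\<^sub>R (p + q))"
  have "open U" unfolding U_def by (intro open_Collect_less continuous_intros)
  have pp: "p \<bullet> p = R\<^sup>2" using p by (simp add: dot_square_norm)
  then have "p \<in> U" using R by (simp add: U_def)
  have sm: "Cinf_on U (e i)" for i
    unfolding e_def using \<open>open U\<close>
    by (intro Cinf_on_diff Cinf_on_scaleR Cinf_on_mult Cinf_on_inverse Cinf_on_add Cinf_on_inner
        Cinf_on_const Cinf_on_ident) (auto simp: U_def)
  have ee: "e i q \<bullet> e j q = (if i = j then 1 else 0)" and eq: "q \<bullet> e i q = 0"
    if "i < m" "j < m" "q \<in> ?M \<inter> U" for i j q
  proof -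
    define s where "s = R\<^sup>2 + p \<bullet> q"
    have s: "s > 0" using that by (simp add: s_def U_def)
    have qq: "q \<bullet> q = R\<^sup>2" using that by (simp add: dot_square_norm)
    have 1: "b k \<bullet> (p + q) = b k \<bullet> q" if "k < m" for k using bp[OF that] by (simp add: inner_simps)
    have 2: "(p + q) \<bullet> (p + q) = 2 * s" using pp qq by (simp add: inner_simps s_def inner_commute)
    have "e i q \<bullet> e j q = b i \<bullet> b j - 2 * ((b i \<bullet> q) * (b j \<bullet> q) * inverse s)
        + ((b i \<bullet> q) * inverse s) * ((b j \<bullet> q) * inverse s) * ((p + q) \<bullet> (p + q))"
      unfolding e_def s_def[symmetric]
      using 1[OF \<open>i < m\<close>] 1[OF \<open>j < m\<close>]
      by (simp only: inner_diff_left inner_diff_right inner_scaleR_left inner_scaleR_right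
          inner_commute[of "p + q" "b j"]) (simp add: algebra_simps)
    also have "\<dots> = b i \<bullet> b j" unfolding 2 using s by (simp add: field_simps)
    finally show "e i q \<bullet> e j q = (if i = j then 1 else 0)" using bb that by simp
    have "q \<bullet> (p + q) = s" using qq by (simp add: inner_simps s_def inner_commute)
    then show "q \<bullet> e i q = 0"
      unfolding e_def s_def[symmetric] using s by (simp add: inner_diff_right inner_commute)
  qed
  have "span ((\<lambda>i. e i q) ` {..<m}) = tangent_space ?M q" if q: "q \<in> ?M \<inter> U" for q
  proof -
    note on = orthonormal_family[of m "\<lambda>i. e i q", OF ee[OF _ _ q]]
    have "(\<lambda>i. e i q) ` {..<m} \<subseteq> {v. q \<bullet> v = 0}" using eq q by blast
    then have "span ((\<lambda>i. e i q) ` {..<m}) \<subseteq> {v. q \<bullet> v = 0}"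
      by (rule span_minimal) (rule subspace_hyperplane)
    moreover have "dim (span ((\<lambda>i. e i q) ` {..<m})) = m"
      using on(1,4) by (simp add: dim_eq_card_independent card_image)
    moreover have "dim {v. q \<bullet> v = 0} = m"
      using dim_tangent_sphere[OF p R] dim_tangent_sphere[of q R] T[of q] q R by (simp add: m_def)
    ultimately have "span ((\<lambda>i. e i q) ` {..<m}) = {v. q \<bullet> v = 0}"
      by (intro subspace_dim_equal subspace_span subspace_hyperplane) auto
    then show ?thesis using T[of q] q by simp
  qed
  moreover have "smooth_on (?M \<inter> U) (e i)" for i using sm by (rule smooth_onI) auto
  ultimately show ?thesis
    unfolding local_orthonormal_frame_def Let_def m_def[symmetric]
    using \<open>open U\<close> \<open>p \<in> U\<close> ee by (intro exI[of _ e] exI[of _ U]) auto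
qed

text \<open>A tangent frame completed by p / |p| is an orthonormal basis of the whole space, and the
  trace of a bilinear map is the same in every orthonormal basis. The basis vectors are expanded in
  the completed frame and resummed by linearity.\<close>

lemma trace_orthonormal:
  fixes u :: "nat \<Rightarrow> 'a::euclidean_space" and B :: "'a \<Rightarrow> 'a \<Rightarrow> 'b::real_vector"
  assumes u: "\<And>i j. i < m \<Longrightarrow> j < m \<Longrightarrow> u i \<bullet> u j = (if i = j then 1 else 0)"
    and sp: "span (u ` {..<m}) = {v. p \<bullet> v = 0}" and p: "p \<noteq> 0" and B: "bilinear B"
  shows "(\<Sum>i<m. B (u i) (u i)) + (1 / (p \<bullet> p)) *\<^sub>R B p p = (\<Sum>b\<in>Basis. B b b)"
proof -
  note on = orthonormal_family[OF u]
  have up: "u i \<bullet> p = 0" if "i < m" for i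
    using span_base[of "u i" "u ` {..<m}"] that sp by (auto simp: inner_commute)
  then have pu: "p \<bullet> u i = 0" if "i < m" for i
    using that by (simp add: inner_commute)
  have ex: "x = (\<Sum>i<m. (x \<bullet> u i) *\<^sub>R u i) + ((x \<bullet> p) / (p \<bullet> p)) *\<^sub>R p" for x
  proof -
    let ?y = "x - ((x \<bullet> p) / (p \<bullet> p)) *\<^sub>R p"
    have "?y \<in> span (u ` {..<m})" using p by (simp add: sp inner_simps inner_commute)
    then have "(\<Sum>b\<in>u ` {..<m}. (?y \<bullet> b) *\<^sub>R b) = ?y"
      using on by (intro orthonormal_basis_expand) auto
    then have "(\<Sum>i<m. (?y \<bullet> u i) *\<^sub>R u i) = ?y" by (simp add: sum.reindex on(1))
    moreover have "(\<Sum>i<m. (?y \<bullet> u i) *\<^sub>R u i) = (\<Sum>i<m. (x \<bullet> u i) *\<^sub>R u i)"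
      by (rule sum.cong) (simp_all add: inner_diff_left pu)
    ultimately show ?thesis by (metis diff_add_cancel)
  qed
  have l: "linear (\<lambda>x. B x y)" and r: "linear (B x)" for x y using B by (auto simp: bilinear_def)
  have bs: "(\<Sum>b\<in>Basis. (b \<bullet> w) *\<^sub>R B x b) = B x w" for x w
    using linear_Basis_sum[OF r, of w] by (simp add: inner_commute)
  have b1: "B b b = (\<Sum>i<m. (b \<bullet> u i) *\<^sub>R B (u i) b) + ((b \<bullet> p) / (p \<bullet> p)) *\<^sub>R B p b" for b
    using arg_cong[OF ex[of b], of "\<lambda>x. B x b"] by (simp add: linear_add[OF l] linear_sum[OF l] linear_cmul[OF l])
  have "(\<Sum>b\<in>Basis. B b b)
     = (\<Sum>b\<in>Basis. (\<Sum>i<m. (b \<bullet> u i) *\<^sub>R B (u i) b) + ((b \<bullet> p) / (p \<bullet> p)) *\<^sub>R B p b)"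
    by (rule sum.cong[OF refl b1])
  also have "\<dots> = (\<Sum>i<m. \<Sum>b\<in>Basis. (b \<bullet> u i) *\<^sub>R B (u i) b)
      + (\<Sum>b\<in>Basis. (1 / (p \<bullet> p)) *\<^sub>R ((b \<bullet> p) *\<^sub>R B p b))"
    unfolding sum.distrib by (subst sum.swap) (simp add: divide_inverse mult.commute)
  also have "\<dots> = (\<Sum>i<m. B (u i) (u i)) + (1 / (p \<bullet> p)) *\<^sub>R B p p"
    unfolding scaleR_sum_right[symmetric] bs ..
  finally show ?thesis by simp
qed


subsection \<open>Rotational vector fields\<close>

definition rotation_field :: "'a \<times> 'a \<Rightarrow> 'a::euclidean_space \<Rightarrow> 'a" where
  "rotation_field a x = (x \<bullet> fst a) *\<^sub>R snd a - (x \<bullet> snd a) *\<^sub>R fst a"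

lemma bounded_linear_rotation_field: "bounded_linear (rotation_field a)"
  unfolding rotation_field_def
  by (intro bounded_linear_sub bounded_linear_scaleR_const bounded_linear_inner_left)

lemmas linear_rotation_field = bounded_linear.linear[OF bounded_linear_rotation_field]

lemma rotation_field_antisym: "rotation_field a x \<bullet> y = - (x \<bullet> rotation_field a y)"
  by (simp add: rotation_field_def inner_diff_left inner_diff_right inner_commute)

lemma rotation_field_orthogonal: "rotation_field a x \<bullet> x = 0" "x \<bullet> rotation_field a x = 0"
  using rotation_field_antisym[of a x x] by (simp_all add: inner_commute)

text \<open>Each coordinate plane is counted twice, by (b, d) and by (d, b), hence the factor 2. Of
  the four products in the expansion, two give the full trace times |x|^2, and the mixed two resum
  to \<open>B x x\<close>.\<close>

lemma sum_bilinear_rotation_field: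
  fixes B :: "'a::euclidean_space \<Rightarrow> 'a \<Rightarrow> 'b::real_vector"
  assumes B: "bilinear B"
  shows "(\<Sum>a\<in>Basis \<times> Basis. B (rotation_field a x) (rotation_field a x)) = 2 *\<^sub>R ((x \<bullet> x) *\<^sub>R (\<Sum>b\<in>Basis. B b b) - B x x)"
proof -
  have l: "linear (\<lambda>x. B x y)" and r: "linear (B x)" for x y using B by (auto simp: bilinear_def)
  have 1: "B (rotation_field (b, d) x) (rotation_field (b, d) x)
     = (((x \<bullet> b) * (x \<bullet> b)) *\<^sub>R B d d + ((x \<bullet> d) * (x \<bullet> d)) *\<^sub>R B b b)
       - ((x \<bullet> d) *\<^sub>R ((x \<bullet> b) *\<^sub>R B d b) + (x \<bullet> b) *\<^sub>R ((x \<bullet> d) *\<^sub>R B b d))" for b d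
    by (simp add: rotation_field_def linear_diff[OF l] linear_diff[OF r] linear_cmul[OF l] linear_cmul[OF r] algebra_simps)
  have bs: "(\<Sum>b\<in>Basis. (x \<bullet> b) *\<^sub>R B y b) = B y x" for y
    using linear_Basis_sum[OF r] .
  have bs': "(\<Sum>b\<in>Basis. (x \<bullet> b) *\<^sub>R B b y) = B x y" for y
    using linear_Basis_sum[OF l] .
  have xx: "(\<Sum>b\<in>Basis. (x \<bullet> b) * (x \<bullet> b)) = x \<bullet> x" by (rule euclidean_inner[symmetric])
  have s: "(\<Sum>b\<in>Basis. \<Sum>d\<in>Basis. (x \<bullet> d) *\<^sub>R ((x \<bullet> b) *\<^sub>R B d b)) = B x x"
    by (subst sum.swap) (simp only: scaleR_sum_right[symmetric] bs bs')
  have s': "(\<Sum>b\<in>Basis. \<Sum>d\<in>Basis. (x \<bullet> b) *\<^sub>R ((x \<bullet> d) *\<^sub>R B b d)) = B x x"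
    by (simp only: scaleR_sum_right[symmetric] bs bs')
  have t: "(\<Sum>b\<in>Basis. \<Sum>d\<in>Basis. ((x \<bullet> b) * (x \<bullet> b)) *\<^sub>R B d d) = (x \<bullet> x) *\<^sub>R (\<Sum>b\<in>Basis. B b b)"
    by (simp add: scaleR_sum_right[symmetric] scaleR_sum_left[symmetric] xx)
  have t': "(\<Sum>b\<in>Basis. \<Sum>d\<in>Basis. ((x \<bullet> d) * (x \<bullet> d)) *\<^sub>R B b b) = (x \<bullet> x) *\<^sub>R (\<Sum>b\<in>Basis. B b b)"
    by (subst sum.swap) (rule t)
  have "(\<Sum>a\<in>Basis \<times> Basis. B (rotation_field a x) (rotation_field a x)) = (\<Sum>b\<in>Basis. \<Sum>d\<in>Basis. B (rotation_field (b, d) x) (rotation_field (b, d) x))"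
    by (simp add: sum.cartesian_product)
  also have "\<dots> = ((x \<bullet> x) *\<^sub>R (\<Sum>b\<in>Basis. B b b) + (x \<bullet> x) *\<^sub>R (\<Sum>b\<in>Basis. B b b)) - (B x x + B x x)"
    unfolding 1 sum.distrib sum_subtractf s s' t t' ..
  finally show ?thesis by (simp add: scaleR_2[symmetric] scaleR_diff_right)
qed

text \<open>The normal term that a tangent trace lacks is exactly the one that the squares of the
  rotation fields lack. The right-hand side no longer mentions a frame.\<close>

lemma trace_rotation_field:
  fixes u :: "nat \<Rightarrow> 'a::euclidean_space" and B :: "'a \<Rightarrow> 'a \<Rightarrow> 'b::real_vector"
  assumes "\<And>i j. i < m \<Longrightarrow> j < m \<Longrightarrow> u i \<bullet> u j = (if i = j then 1 else 0)"
    and "span (u ` {..<m}) = {v. p \<bullet> v = 0}" and "p \<noteq> 0" and "bilinear B"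
  shows "(\<Sum>i<m. B (u i) (u i)) = (1 / (2 * (p \<bullet> p))) *\<^sub>R (\<Sum>a\<in>Basis \<times> Basis. B (rotation_field a p) (rotation_field a p))"
proof -
  have "(\<Sum>i<m. B (u i) (u i)) = (\<Sum>b\<in>Basis. B b b) - (1 / (p \<bullet> p)) *\<^sub>R B p p"
    using trace_orthonormal[OF assms] by (simp add: algebra_simps)
  also have "\<dots> = (1 / (2 * (p \<bullet> p))) *\<^sub>R (2 *\<^sub>R ((p \<bullet> p) *\<^sub>R (\<Sum>b\<in>Basis. B b b) - B p p))"
    using \<open>p \<noteq> 0\<close> by (simp add: scaleR_diff_right)
  finally show ?thesis by (simp add: sum_bilinear_rotation_field[OF assms(4)])
qed

text \<open>Antisymmetry turns the inner product of A A x with d into minus that of A x with A d,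
  and the sum of these is found by polarising the sum of the squared norms.\<close>

lemma sum_rotation_field_rotation_field:
  fixes x :: "'a::euclidean_space"
  shows "(\<Sum>a\<in>Basis \<times> Basis. rotation_field a (rotation_field a x)) = (- (2 * (real DIM('a) - 1))) *\<^sub>R x"
proof (rule euclidean_eqI)
  fix d :: 'a assume "d \<in> Basis"
  let ?B = "\<lambda>u v. (u \<bullet> x) * (v \<bullet> d) :: real"
  have B: "bilinear (\<lambda>u v. u \<bullet> v :: real)" for x y :: 'a
    by (auto simp: bilinear_def intro!: linearI simp: inner_simps)
  have polar: "(\<Sum>a\<in>Basis \<times> Basis. rotation_field a y \<bullet> rotation_field a y) = 2 * (real DIM('a) - 1) * (y \<bullet> y)" for y :: 'a
    using sum_bilinear_rotation_field[OF B, of y] by (simp add: algebra_simps)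
  have kk: "rotation_field a (y + z) \<bullet> rotation_field a (y + z)
      = rotation_field a y \<bullet> rotation_field a y + rotation_field a z \<bullet> rotation_field a z + 2 * (rotation_field a y \<bullet> rotation_field a z)" for a and y z :: 'a
    by (simp add: linear_add[OF linear_rotation_field] inner_add_left inner_add_right inner_commute)
  have "2 * (real DIM('a) - 1) * ((x + d) \<bullet> (x + d))
      = 2 * (real DIM('a) - 1) * (x \<bullet> x) + 2 * (real DIM('a) - 1) * (d \<bullet> d)
        + 2 * (\<Sum>a\<in>Basis \<times> Basis. rotation_field a x \<bullet> rotation_field a d)"
    unfolding polar[symmetric] kk sum.distrib by (simp add: sum_distrib_left)
  moreover have "2 * (real DIM('a) - 1) * ((x + d) \<bullet> (x + d)) = 2 * (real DIM('a) - 1) * (x \<bullet> x)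
     + 2 * (real DIM('a) - 1) * (d \<bullet> d) + 2 * (2 * (real DIM('a) - 1) * (x \<bullet> d))"
    by (simp add: inner_add_left inner_add_right inner_commute algebra_simps)
  ultimately have "(\<Sum>a\<in>Basis \<times> Basis. rotation_field a x \<bullet> rotation_field a d) = 2 * (real DIM('a) - 1) * (x \<bullet> d)" by linarith
  then show "(\<Sum>a\<in>Basis \<times> Basis. rotation_field a (rotation_field a x)) \<bullet> d = ((- (2 * (real DIM('a) - 1))) *\<^sub>R x) \<bullet> d"
    by (simp add: inner_sum_left rotation_field_antisym[of _ "rotation_field _ x"] sum_negf left_diff_distrib)
qed

lemma sum_rotation_field_inner:
  fixes x :: "'a::euclidean_space"
  shows "(\<Sum>a\<in>Basis \<times> Basis. rotation_field a x \<bullet> rotation_field a x) = 2 * (real DIM('a) - 1) * (x \<bullet> x)"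
  using arg_cong[OF sum_rotation_field_rotation_field[of x], of "\<lambda>y. y \<bullet> x"]
  by (simp add: inner_sum_left rotation_field_antisym[of _ "rotation_field _ x"] sum_negf left_diff_distrib)


subsection \<open>Second covariant derivatives on a sphere\<close>

definition rotation_derivative :: "'a \<times> 'a \<Rightarrow> ('a::euclidean_space \<Rightarrow> 'b::real_normed_vector) \<Rightarrow> 'a \<Rightarrow> 'b" where
  "rotation_derivative a f x = frechet_derivative f (at x) (rotation_field a x)"

definition rotation_connection :: "('a::euclidean_space \<Rightarrow> 'b::euclidean_space) \<Rightarrow> 'a \<times> 'a \<Rightarrow> ('a \<Rightarrow> 'b) \<Rightarrow> 'a \<Rightarrow> 'b" where
  "rotation_connection F a V x = proj (F x) (rotation_derivative a V x)"

text \<open>The factor 1 / (2 R^2) undoes the normalisation of the sum of squares of the rotation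
  fields on the sphere of radius R. No choice of frame is involved, so smooth fields on the
  punctured space are sent to smooth fields.\<close>

definition rotation_laplacian :: "real \<Rightarrow> ('a::euclidean_space \<Rightarrow> 'b::euclidean_space) \<Rightarrow> ('a \<Rightarrow> 'b) \<Rightarrow> 'a \<Rightarrow> 'b" where
  "rotation_laplacian R F V x = - (1 / (2 * R\<^sup>2)) *\<^sub>R (\<Sum>a\<in>Basis \<times> Basis. rotation_connection F a (rotation_connection F a V) x)"

lemma has_derivative_proj:
  fixes F Y :: "'a::euclidean_space \<Rightarrow> 'b::euclidean_space"
  assumes "(F has_derivative F') (at p)" "(Y has_derivative Y') (at p)"
  shows "((\<lambda>q. proj (F q) (Y q)) has_derivative
    (\<lambda>v. Y' v - ((Y p \<bullet> F p) *\<^sub>R F' v + (Y p \<bullet> F' v + Y' v \<bullet> F p) *\<^sub>R F p))) (at p)"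
  unfolding proj_def by (intro has_derivative_diff has_derivative_scaleR has_derivative_inner assms)

lemma Cinf_on_proj: "Cinf_on U F \<Longrightarrow> Cinf_on U Y \<Longrightarrow> Cinf_on U (\<lambda>q. proj (F q) (Y q))"
  unfolding proj_def by (intro Cinf_on_diff Cinf_on_scaleR Cinf_on_inner)

text \<open>The outer projection removes all multiples of \<open>F p\<close> that come from
  differentiating the inner one; the surviving contribution of the moving projection is the term
  with the derivative of F. The behaviour of E away from p enters only through the last
  summand.\<close>

lemma second_covariant:
  fixes F V :: "'a::euclidean_space \<Rightarrow> 'b::euclidean_space"
  assumes F: "Cinf_on U F" and V: "Cinf_on U V" and "p \<in> U" and F1: "norm (F p) = 1"
    and E: "(E has_derivative E') (at p)"
  obtains G' where "((\<lambda>q. proj (F q) (frechet_derivative V (at q) (E q))) has_derivative G') (at p)"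
    "proj (F p) (G' w) = proj (F p) (frechet_derivative (\<lambda>y. frechet_derivative V (at y) (E p)) (at p) w)
       - (frechet_derivative V (at p) (E p) \<bullet> F p) *\<^sub>R proj (F p) (frechet_derivative F (at p) w)
       + proj (F p) (frechet_derivative V (at p) (E' w))"
proof
  show "((\<lambda>q. proj (F q) (frechet_derivative V (at q) (E q))) has_derivative
     (\<lambda>v. (frechet_derivative (\<lambda>y. frechet_derivative V (at y) (E p)) (at p) v
       + frechet_derivative V (at p) (E' v)) - ((frechet_derivative V (at p) (E p) \<bullet> F p) *\<^sub>R frechet_derivative F (at p) v
      + (frechet_derivative V (at p) (E p) \<bullet> frechet_derivative F (at p) v
        + (frechet_derivative (\<lambda>y. frechet_derivative V (at y) (E p)) (at p) v
       + frechet_derivative V (at p) (E' v)) \<bullet> F p) *\<^sub>R F p))) (at p)"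
    by (rule has_derivative_proj[OF Cinf_on_has_derivative[OF F \<open>p \<in> U\<close>] has_derivative_frechet_field[OF V \<open>p \<in> U\<close> E]])
qed (simp add: proj_simps proj_self[OF F1])

definition hessian :: "('a::euclidean_space \<Rightarrow> 'b::euclidean_space) \<Rightarrow> 'a \<Rightarrow> 'a \<Rightarrow> 'a \<Rightarrow> 'b" where
  "hessian V p X Y = frechet_derivative (\<lambda>y. frechet_derivative V (at y) X) (at p) Y"

text \<open>Linearity in the second argument is that of a derivative; symmetry transfers it to the
  first.\<close>

lemma bilinear_hessian:
  assumes "Cinf_on U V" "p \<in> U"
  shows "bilinear (hessian V p)"
proof -
  have l: "linear (hessian V p X)" for X
    unfolding hessian_def
    by (intro has_derivative_linear[OF Cinf_on_has_derivative[OF Cinf_on_frechet[OF assms(1)] assms(2)]])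
  have "hessian V p X Y = hessian V p Y X" for X Y
    unfolding hessian_def by (rule Cinf_on_mixed_derivative[OF assms])
  then have "(\<lambda>X. hessian V p X Y) = hessian V p Y" for Y by auto
  then show ?thesis using l by (simp add: bilinear_def)
qed

text \<open>The map \<open>\<psi>\<close> matters on the sphere only; F extends it to the punctured
  space. Unit values are required off the sphere too, so that \<open>proj (F x)\<close> is an
  orthogonal projection wherever derivatives are taken.\<close>

locale sphere_valued =
  fixes R :: real and F \<psi> :: "'a::euclidean_space \<Rightarrow> 'b::euclidean_space"
  assumes R: "R > 0" and F: "Cinf_on (- {0}) F" and F1: "x \<noteq> 0 \<Longrightarrow> norm (F x) = 1"
    and \<psi>: "x \<in> sphere 0 R \<Longrightarrow> \<psi> x = F x"
begin

abbreviation "M \<equiv> sphere (0::'a) R"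
abbreviation "N \<equiv> sphere (0::'b) 1"

lemma M_nz: "x \<in> M \<Longrightarrow> x \<noteq> 0" using R by auto

lemma pullback_eq:
  assumes q: "q \<in> M" and X: "q \<bullet> X q = 0" and V: "(V has_derivative D) (at q)"
    and U: "open U" "q \<in> U" "\<And>x. x \<in> M \<inter> U \<Longrightarrow> V x = V' x"
  shows "pullback_connection M N \<psi> X V' q = proj (F q) (D (X q))"
proof -
  have "frechet_derivative V' (at q within M) (X q) = D (X q)"
    by (rule frechet_derivative_within_tangent[OF V U q]) (simp_all add: tangent_space_sphere[OF q R] X)
  moreover have "F q \<in> N" using F1[OF M_nz[OF q]] by simp
  ultimately show ?thesis
    by (simp only: pullback_connection_def differential_def \<psi>[OF q] closest_point_tangent_unit_sphere)
qed

lemma levi_civita_eq: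
  assumes q: "q \<in> M" and X: "q \<bullet> X q = 0" and V: "(V has_derivative D) (at q)"
    and U: "open U" "q \<in> U" "\<And>x. x \<in> M \<inter> U \<Longrightarrow> V x = V' x"
  shows "levi_civita M X V' q = D (X q) - ((D (X q) \<bullet> q) / R\<^sup>2) *\<^sub>R q"
proof -
  have "frechet_derivative V' (at q within M) (X q) = D (X q)"
    by (rule frechet_derivative_within_tangent[OF V U q]) (simp_all add: tangent_space_sphere[OF q R] X)
  then show ?thesis
    by (simp only: levi_civita_def pullback_connection_def differential_def closest_point_tangent_sphere[OF q R])
qed

text \<open>The second covariant derivative of V along F. The ambient Hessian is corrected by the
  derivative of the target projection and, in the last term, by the second fundamental form of the
  sphere of radius R, which is minus (X . Y) / R^2 times the position vector.\<close>

definition second_covariant_form :: "('a \<Rightarrow> 'b) \<Rightarrow> 'a \<Rightarrow> 'a \<Rightarrow> 'a \<Rightarrow> 'b" where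
  "second_covariant_form V p X Y = proj (F p) (hessian V p X Y)
     - (frechet_derivative V (at p) X \<bullet> F p) *\<^sub>R proj (F p) (frechet_derivative F (at p) Y)
     - ((X \<bullet> Y) / R\<^sup>2) *\<^sub>R proj (F p) (frechet_derivative V (at p) p)"

lemma bilinear_second_covariant_form:
  assumes V: "Cinf_on (- {0}) V" and p: "p \<noteq> 0"
  shows "bilinear (second_covariant_form V p)"
proof -
  have p': "p \<in> - {0}" using p by simp
  have h: "linear (\<lambda>X. hessian V p X Y)" "linear (hessian V p X)" for X Y
    using bilinear_hessian[OF V p'] by (auto simp: bilinear_def)
  have d: "linear (frechet_derivative V (at p))" "linear (frechet_derivative F (at p))"
    using Cinf_on_has_derivative[OF V p'] Cinf_on_has_derivative[OF F p'] by (auto dest: has_derivative_linear)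
  show ?thesis
    unfolding bilinear_def second_covariant_form_def
    by (intro conjI allI linearI)
      (simp_all add: linear_add[OF h(1)] linear_add[OF h(2)] linear_cmul[OF h(1)] linear_cmul[OF h(2)]
        linear_add[OF d(1)] linear_add[OF d(2)] linear_cmul[OF d(1)] linear_cmul[OF d(2)]
        proj_simps inner_add_left inner_add_right add_divide_distrib algebra_simps)
qed

text \<open>Subtracting the derivative along \<open>levi_civita M X X\<close> cancels the tangential
  part of the derivative of X, so only the value \<open>X p\<close> is left: the expression is
  tensorial. W is kept general so that both the first covariant derivative of V' and the
  differential of \<open>\<psi>\<close> can stand in its place.\<close>

lemma second_covariant_tangent:
  assumes V: "Cinf_on (- {0}) V" and V': "\<And>x. x \<in> M \<Longrightarrow> V x = V' x" and p: "p \<in> M"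
    and E: "Cinf_on U E" "p \<in> U" "\<And>x. x \<in> M \<inter> U \<Longrightarrow> E x = X x" "\<And>x. x \<in> M \<inter> U \<Longrightarrow> x \<bullet> X x = 0"
    and W: "\<And>q. q \<in> M \<Longrightarrow> q \<bullet> X q = 0 \<Longrightarrow> W q = pullback_connection M N \<psi> X V' q"
  shows "pullback_connection M N \<psi> X W p
       - pullback_connection M N \<psi> (levi_civita M X X) V' p = second_covariant_form V p (X p) (X p)"
proof -
  let ?E' = "frechet_derivative E (at p)" and ?dV = "\<lambda>x. frechet_derivative V (at x)"
  have p0: "p \<in> - {0}" using M_nz[OF p] by simp
  have U: "open U" using E(1) by (rule Cinf_on_open)
  have Ed: "(E has_derivative ?E') (at p)" using E by (intro Cinf_on_has_derivative)
  have Ep: "E p = X p" using E p by simp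
  have pX: "p \<bullet> X p = 0" using E p by simp
  have Vd: "(V has_derivative ?dV x) (at x)" if "x \<in> M" for x
    using Cinf_on_has_derivative[OF V] M_nz[OF that] by simp
  have lin: "linear (?dV p)" using Vd[OF p] by (rule has_derivative_linear)
  obtain G' where G: "((\<lambda>q. proj (F q) (?dV q (E q))) has_derivative G') (at p)"
    "proj (F p) (G' (X p)) = proj (F p) (hessian V p (X p) (X p))
       - (?dV p (X p) \<bullet> F p) *\<^sub>R proj (F p) (frechet_derivative F (at p) (X p))
       + proj (F p) (?dV p (?E' (X p)))"
    by (rule second_covariant[OF F V p0 F1[OF M_nz[OF p]] Ed, where w="X p", unfolded Ep, folded hessian_def])
  have "proj (F q) (?dV q (E q)) = W q" if "q \<in> M \<inter> U" for q
    using pullback_eq[of q X V "?dV q" UNIV V'] Vd[of q] E(3,4)[OF that] V' that W by simp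
  then have 1: "pullback_connection M N \<psi> X W p = proj (F p) (G' (X p))"
    by (rule pullback_eq[where X=X and q=p, OF p pX G(1) U E(2)])
  \<comment> \<open>The product of x and E x vanishes on the sphere near p, so its derivative along
    the tangent vector \<open>X p\<close> is zero. This determines the normal component of the
    derivative of E.\<close>
  have "((\<lambda>x. x \<bullet> E x) has_derivative (\<lambda>v. p \<bullet> ?E' v + v \<bullet> E p)) (at p)"
    by (rule has_derivative_inner[OF has_derivative_ident Ed])
  then have "frechet_derivative (\<lambda>x. 0) (at p within M) (X p) = p \<bullet> ?E' (X p) + X p \<bullet> E p"
    by (rule frechet_derivative_within_tangent[OF _ U E(2) _ p])
      (use E(3,4) in \<open>auto simp: tangent_space_sphere[OF p R] pX\<close>)
  moreover have "frechet_derivative (\<lambda>x. 0::real) (at p within M) (X p) = 0"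
    by (rule frechet_derivative_within_tangent[OF has_derivative_const open_UNIV _ _ p])
      (auto simp: tangent_space_sphere[OF p R] pX)
  ultimately have n: "?E' (X p) \<bullet> p = - (X p \<bullet> X p)" by (simp add: Ep inner_commute)
  have lc: "levi_civita M X X p = ?E' (X p) + ((X p \<bullet> X p) / R\<^sup>2) *\<^sub>R p"
    using levi_civita_eq[where X=X and q=p, OF p pX Ed U E(2,3)] n by simp
  have "p \<bullet> levi_civita M X X p = 0"
    using n p R unfolding lc by (simp add: inner_add_right inner_commute dot_square_norm)
  then have "pullback_connection M N \<psi> (levi_civita M X X) V' p = proj (F p) (?dV p (levi_civita M X X p))"
    by (intro pullback_eq[where U=UNIV and q=p and V=V and X="levi_civita M X X", OF p _ Vd[OF p]]) (auto simp: V')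
  then show ?thesis
    unfolding 1 G(2) second_covariant_form_def lc by (simp add: linear_add[OF lin] linear_cmul[OF lin] proj_simps)
qed

text \<open>Each rotation field leaves two unwanted terms: one from its acceleration and one from
  the second fundamental form of the sphere. Summed, both are multiples of the radial derivative of
  V, with opposite factors 2 (n - 1) where n is the dimension of the ambient space, and they
  cancel.\<close>

lemma sum_rotation_connection_rotation_connection:
  assumes V: "Cinf_on (- {0}) V" and p: "p \<in> M"
  shows "(\<Sum>a\<in>Basis \<times> Basis. rotation_connection F a (rotation_connection F a V) p) = (\<Sum>a\<in>Basis \<times> Basis. second_covariant_form V p (rotation_field a p) (rotation_field a p))"
proof -
  let ?dV = "frechet_derivative V (at p)"
  have p0: "p \<in> - {0}" using M_nz[OF p] by simp
  have lin: "linear ?dV" using Cinf_on_has_derivative[OF V p0] by (rule has_derivative_linear)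
  have 1: "rotation_connection F a (rotation_connection F a V) p = second_covariant_form V p (rotation_field a p) (rotation_field a p)
     + proj (F p) (?dV (rotation_field a (rotation_field a p))) + ((rotation_field a p \<bullet> rotation_field a p) / R\<^sup>2) *\<^sub>R proj (F p) (?dV p)" for a
  proof -
    obtain G' where G: "((\<lambda>q. proj (F q) (frechet_derivative V (at q) (rotation_field a q))) has_derivative G') (at p)"
      "proj (F p) (G' (rotation_field a p)) = proj (F p) (hessian V p (rotation_field a p) (rotation_field a p))
         - (?dV (rotation_field a p) \<bullet> F p) *\<^sub>R proj (F p) (frechet_derivative F (at p) (rotation_field a p))
         + proj (F p) (?dV (rotation_field a (rotation_field a p)))"
      by (rule second_covariant[OF F V p0 F1[OF M_nz[OF p]]
          bounded_linear_imp_has_derivative[OF bounded_linear_rotation_field[of a]], where w="rotation_field a p", folded hessian_def])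
    have "rotation_connection F a V = (\<lambda>q. proj (F q) (frechet_derivative V (at q) (rotation_field a q)))"
      by (simp add: fun_eq_iff rotation_connection_def rotation_derivative_def)
    then have "rotation_connection F a (rotation_connection F a V) p = proj (F p) (G' (rotation_field a p))"
      unfolding rotation_connection_def[of F a "rotation_connection F a V"] rotation_derivative_def by (simp only: frechet_derivative_eqI[OF G(1)])
    then show ?thesis unfolding G(2) second_covariant_form_def by simp
  qed
  have "(\<Sum>a\<in>Basis \<times> Basis. proj (F p) (?dV (rotation_field a (rotation_field a p)))) = proj (F p) (?dV (\<Sum>a\<in>Basis \<times> Basis. rotation_field a (rotation_field a p)))"
    by (simp add: linear_sum[OF lin] proj_simps)
  also have "\<dots> = (- (2 * (real DIM('a) - 1))) *\<^sub>R proj (F p) (?dV p)"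
    by (simp only: sum_rotation_field_rotation_field linear_cmul[OF lin] proj_simps)
  finally have 2: "(\<Sum>a\<in>Basis \<times> Basis. proj (F p) (?dV (rotation_field a (rotation_field a p)))) = (- (2 * (real DIM('a) - 1))) *\<^sub>R proj (F p) (?dV p)" .
  have "(\<Sum>a\<in>Basis \<times> Basis. ((rotation_field a p \<bullet> rotation_field a p) / R\<^sup>2) *\<^sub>R proj (F p) (?dV p))
      = ((\<Sum>a\<in>Basis \<times> Basis. rotation_field a p \<bullet> rotation_field a p) / R\<^sup>2) *\<^sub>R proj (F p) (?dV p)"
    by (simp add: scaleR_sum_left[symmetric] sum_divide_distrib)
  also have "\<dots> = (2 * (real DIM('a) - 1)) *\<^sub>R proj (F p) (?dV p)"
    unfolding sum_rotation_field_inner using p R by (simp add: dot_square_norm)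
  finally have 3: "(\<Sum>a\<in>Basis \<times> Basis. ((rotation_field a p \<bullet> rotation_field a p) / R\<^sup>2) *\<^sub>R proj (F p) (?dV p)) = (2 * (real DIM('a) - 1)) *\<^sub>R proj (F p) (?dV p)" .
  show ?thesis unfolding 1 sum.distrib 2 3 by (simp add: algebra_simps)
qed

section \<open>From the chosen frames to rotation fields\<close>

lemma local_orthonormal_frame_at: "p \<in> M \<Longrightarrow> local_orthonormal_frame M p (frame_at M p)"
  unfolding frame_at_def by (rule someI_ex[OF local_orthonormal_frame_exists[OF _ R]])

lemma frame_at_local:
  assumes p: "p \<in> M"
  shows "\<exists>U. open U \<and> p \<in> U \<and> (\<forall>i<dim (tangent_space M p). smooth_on (M \<inter> U) (frame_at M p i) \<and>
    (\<forall>q\<in>M \<inter> U. q \<bullet> frame_at M p i q = 0))"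
proof -
  let ?e = "frame_at M p" and ?m = "dim (tangent_space M p)"
  obtain U where U: "open U" "p \<in> U" "\<forall>i<?m. smooth_on (M \<inter> U) (?e i)"
    "\<forall>q\<in>M \<inter> U. span ((\<lambda>i. ?e i q) ` {..<?m}) = tangent_space M q"
    using local_orthonormal_frame_at[OF p] unfolding local_orthonormal_frame_def Let_def by auto
  have "q \<bullet> ?e i q = 0" if "q \<in> M \<inter> U" "i < ?m" for q i
  proof -
    have "?e i q \<in> tangent_space M q"
      using span_base[of "?e i q" "(\<lambda>i. ?e i q) ` {..<?m}"] that U(4) by auto
    then show ?thesis using that tangent_space_sphere[of q R] R by auto
  qed
  then show ?thesis using U by (intro exI[of _ U]) auto
qed

lemma frame_at_trace:
  fixes B :: "'a \<Rightarrow> 'a \<Rightarrow> 'c::real_vector"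
  assumes p: "p \<in> M" and B: "bilinear B"
  shows "(\<Sum>i<dim (tangent_space M p). B (frame_at M p i p) (frame_at M p i p))
     = (1 / (2 * R\<^sup>2)) *\<^sub>R (\<Sum>a\<in>Basis \<times> Basis. B (rotation_field a p) (rotation_field a p))"
proof -
  let ?m = "dim (tangent_space M p)"
  have "\<forall>i<?m. \<forall>j<?m. frame_at M p i p \<bullet> frame_at M p j p = (if i = j then 1 else 0)"
    and "span ((\<lambda>i. frame_at M p i p) ` {..<?m}) = {v. p \<bullet> v = 0}"
    using local_orthonormal_frame_at[OF p] p
    unfolding local_orthonormal_frame_def Let_def tangent_space_sphere[OF p R, symmetric] by auto
  moreover have "p \<bullet> p = R\<^sup>2" using p by (simp add: dot_square_norm)
  ultimately show ?thesis
    using trace_rotation_field[of ?m "\<lambda>i. frame_at M p i p" p B] M_nz[OF p] B by simp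
qed

text \<open>The frame attached to p is smooth near p but unrelated to the frames attached to other
  points. By tensoriality only its values at p count, and there the trace can be rewritten with
  rotation fields.\<close>

lemma rough_laplacian_eq:
  assumes V: "Cinf_on (- {0}) V" and V': "\<And>x. x \<in> M \<Longrightarrow> V x = V' x" and p: "p \<in> M"
  shows "rough_laplacian M N \<psi> V' p = rotation_laplacian R F V p"
proof -
  define m where "m = dim (tangent_space M p)"
  let ?e = "frame_at M p"
  obtain U where U: "open U" "p \<in> U" "\<And>i. i < m \<Longrightarrow> smooth_on (M \<inter> U) (?e i)"
    "\<And>q i. q \<in> M \<inter> U \<Longrightarrow> i < m \<Longrightarrow> q \<bullet> ?e i q = 0"
    using frame_at_local[OF p] unfolding m_def by auto
  have "pullback_connection M N \<psi> (?e i) (pullback_connection M N \<psi> (?e i) V') p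
       - pullback_connection M N \<psi> (levi_civita M (?e i) (?e i)) V' p = second_covariant_form V p (?e i p) (?e i p)"
    if i: "i < m" for i
  proof -
    obtain U' E where E: "p \<in> U'" "Cinf_on U' E" "\<And>x. x \<in> (M \<inter> U) \<inter> U' \<Longrightarrow> E x = ?e i x"
      using smooth_onE[OF U(3)[OF i], of p] p U(2) by blast
    have o: "open (U \<inter> U')" using U(1) Cinf_on_open[OF E(2)] by blast
    show ?thesis
      by (rule second_covariant_tangent[OF V V' p Cinf_on_subset[OF E(2) o]]) (use E U i in auto)
  qed
  then have "rough_laplacian M N \<psi> V' p = - (\<Sum>i<m. second_covariant_form V p (?e i p) (?e i p))"
    by (simp add: rough_laplacian_def Let_def m_def)
  also have "\<dots> = rotation_laplacian R F V p"
    unfolding m_def frame_at_trace[OF p bilinear_second_covariant_form[OF V M_nz[OF p]]] rotation_laplacian_def sum_rotation_connection_rotation_connection[OF V p] by simp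
  finally show ?thesis .
qed

text \<open>Differentiating F . F = 1 shows that the differential is already tangent to the target,
  so the projection leaves it alone. The map itself may thus be treated as a section, which makes
  the tension field an instance of the second covariant derivative.\<close>

lemma differential_eq:
  assumes "q \<in> M" "q \<bullet> X q = 0"
  shows "differential M \<psi> X q = pullback_connection M N \<psi> X \<psi> q"
proof -
  have q0: "q \<in> - {0}" using M_nz[OF assms(1)] by simp
  have Fd: "(F has_derivative frechet_derivative F (at q)) (at q)" by (rule Cinf_on_has_derivative[OF F q0])
  have 1: "differential M \<psi> X q = frechet_derivative F (at q) (X q)"
    unfolding differential_def
    by (rule frechet_derivative_within_tangent[OF Fd open_UNIV _ _ assms(1)])
      (use assms R in \<open>auto simp: \<psi> tangent_space_sphere\<close>)
  have "((\<lambda>x. F x \<bullet> F x) has_derivative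
     (\<lambda>v. F q \<bullet> frechet_derivative F (at q) v + frechet_derivative F (at q) v \<bullet> F q)) (at q)"
    by (rule has_derivative_inner[OF Fd Fd])
  moreover have "((\<lambda>x. F x \<bullet> F x) has_derivative (\<lambda>v. 0)) (at q)"
    by (rule has_derivative_transform_within_open[OF has_derivative_const[of 1] _ q0])
      (auto simp: dot_square_norm F1)
  ultimately have "(\<lambda>v. F q \<bullet> frechet_derivative F (at q) v + frechet_derivative F (at q) v \<bullet> F q) = (\<lambda>v. 0)"
    by (rule has_derivative_unique)
  then have "frechet_derivative F (at q) (X q) \<bullet> F q = 0" by (simp add: fun_eq_iff inner_commute)
  then show ?thesis
    using 1 pullback_eq[where X=X and q=q and V'=\<psi>, OF assms Fd open_UNIV] by (simp add: \<psi> proj_def)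
qed

text \<open>The sign comes from the rough Laplacian being minus the trace of second covariant
  derivatives.\<close>

lemma tension_field_eq:
  assumes p: "p \<in> M"
  shows "tension_field M N \<psi> p = - rotation_laplacian R F F p"
proof -
  define m where "m = dim (tangent_space M p)"
  let ?e = "frame_at M p"
  obtain U where U: "open U" "p \<in> U" "\<And>i. i < m \<Longrightarrow> smooth_on (M \<inter> U) (?e i)"
    "\<And>q i. q \<in> M \<inter> U \<Longrightarrow> i < m \<Longrightarrow> q \<bullet> ?e i q = 0"
    using frame_at_local[OF p] unfolding m_def by auto
  have "second_derivative M N \<psi> (?e i) (?e i) p = second_covariant_form F p (?e i p) (?e i p)" if i: "i < m" for i
  proof -
    obtain U' E where E: "p \<in> U'" "Cinf_on U' E" "\<And>x. x \<in> (M \<inter> U) \<inter> U' \<Longrightarrow> E x = ?e i x"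
      using smooth_onE[OF U(3)[OF i], of p] p U(2) by blast
    have o: "open (U \<inter> U')" using U(1) Cinf_on_open[OF E(2)] by blast
    have E': "Cinf_on (U \<inter> U') E" by (rule Cinf_on_subset[OF E(2) o]) auto
    have "p \<bullet> levi_civita M (?e i) (?e i) p = 0"
    proof -
      have "levi_civita M (?e i) (?e i) p \<in> tangent_space M p"
        unfolding levi_civita_def pullback_connection_def tangent_space_sphere[OF p R]
        by (rule closest_point_in_set) (auto simp: closed_hyperplane intro: exI[of _ 0])
      then show ?thesis by (simp add: tangent_space_sphere[OF p R])
    qed
    then have d: "differential M \<psi> (levi_civita M (?e i) (?e i)) p
        = pullback_connection M N \<psi> (levi_civita M (?e i) (?e i)) \<psi> p"
      by (rule differential_eq[where X="levi_civita M (?e i) (?e i)" and q=p, OF p])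
    show ?thesis
      unfolding second_derivative_def d
    proof (rule second_covariant_tangent[OF F _ p E'])
      show "differential M \<psi> (?e i) q = pullback_connection M N \<psi> (?e i) \<psi> q" if "q \<in> M" "q \<bullet> ?e i q = 0" for q
        using that by (rule differential_eq[where X="?e i" and q=q])
    qed (use E U i \<psi> in auto)
  qed
  then have "tension_field M N \<psi> p = (\<Sum>i<m. second_covariant_form F p (?e i p) (?e i p))"
    by (simp add: tension_field_def Let_def m_def)
  also have "\<dots> = - rotation_laplacian R F F p"
    unfolding m_def frame_at_trace[OF p bilinear_second_covariant_form[OF F M_nz[OF p]]] rotation_laplacian_def sum_rotation_connection_rotation_connection[OF F p] by simp
  finally show ?thesis .
qed

lemma energy_density_eq:
  assumes V: "Cinf_on (- {0}) V" and V': "\<And>x. x \<in> M \<Longrightarrow> V x = V' x" and p: "p \<in> M"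
  shows "(\<Sum>j<dim (tangent_space M p). pullback_connection M N \<psi> (frame_at M p j) V' p
           \<bullet> pullback_connection M N \<psi> (frame_at M p j) V' p)
     = (1 / (2 * R\<^sup>2)) * (\<Sum>a\<in>Basis \<times> Basis. rotation_connection F a V p \<bullet> rotation_connection F a V p)"
proof -
  define m where "m = dim (tangent_space M p)"
  let ?e = "frame_at M p" and ?dV = "frechet_derivative V (at p)"
  obtain U where U: "open U" "p \<in> U" "\<And>q i. q \<in> M \<inter> U \<Longrightarrow> i < m \<Longrightarrow> q \<bullet> ?e i q = 0"
    using frame_at_local[OF p] unfolding m_def by auto
  have Vd: "(V has_derivative ?dV) (at p)"
    using Cinf_on_has_derivative[OF V] M_nz[OF p] by simp
  have lin: "linear ?dV" using Vd by (rule has_derivative_linear)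
  have B: "bilinear (\<lambda>X Y. proj (F p) (?dV X) \<bullet> proj (F p) (?dV Y))"
    by (auto simp: bilinear_def linear_add[OF lin] linear_cmul[OF lin] proj_simps inner_add_left inner_add_right intro!: linearI)
  have "pullback_connection M N \<psi> (?e j) V' p = proj (F p) (?dV (?e j p))" if "j < m" for j
    using U p that by (intro pullback_eq[where q=p and X="?e j", OF p _ Vd open_UNIV]) (auto simp: V')
  then show ?thesis
    using frame_at_trace[OF p B] by (simp add: m_def rotation_connection_def rotation_derivative_def)
qed

end


subsection \<open>One-parameter families\<close>

text \<open>Joint smoothness in (x, t) is what allows spatial and time derivatives to be
  exchanged.\<close>

definition smooth_family :: "real \<Rightarrow> (real \<Rightarrow> 'a::euclidean_space \<Rightarrow> 'b::euclidean_space) \<Rightarrow> bool" where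
  "smooth_family \<epsilon> f \<longleftrightarrow> Cinf_on ((- {0}) \<times> {-\<epsilon><..<\<epsilon>}) (\<lambda>z. f (snd z) (fst z))"

definition time_derivative :: "(real \<Rightarrow> 'a \<Rightarrow> 'b::real_normed_vector) \<Rightarrow> 'a \<Rightarrow> 'b" where
  "time_derivative f x = vector_derivative (\<lambda>t. f t x) (at 0)"

lemma open_smooth_family: "open ((- {0 :: 'a::euclidean_space}) \<times> {-\<epsilon><..<\<epsilon>::real})"
  by (intro open_Times) auto

lemma has_derivative_slice:
  assumes "(G has_derivative D) (at (x, t))"
  shows "((\<lambda>x. G (x, t)) has_derivative (\<lambda>v. D (v, 0))) (at x)"
    and "((\<lambda>t. G (x, t)) has_derivative (\<lambda>s. D (0, s))) (at t)"
proof -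
  have 1: "((\<lambda>x. (x, t)) has_derivative (\<lambda>v. (v, 0))) (at x)"
    and 2: "((\<lambda>t. (x, t)) has_derivative (\<lambda>s. (0, s))) (at t)"
    by (auto intro!: derivative_eq_intros)
  show "((\<lambda>x. G (x, t)) has_derivative (\<lambda>v. D (v, 0))) (at x)"
    using diff_chain_at[OF 1 assms] by (simp add: o_def)
  show "((\<lambda>t. G (x, t)) has_derivative (\<lambda>s. D (0, s))) (at t)"
    using diff_chain_at[OF 2 assms] by (simp add: o_def)
qed

context
  fixes \<epsilon> :: real and f :: "real \<Rightarrow> 'a::euclidean_space \<Rightarrow> 'b::euclidean_space"
  assumes f: "smooth_family \<epsilon> f"
begin

private abbreviation (input) "D \<equiv> \<lambda>z. frechet_derivative (\<lambda>z. f (snd z) (fst z)) (at z)"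

private lemma Dz: "x \<noteq> 0 \<Longrightarrow> \<bar>t\<bar> < \<epsilon> \<Longrightarrow> ((\<lambda>z. f (snd z) (fst z)) has_derivative D (x, t)) (at (x, t))"
  using f unfolding smooth_family_def by (rule Cinf_on_has_derivative) auto

lemma smooth_family_slice:
  assumes "\<bar>t\<bar> < \<epsilon>"
  shows "Cinf_on (- {0}) (f t)"
proof -
  have "Cinf_on (- {0}) (\<lambda>x. (x, t))"
    by (intro Cinf_on_Pair Cinf_on_ident Cinf_on_const) auto
  then have "Cinf_on (- {0}) (\<lambda>x. f (snd (x, t)) (fst (x, t)))"
    by (rule Cinf_on_compose[OF f[unfolded smooth_family_def]]) (use assms in auto)
  then show ?thesis by simp
qed

lemma smooth_family_has_derivative_t:
  assumes "x \<noteq> 0" "\<bar>t\<bar> < \<epsilon>"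
  shows "((\<lambda>t. f t x) has_vector_derivative D (x, t) (0, 1)) (at t)"
proof -
  have "D (x, t) (0, s) = s *\<^sub>R D (x, t) (0, 1)" for s
  proof -
    have "D (x, t) (s *\<^sub>R (0, 1)) = s *\<^sub>R D (x, t) (0, 1)"
      by (rule linear_cmul[OF has_derivative_linear[OF Dz[OF assms]]])
    then show ?thesis by simp
  qed
  then have "(\<lambda>s. D (x, t) (0, s)) = (\<lambda>s. s *\<^sub>R D (x, t) (0, 1))" by (rule ext)
  then show ?thesis
    using has_derivative_slice(2)[OF Dz[OF assms]] unfolding has_vector_derivative_def by (simp only: fst_conv snd_conv)
qed

lemma rotation_derivative_smooth_family:
  assumes "x \<noteq> 0" "\<bar>t\<bar> < \<epsilon>"
  shows "rotation_derivative a (f t) x = D (x, t) (rotation_field a x, 0)"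
  using frechet_derivative_eqI[OF has_derivative_slice(1)[OF Dz[OF assms]]] by (simp add: rotation_derivative_def)

private lemma rotation_derivative_fam':
  "z \<in> (- {0}) \<times> {-\<epsilon><..<\<epsilon>} \<Longrightarrow> D z (rotation_field a (fst z), 0) = rotation_derivative a (f (snd z)) (fst z)"
  by (cases z) (simp add: rotation_derivative_smooth_family abs_less_iff)

private lemma field: "Cinf_on ((- {0}) \<times> {-\<epsilon><..<\<epsilon>}) (\<lambda>z. (rotation_field a (fst z), 0 :: real))"
  by (intro Cinf_on_Pair Cinf_on_const Cinf_on_linear_compose[OF bounded_linear_rotation_field] Cinf_on_fst open_smooth_family)

lemma smooth_family_rotation_derivative: "smooth_family \<epsilon> (\<lambda>t. rotation_derivative a (f t))"
  unfolding smooth_family_def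
proof (rule Cinf_on_cong)
  show "Cinf_on ((- {0}) \<times> {-\<epsilon><..<\<epsilon>}) (\<lambda>z. D z (rotation_field a (fst z), 0))"
    by (rule Cinf_on_frechet_field[OF f[unfolded smooth_family_def] field])
qed (rule rotation_derivative_fam')

lemma time_derivative_eq: "\<epsilon> > 0 \<Longrightarrow> x \<noteq> 0 \<Longrightarrow> time_derivative f x = D (x, 0) (0, 1)"
  unfolding time_derivative_def by (rule vector_derivative_at[OF smooth_family_has_derivative_t]) auto

lemma has_time_derivative: "\<epsilon> > 0 \<Longrightarrow> x \<noteq> 0 \<Longrightarrow> ((\<lambda>t. f t x) has_vector_derivative time_derivative f x) (at 0)"
  using smooth_family_has_derivative_t[of x 0] by (simp add: time_derivative_eq)

lemma Cinf_on_time_derivative: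
  assumes "\<epsilon> > 0"
  shows "Cinf_on (- {0}) (time_derivative f)"
proof (rule Cinf_on_cong)
  have "Cinf_on (- {0::'a}) (\<lambda>x. (x, 0::real))"
    by (intro Cinf_on_Pair Cinf_on_ident Cinf_on_const) auto
  then show "Cinf_on (- {0}) (\<lambda>x. D (x, 0) (0, 1))"
    by (rule Cinf_on_compose[OF Cinf_on_frechet[OF f[unfolded smooth_family_def]]]) (use assms in auto)
qed (simp add: time_derivative_eq assms)

text \<open>Both sides are mixed second derivatives of the joint map in the directions (A x, 0) and
  (0, 1). The first direction does not vary with t, so the product rule adds nothing to the
  Hessian.\<close>

lemma time_derivative_rotation_derivative:
  assumes "\<epsilon> > 0" "x \<noteq> 0"
  shows "time_derivative (\<lambda>t. rotation_derivative a (f t)) x = rotation_derivative a (time_derivative f) x"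
proof -
  let ?\<Omega> = "(- {0 :: 'a}) \<times> {-\<epsilon><..<\<epsilon>}"
  have z: "(x, 0) \<in> ?\<Omega>" using assms by auto
  note G = f[unfolded smooth_family_def]
  have "((\<lambda>z. (rotation_field a (fst z), 0 :: real)) has_derivative (\<lambda>v. (rotation_field a (fst v), 0))) (at (x, 0))"
    by (intro has_derivative_Pair has_derivative_const bounded_linear.has_derivative[OF bounded_linear_rotation_field]
        has_derivative_fst has_derivative_ident)
  from has_derivative_frechet_field[OF G z this]
  have "((\<lambda>z. D z (rotation_field a (fst z), 0)) has_derivative
     (\<lambda>v. hessian (\<lambda>z. f (snd z) (fst z)) (x, 0) (rotation_field a x, 0) v + D (x, 0) (rotation_field a (fst v), 0))) (at (x, 0))"
    by (simp add: hessian_def)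
  then have "((\<lambda>z. rotation_derivative a (f (snd z)) (fst z)) has_derivative
     (\<lambda>v. hessian (\<lambda>z. f (snd z) (fst z)) (x, 0) (rotation_field a x, 0) v + D (x, 0) (rotation_field a (fst v), 0))) (at (x, 0))"
    by (rule has_derivative_transform_within_open[OF _ open_smooth_family z]) (rule rotation_derivative_fam')
  from has_derivative_slice(2)[OF this]
  have "((\<lambda>t. rotation_derivative a (f t) x) has_derivative
     (\<lambda>s. hessian (\<lambda>z. f (snd z) (fst z)) (x, 0) (rotation_field a x, 0) (0, s) + D (x, 0) 0)) (at 0)"
    by (simp add: linear_0[OF linear_rotation_field] zero_prod_def)
  then have 1: "frechet_derivative (\<lambda>t. rotation_derivative a (f t) x) (at 0) 1
     = hessian (\<lambda>z. f (snd z) (fst z)) (x, 0) (rotation_field a x, 0) (0, 1)"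
    using linear_0[OF has_derivative_linear[OF Dz[of x 0]]] assms by (simp add: frechet_derivative_eqI)
  have "((\<lambda>t. rotation_derivative a (f t) x) has_derivative (\<lambda>s. s *\<^sub>R time_derivative (\<lambda>t. rotation_derivative a (f t)) x)) (at 0)"
    using vector_derivative_works[of "\<lambda>t. rotation_derivative a (f t) x" "at 0"]
      \<open>((\<lambda>t. rotation_derivative a (f t) x) has_derivative _) (at 0)\<close>[THEN differentiableI]
    by (simp add: time_derivative_def has_vector_derivative_def)
  then have 2: "time_derivative (\<lambda>t. rotation_derivative a (f t)) x = hessian (\<lambda>z. f (snd z) (fst z)) (x, 0) (rotation_field a x, 0) (0, 1)"
    using 1 by (simp add: frechet_derivative_eqI)
  have "((\<lambda>z. D z (0, 1)) has_derivative hessian (\<lambda>z. f (snd z) (fst z)) (x, 0) (0, 1)) (at (x, 0))"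
    unfolding hessian_def using Cinf_on_has_derivative[OF Cinf_on_frechet[OF G] z] .
  from has_derivative_slice(1)[OF this]
  have "(time_derivative f has_derivative (\<lambda>v. hessian (\<lambda>z. f (snd z) (fst z)) (x, 0) (0, 1) (v, 0))) (at x)"
    by (rule has_derivative_transform_within_open[where s="- {0}"]) (simp_all add: time_derivative_eq assms open_Compl)
  then have 3: "rotation_derivative a (time_derivative f) x = hessian (\<lambda>z. f (snd z) (fst z)) (x, 0) (0, 1) (rotation_field a x, 0)"
    by (simp add: rotation_derivative_def frechet_derivative_eqI)
  show ?thesis
    unfolding 2 3 hessian_def by (rule Cinf_on_mixed_derivative[OF G z])
qed

end

lemma tderivI: "((\<lambda>t. f t x) has_vector_derivative d) (at 0) \<Longrightarrow> time_derivative f x = d"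
  unfolding time_derivative_def by (rule vector_derivative_at)

lemma smooth_family_minus: "smooth_family \<epsilon> f \<Longrightarrow> smooth_family \<epsilon> (\<lambda>t x. - f t x)"
  unfolding smooth_family_def by (rule Cinf_on_minus)

lemma smooth_family_inner: "smooth_family \<epsilon> f \<Longrightarrow> smooth_family \<epsilon> g \<Longrightarrow> smooth_family \<epsilon> (\<lambda>t x. f t x \<bullet> g t x)"
  unfolding smooth_family_def by (rule Cinf_on_inner)

lemma smooth_family_rotation_connection: "smooth_family \<epsilon> F \<Longrightarrow> smooth_family \<epsilon> V \<Longrightarrow> smooth_family \<epsilon> (\<lambda>t. rotation_connection (F t) a (V t))"
  unfolding rotation_connection_def using smooth_family_rotation_derivative[of \<epsilon> V a] unfolding smooth_family_def by (intro Cinf_on_proj)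

lemma smooth_family_rotation_laplacian: "smooth_family \<epsilon> F \<Longrightarrow> smooth_family \<epsilon> V \<Longrightarrow> smooth_family \<epsilon> (\<lambda>t. rotation_laplacian R (F t) (V t))"
proof -
  assume F: "smooth_family \<epsilon> F" and V: "smooth_family \<epsilon> V"
  have "smooth_family \<epsilon> (\<lambda>t. rotation_connection (F t) a (rotation_connection (F t) a (V t)))" for a by (intro smooth_family_rotation_connection F V)
  then show ?thesis
    unfolding rotation_laplacian_def unfolding smooth_family_def by (intro Cinf_on_scaleR Cinf_on_const Cinf_on_sum open_smooth_family)
qed


subsection \<open>Integration over the sphere\<close>

text \<open>For two distinct basis vectors this is the flow of \<open>rotation_field a\<close>: the
  rotation by angle s in their plane, and the identity on its orthogonal complement.\<close>

definition plane_rotation :: "'a \<times> 'a \<Rightarrow> real \<Rightarrow> 'a::euclidean_space \<Rightarrow> 'a" where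
  "plane_rotation a s x = x + (cos s - 1) *\<^sub>R ((x \<bullet> fst a) *\<^sub>R fst a + (x \<bullet> snd a) *\<^sub>R snd a) + sin s *\<^sub>R rotation_field a x"

lemma orthogonal_transformation_plane_rotation:
  assumes "a \<in> Basis \<times> Basis" "fst a \<noteq> snd a"
  shows "orthogonal_transformation (plane_rotation a s)"
proof -
  have lin: "linear (plane_rotation a s)"
    by (rule linearI) (simp_all add: plane_rotation_def linear_add[OF linear_rotation_field] linear_cmul[OF linear_rotation_field] inner_add_left algebra_simps)
  have n: "fst a \<bullet> fst a = 1" "snd a \<bullet> snd a = 1" "fst a \<bullet> snd a = 0" "snd a \<bullet> fst a = 0"
    using assms by (auto simp: inner_Basis)
  have "plane_rotation a s x \<bullet> plane_rotation a s x = x \<bullet> x" for x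
  proof -
    define b d c where "b = x \<bullet> fst a" and "d = x \<bullet> snd a" and "c = cos s - 1"
    have 1: "plane_rotation a s x = x + (c * b - sin s * d) *\<^sub>R fst a + (c * d + sin s * b) *\<^sub>R snd a"
      by (simp add: plane_rotation_def rotation_field_def b_def d_def c_def algebra_simps)
    have "plane_rotation a s x \<bullet> plane_rotation a s x = x \<bullet> x + 2 * (c * b - sin s * d) * b + 2 * (c * d + sin s * b) * d
       + (c * b - sin s * d)\<^sup>2 + (c * d + sin s * b)\<^sup>2"
      unfolding 1 by (simp add: inner_add_left inner_add_right n b_def d_def inner_commute power2_eq_square algebra_simps)
    also have "\<dots> = x \<bullet> x + (2 * c + c\<^sup>2 + (sin s)\<^sup>2) * (b\<^sup>2 + d\<^sup>2)"
      by (simp add: power2_eq_square algebra_simps)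
    also have "2 * c + c\<^sup>2 + (sin s)\<^sup>2 = 0"
      using sin_cos_squared_add[of s] by (simp add: c_def power2_eq_square algebra_simps)
    finally show ?thesis by simp
  qed
  then show ?thesis
    using lin by (simp add: orthogonal_transformation norm_eq_sqrt_inner)
qed

text \<open>The properties of the volume measure from which integrals of derivatives along rotations
  are evaluated. Invariance is stated for integrals of continuous functions, the form in which it
  gets differentiated.\<close>

locale sphere_measure = finite_measure \<mu> for \<mu> :: "'a::euclidean_space measure" +
  fixes R :: real
  assumes R_pos: "R > 0" and space_\<mu>: "space \<mu> = sphere 0 R"
    and sets_\<mu>: "sets \<mu> = sets (restrict_space borel (sphere 0 R))"
    and invariant: "\<And>T f. orthogonal_transformation T \<Longrightarrow> continuous_on (sphere 0 R) f \<Longrightarrow>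
      (LINT x|\<mu>. f (T x)) = (LINT x|\<mu>. f x :: real)"
begin

lemma sphere_nz: "x \<in> sphere 0 R \<Longrightarrow> x \<noteq> 0" using R_pos by auto

lemma integrable_continuous:
  fixes f :: "'a \<Rightarrow> real"
  assumes "continuous_on (sphere 0 R) f"
  shows "integrable \<mu> f"
proof -
  obtain B where "\<forall>y\<in>f ` sphere 0 R. norm y \<le> B"
    using compact_imp_bounded[OF compact_continuous_image[OF assms compact_sphere]]
    unfolding bounded_iff by blast
  then have "norm (f x) \<le> B" if "x \<in> sphere 0 R" for x using that by blast
  moreover have "f \<in> borel_measurable \<mu>"
    using borel_measurable_continuous_on_restrict[OF assms] measurable_cong_sets[OF sets_\<mu> refl] by blast
  ultimately show ?thesis
    by (intro integrable_const_bound[of _ B]) (auto simp: space_\<mu>)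
qed

lemma integrable_Cinf: "Cinf_on (- {0}) f \<Longrightarrow> integrable \<mu> (f :: 'a \<Rightarrow> real)"
  by (rule integrable_continuous, rule continuous_on_subset[OF Cinf_on_continuous], assumption) (use R_pos in auto)

text \<open>Dominated convergence for the difference quotients; a bound of the time derivative over
  a compact set, combined with the mean value inequality, dominates them.\<close>

lemma has_derivative_integral:
  fixes h :: "real \<Rightarrow> 'a \<Rightarrow> real"
  assumes h: "smooth_family \<epsilon> h" and \<epsilon>: "\<epsilon> > 0"
  shows "((\<lambda>t. LINT x|\<mu>. h t x) has_real_derivative (LINT x|\<mu>. time_derivative h x)) (at 0)"
proof -
  let ?D = "\<lambda>z. frechet_derivative (\<lambda>z. h (snd z) (fst z)) (at z) (0, 1)"
  \<comment> \<open>Half of the time interval, closed, makes the product with the sphere compact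
    inside the domain of smoothness.\<close>
  let ?K = "sphere (0::'a) R \<times> {-\<epsilon>/2..\<epsilon>/2}"
  have "continuous_on ((- {0}) \<times> {-\<epsilon><..<\<epsilon>}) ?D"
    by (rule Cinf_on_continuous[OF Cinf_on_frechet[OF h[unfolded smooth_family_def]]])
  then have "continuous_on ?K ?D"
    by (rule continuous_on_subset) (use \<epsilon> sphere_nz in auto)
  moreover have "compact ?K" by (intro compact_Times compact_sphere compact_Icc)
  ultimately have "bounded (?D ` ?K)" by (intro compact_imp_bounded compact_continuous_image)
  then obtain B where B: "\<And>z. z \<in> ?K \<Longrightarrow> norm (?D z) \<le> B" by (auto simp: bounded_iff)
  have diff: "((\<lambda>t. h t x) has_real_derivative ?D (x, t)) (at t)" if "x \<in> sphere 0 R" "\<bar>t\<bar> < \<epsilon>" for x t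
    using smooth_family_has_derivative_t[OF h sphere_nz[OF that(1)] that(2)]
    by (simp add: has_real_derivative_iff_has_vector_derivative)
  have lip: "norm (h t x - h 0 x) \<le> B * norm (t - 0)" if "x \<in> sphere 0 R" "\<bar>t\<bar> \<le> \<epsilon> / 2" for x t
  proof (rule field_differentiable_bound[where S="{-\<epsilon>/2..\<epsilon>/2}" and f="\<lambda>t. h t x" and f'="\<lambda>t. ?D (x, t)"])
    show "((\<lambda>t. h t x) has_real_derivative ?D (x, s)) (at s within {- \<epsilon> / 2..\<epsilon> / 2})" if "s \<in> {-\<epsilon>/2..\<epsilon>/2}" for s
      using diff[OF \<open>x \<in> _\<close>, of s] that \<epsilon> by (auto intro: has_field_derivative_at_within)
    show "norm (?D (x, s)) \<le> B" if "s \<in> {-\<epsilon>/2..\<epsilon>/2}" for s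
      using B[of "(x, s)"] that \<open>x \<in> _\<close> by auto
  qed (use that \<epsilon> in auto)
  have int: "integrable \<mu> (h t)" if "\<bar>t\<bar> < \<epsilon>" for t
    using smooth_family_slice[OF h that] by (rule integrable_Cinf)
  have int': "integrable \<mu> (time_derivative h)" using Cinf_on_time_derivative[OF h \<epsilon>] by (rule integrable_Cinf)
  show ?thesis
    unfolding has_field_derivative_iff tendsto_at_iff_sequentially
  proof (intro allI impI)
    fix X :: "nat \<Rightarrow> real" assume X0: "\<forall>i. X i \<in> UNIV - {0}" and X: "X \<longlonglongrightarrow> 0"
    obtain n where n: "\<And>i. i \<ge> n \<Longrightarrow> \<bar>X i\<bar> < \<epsilon> / 2"
      using LIMSEQ_D[OF X, of "\<epsilon> / 2"] \<epsilon> by auto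
    \<comment> \<open>The shift by n keeps all times within the half interval, where the bound B is
      available.\<close>
    let ?q = "\<lambda>i x. (h (X (i + n)) x - h 0 x) / X (i + n)"
    have Xn: "\<bar>X (i + n)\<bar> < \<epsilon>" "X (i + n) \<noteq> 0" for i using n[of "i + n"] X0 \<epsilon> by auto
    have "(\<lambda>i. LINT x|\<mu>. ?q i x) \<longlonglongrightarrow> (LINT x|\<mu>. time_derivative h x)"
    proof (rule integral_dominated_convergence[where w="\<lambda>x. B"])
      show "time_derivative h \<in> borel_measurable \<mu>" using int' by (rule borel_measurable_integrable)
      show "?q i \<in> borel_measurable \<mu>" for i
        using int[OF Xn(1)[of i]] int[of 0] \<epsilon> by (intro borel_measurable_divide borel_measurable_diff) auto
      show "integrable \<mu> (\<lambda>x. B)" by simp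
      show "AE x in \<mu>. (\<lambda>i. ?q i x) \<longlonglongrightarrow> time_derivative h x"
      proof (rule AE_I2)
        fix x assume "x \<in> space \<mu>"
        then have "((\<lambda>t. h t x) has_real_derivative time_derivative h x) (at 0)"
          using has_time_derivative[OF h \<epsilon> sphere_nz[of x]]
          by (simp add: space_\<mu> has_real_derivative_iff_has_vector_derivative)
        then have "((\<lambda>i. (h i x - h 0 x) / (i - 0)) \<longlongrightarrow> time_derivative h x) (at 0)"
          by (simp add: has_field_derivative_iff)
        moreover have "filterlim (\<lambda>i. X (i + n)) (at 0) sequentially"
          using LIMSEQ_ignore_initial_segment[OF X, of n] Xn(2) by (auto simp: filterlim_at)
        ultimately show "(\<lambda>i. ?q i x) \<longlonglongrightarrow> time_derivative h x"
          using filterlim_compose[of "\<lambda>i. (h i x - h 0 x) / (i - 0)"] by fastforce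
      qed
      show "AE x in \<mu>. norm (?q i x) \<le> B" for i
      proof (rule AE_I2)
        fix x assume "x \<in> space \<mu>"
        then show "norm (?q i x) \<le> B"
          using lip[of x "X (i + n)"] n[of "i + n"] Xn(2)[of i] by (simp add: space_\<mu> divide_le_eq)
      qed
    qed
    moreover have "(LINT x|\<mu>. ?q i x) = ((LINT x|\<mu>. h (X (i + n)) x) - (LINT x|\<mu>. h 0 x)) / (X (i + n) - 0)" for i
      using int[OF Xn(1)[of i]] int[of 0] \<epsilon> by simp
    ultimately have "(\<lambda>i. ((\<lambda>t. ((LINT x|\<mu>. h t x) - (LINT x|\<mu>. h 0 x)) / (t - 0)) \<circ> X) (i + n))
        \<longlonglongrightarrow> (LINT x|\<mu>. time_derivative h x)" by (simp only: o_def)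
    then show "((\<lambda>t. ((LINT x|\<mu>. h t x) - (LINT x|\<mu>. h 0 x)) / (t - 0)) \<circ> X)
        \<longlonglongrightarrow> (LINT x|\<mu>. time_derivative h x)" by (rule LIMSEQ_offset)
  qed
qed

text \<open>The integral of f after a rotation by angle s does not depend on s, and its derivative
  at s = 0 may be taken under the integral. A pair of equal basis vectors has the zero field and
  generates no rotation, so it is treated apart.\<close>

lemma integral_rotation_derivative:
  fixes f :: "'a \<Rightarrow> real"
  assumes f: "Cinf_on (- {0}) f" and a: "a \<in> Basis \<times> Basis"
  shows "(LINT x|\<mu>. rotation_derivative a f x) = 0"
proof (cases "fst a = snd a")
  case True
  have "rotation_derivative a f x = 0" if "x \<in> space \<mu>" for x
  proof -
    have "x \<in> - {0}" using that sphere_nz by (auto simp: space_\<mu>)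
    then show ?thesis
      using linear_0[OF has_derivative_linear[OF Cinf_on_has_derivative[OF f]]] True
      by (simp add: rotation_derivative_def rotation_field_def)
  qed
  then show ?thesis by (simp cong: Bochner_Integration.integral_cong)
next
  case False
  note ot = orthogonal_transformation_plane_rotation[OF a False]
  let ?h = "\<lambda>s x. f (plane_rotation a s x)"
  have "plane_rotation a s x \<noteq> 0" if "x \<noteq> 0" for s x
    using orthogonal_transformation_norm[OF ot, of s x] that by (metis norm_eq_zero)
  moreover have "Cinf_on ((- {0}) \<times> {-1<..<1}) (\<lambda>z. plane_rotation a (snd z) (fst z))"
    unfolding plane_rotation_def
    by (intro Cinf_on_add Cinf_on_diff Cinf_on_scaleR Cinf_on_cos Cinf_on_sin Cinf_on_inner Cinf_on_const Cinf_on_fst Cinf_on_snd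
        Cinf_on_linear_compose[OF bounded_linear_rotation_field] open_smooth_family)
  ultimately have h: "smooth_family 1 ?h"
    unfolding smooth_family_def by (intro Cinf_on_compose[OF f]) auto
  have "time_derivative ?h x = rotation_derivative a f x" if "x \<in> space \<mu>" for x
  proof (rule tderivI)
    have x: "x \<in> - {0}" using that sphere_nz by (auto simp: space_\<mu>)
    have r: "((\<lambda>s. plane_rotation a s x) has_derivative (\<lambda>s. s *\<^sub>R rotation_field a x)) (at 0)"
      unfolding plane_rotation_def by (auto intro!: derivative_eq_intros)
    have r0: "plane_rotation a 0 x = x" by (simp add: plane_rotation_def)
    have "(f has_derivative frechet_derivative f (at x)) (at (plane_rotation a 0 x))"
      unfolding r0 by (rule Cinf_on_has_derivative[OF f x])
    from diff_chain_at[OF r this]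
    show "((\<lambda>s. f (plane_rotation a s x)) has_vector_derivative rotation_derivative a f x) (at 0)"
      using linear_cmul[OF has_derivative_linear[OF Cinf_on_has_derivative[OF f x]]]
      by (simp add: has_vector_derivative_def o_def rotation_derivative_def)
  qed
  then have "((\<lambda>s. LINT x|\<mu>. ?h s x) has_real_derivative (LINT x|\<mu>. rotation_derivative a f x)) (at 0)"
    using has_derivative_integral[OF h] by (simp cong: Bochner_Integration.integral_cong)
  moreover have "continuous_on (sphere 0 R) f"
    by (rule continuous_on_subset[OF Cinf_on_continuous[OF f]]) (use R_pos in auto)
  then have "(\<lambda>s. LINT x|\<mu>. ?h s x) = (\<lambda>s. LINT x|\<mu>. f x)"
    using invariant[OF ot] by (simp add: fun_eq_iff)
  ultimately show ?thesis
    by (metis DERIV_const DERIV_unique)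
qed

end


subsection \<open>The volume measure of the sphere\<close>

text \<open>An open set is a countable disjoint union of balls up to a null set (Vitali), and orthogonal
  maps preserve balls and null sets.\<close>

lemma emeasure_lborel_orthogonal_image:
  fixes T :: "'a::euclidean_space \<Rightarrow> 'a"
  assumes T: "orthogonal_transformation T" and U: "open U"
  shows "emeasure lborel (T ` U) = emeasure lborel U"
proof -
  define K where "K = {k :: 'a \<times> real. ball (fst k) (snd k) \<subseteq> U}"
  have "\<exists>k. k \<in> K \<and> x \<in> ball (fst k) (snd k) \<and> snd k < d" if "x \<in> U" "d > 0" for x d
  proof -
    obtain e where "e > 0" "ball x e \<subseteq> U" using U \<open>x \<in> U\<close> openE by blast
    then show ?thesis
      using \<open>d > 0\<close> by (intro exI[of _ "(x, min e (d / 2))"]) (auto simp: K_def)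
  qed
  then obtain C where C: "countable C" "C \<subseteq> K"
    "pairwise (\<lambda>i j. disjnt (ball (fst i) (snd i)) (ball (fst j) (snd j))) C"
    "negligible (U - (\<Union>i\<in>C. ball (fst i) (snd i)))"
    by (rule Vitali_covering_theorem_balls)
  let ?W = "\<Union>i\<in>C. ball (fst i) (snd i)"
  have "?W \<subseteq> U" using C(2) by (auto simp: K_def)
  have inj: "inj T" using T by (rule orthogonal_transformation_inj)
  have "continuous_on UNIV (inv T)"
    using orthogonal_transformation_linear[OF orthogonal_transformation_inv[OF T]]
    by (simp add: linear_continuous_on linear_conv_bounded_linear)
  moreover have img: "T ` S = inv T -` S" for S
    using bij_vimage_eq_inv_image[OF orthogonal_transformation_bij[OF orthogonal_transformation_inv[OF T]], of S]
      inv_inv_eq[OF orthogonal_transformation_bij[OF T]] by simp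
  ultimately have op: "open (T ` S)" if "open S" for S
    using that by (simp add: open_vimage)
  have "disjoint_family_on (\<lambda>i. ball (fst i) (snd i)) C"
    using C(3) by (auto simp: disjoint_family_on_def pairwise_def disjnt_def)
  \<comment> \<open>Stated for a general g because both T and the identity are substituted; the two
    resulting sums over the balls of C are then compared term by term.\<close>
  then have W: "emeasure lborel (g ` ?W) = (\<integral>\<^sup>+i. emeasure lborel (g ` ball (fst i) (snd i)) \<partial>count_space C)"
    if g: "inj g" "\<And>S. open S \<Longrightarrow> open (g ` S)" for g :: "'a \<Rightarrow> 'a"
    using g C(1) unfolding image_UN
    by (intro emeasure_UN_countable) (auto simp: disjoint_family_on_def image_Int[symmetric])
  have ball: "emeasure lborel (T ` ball c r) = emeasure lborel (ball c r)" for c r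
    unfolding image_orthogonal_transformation_ball[OF T] by (cases "r \<ge> 0") (simp_all add: emeasure_ball ball_empty not_le)
  have null: "emeasure lborel S = 0" if "negligible S" "S \<in> sets borel" for S :: "'a set"
    using that negligible_iff_emeasure0[of S] by simp
  have split: "emeasure lborel (g ` U) = emeasure lborel (g ` ?W)"
    if g: "inj g" "\<And>S. open S \<Longrightarrow> open (g ` S)" "g differentiable_on (U - ?W)" for g :: "'a \<Rightarrow> 'a"
  proof -
    have "negligible (g ` (U - ?W))"
      by (rule negligible_differentiable_image_negligible[OF _ C(4) g(3)]) simp
    moreover have d: "g ` (U - ?W) = g ` U - g ` ?W" using g(1) by (rule image_set_diff)
    moreover have o: "open (g ` U)" "open (g ` ?W)" using U by (auto intro!: g(2))
    ultimately have "emeasure lborel (g ` U - g ` ?W) = 0" by (intro null) auto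
    then have "g ` U - g ` ?W \<in> null_sets lborel" using o by auto
    then have "emeasure lborel (g ` ?W \<union> (g ` U - g ` ?W)) = emeasure lborel (g ` ?W)"
      using o by (intro emeasure_Un_null_set) auto
    moreover have "g ` ?W \<union> (g ` U - g ` ?W) = g ` U" using \<open>?W \<subseteq> U\<close> by blast
    ultimately show ?thesis by simp
  qed
  have "T differentiable_on (U - ?W)"
    using orthogonal_transformation_linear[OF T] by (simp add: linear_imp_differentiable_on)
  then have "emeasure lborel (T ` U) = emeasure lborel (T ` ?W)" by (intro split inj op)
  also have "\<dots> = (\<integral>\<^sup>+i. emeasure lborel (ball (fst i) (snd i)) \<partial>count_space C)"
    using W[of T] inj op by (simp add: ball)
  also have "\<dots> = emeasure lborel ?W" using W[of "\<lambda>x. x"] by simp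
  also have "\<dots> = emeasure lborel U" using split[of "\<lambda>x. x"] by simp
  finally show ?thesis .
qed

text \<open>Lebesgue measure is characterised by its values on open boxes, and the preimage of a box
  is its image under the inverse, which is orthogonal again.\<close>

lemma distr_lborel_orthogonal:
  fixes T :: "'a::euclidean_space \<Rightarrow> 'a"
  assumes T: "orthogonal_transformation T"
  shows "distr lborel borel T = lborel"
proof (rule lborel_eqI[symmetric])
  have meas: "T \<in> borel_measurable borel"
    using orthogonal_transformation_linear[OF T]
    by (intro borel_measurable_continuous_onI linear_continuous_on) (simp add: linear_conv_bounded_linear)
  fix l u :: 'a assume lu: "\<And>b. b \<in> Basis \<Longrightarrow> l \<bullet> b \<le> u \<bullet> b"
  have "T -` box l u = inv T ` box l u"
    using bij_vimage_eq_inv_image[OF orthogonal_transformation_bij[OF T]] .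
  then have "emeasure lborel (T -` box l u) = emeasure lborel (box l u)"
    using emeasure_lborel_orthogonal_image[OF orthogonal_transformation_inv[OF T] open_box] by simp
  then have "emeasure (distr lborel borel T) (box l u) = emeasure lborel (box l u)"
    using meas by (subst emeasure_distr) auto
  then show "emeasure (distr lborel borel T) (box l u) = (\<Prod>b\<in>Basis. (u - l) \<bullet> b)"
    using lu by simp
qed simp

section \<open>The cone construction of the sphere volume\<close>

lemma integral_scale_measure:
  fixes f :: "'a \<Rightarrow> real"
  assumes "c \<ge> 0" "f \<in> borel_measurable M"
  shows "(LINT x|scale_measure (ennreal c) M. f x) = c * (LINT x|M. f x)"
proof -
  have "scale_measure (ennreal c) M = density M (\<lambda>_. ennreal c)"
    by (rule measure_eqI) (simp_all add: emeasure_density_const)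
  then show ?thesis using assms by (simp add: integral_real_density)
qed

context
  fixes R :: real
  assumes R: "R > 0"
begin

private lemma retract_measurable:
  "(\<lambda>x::'a::euclidean_space. (R / norm x) *\<^sub>R x) \<in> restrict_space lborel (ball 0 R - {0}) \<rightarrow>\<^sub>M restrict_space borel (sphere 0 R)"
proof (rule measurable_restrict_space2)
  show "(\<lambda>x::'a. (R / norm x) *\<^sub>R x) \<in> space (restrict_space lborel (ball 0 R - {0})) \<rightarrow> sphere 0 R"
    using R by (auto simp: space_restrict_space)
  have "(\<lambda>x::'a. (R / norm x) *\<^sub>R x) \<in> borel_measurable borel" by measurable
  then show "(\<lambda>x::'a. (R / norm x) *\<^sub>R x) \<in> borel_measurable (restrict_space lborel (ball 0 R - {0}))"
    by (intro measurable_restrict_space1) simp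
qed

lemma space_sphere_volume: "space (sphere_volume R) = sphere (0::'a::euclidean_space) R"
  by (simp add: sphere_volume_def space_restrict_space space_scale_measure)

lemma sets_sphere_volume: "sets (sphere_volume R) = sets (restrict_space borel (sphere (0::'a::euclidean_space) R))"
  by (simp add: sphere_volume_def)

lemma emeasure_sphere_volume:
  "emeasure (sphere_volume R) (sphere (0::'a::euclidean_space) R)
    = ennreal (DIM('a) / R) * emeasure lborel (ball (0::'a) R - {0})"
proof -
  have s: "sphere (0::'a) R \<in> sets (restrict_space borel (sphere 0 R))"
    using sets.top[of "restrict_space borel (sphere (0::'a) R)"] by (simp add: space_restrict_space)
  have "(\<lambda>x. (R / norm x) *\<^sub>R x) -` sphere 0 R \<inter> (ball 0 R - {0}) = ball (0::'a) R - {0}"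
    using R by auto
  then show ?thesis
    unfolding sphere_volume_def emeasure_scale_measure
    by (simp add: emeasure_distr[OF retract_measurable s] space_restrict_space emeasure_restrict_space)
qed

lemma emeasure_punctured_ball:
  "emeasure lborel (ball (0::'a::euclidean_space) R - {0}) = emeasure lborel (ball (0::'a) R)"
  by (rule emeasure_Diff_null_set) auto

lemma finite_measure_sphere_volume: "finite_measure (sphere_volume R :: 'a::euclidean_space measure)"
proof
  have "emeasure lborel (ball (0::'a) R) < \<infinity>" by (rule emeasure_lborel_ball_finite)
  then show "emeasure (sphere_volume R) (space (sphere_volume R :: 'a measure)) \<noteq> \<infinity>"
    by (simp add: space_sphere_volume emeasure_sphere_volume emeasure_punctured_ball ennreal_mult_eq_top_iff)
qed

text \<open>Guarantees that a variation of constant normal speed is detected by the first variation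
  formula.\<close>

lemma measure_sphere_volume_pos: "measure (sphere_volume R) (sphere (0::'a::euclidean_space) R) > 0"
proof -
  interpret finite_measure "sphere_volume R :: 'a measure" by (rule finite_measure_sphere_volume)
  have "emeasure lborel (ball (0::'a) R) > 0"
    using R by (simp add: emeasure_ball)
  then have "emeasure (sphere_volume R) (sphere (0::'a) R) \<noteq> 0"
    using R by (simp add: emeasure_sphere_volume emeasure_punctured_ball)
  then show ?thesis by (simp add: emeasure_eq_measure zero_less_measure_iff)
qed

text \<open>An orthogonal map is linear and preserves norms, so it commutes with the radial
  projection and preserves the punctured ball. Written as Lebesgue integrals over the cone, the two
  sides agree by invariance of Lebesgue measure.\<close>

lemma sphere_volume_invariant:
  fixes f :: "'a::euclidean_space \<Rightarrow> real" and T :: "'a \<Rightarrow> 'a"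
  assumes T: "orthogonal_transformation T" and f: "continuous_on (sphere 0 R) f"
  shows "(LINT x|sphere_volume R. f (T x)) = (LINT x|sphere_volume R. f x)"
proof -
  let ?B = "ball (0 :: 'a) R - {0}"
  \<comment> \<open>The extension of f to the punctured ball that is constant along rays, and zero
    elsewhere.\<close>
  define g where "g = (\<lambda>f (x :: 'a). indicator ?B x *\<^sub>R (f ((R / norm x) *\<^sub>R x) :: real))"
  have lin: "linear T" using T by (rule orthogonal_transformation_linear)
  have nT: "norm (T x) = norm x" for x using T by (rule orthogonal_transformation_norm)
  have B: "?B \<inter> space lborel \<in> sets lborel" by auto
  have vol: "(LINT x|sphere_volume R. f x) = (DIM('a) / R) * (LINT x|lborel. g f x)"
    if "continuous_on (sphere 0 R) f" for f :: "'a \<Rightarrow> real"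
  proof -
    have fm: "f \<in> borel_measurable (restrict_space borel (sphere 0 R))"
      using that by (rule borel_measurable_continuous_on_restrict)
    have "(LINT x|sphere_volume R. f x) = (DIM('a) / R) * (LINT x|distr (restrict_space lborel ?B)
       (restrict_space borel (sphere 0 R)) (\<lambda>x. (R / norm x) *\<^sub>R x). f x)"
      unfolding sphere_volume_def using R fm by (subst integral_scale_measure) auto
    also have "\<dots> = (DIM('a) / R) * (LINT x|restrict_space lborel ?B. f ((R / norm x) *\<^sub>R x))"
      by (subst integral_distr[OF retract_measurable fm]) simp
    also have "\<dots> = (DIM('a) / R) * (LINT x|lborel. g f x)"
      unfolding g_def by (subst integral_restrict_space[OF B]) simp
    finally show ?thesis .
  qed
  have Ts: "T ` sphere 0 R \<subseteq> sphere 0 R" using nT by auto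
  have fT: "continuous_on (sphere 0 R) (\<lambda>x. f (T x))"
    by (rule continuous_on_compose2[OF f linear_continuous_on[OF lin[unfolded linear_conv_bounded_linear]] Ts])
  have "g (\<lambda>x. f (T x)) = (\<lambda>x. g f (T x))"
    by (rule ext, simp add: g_def nT linear_cmul[OF lin] indicator_def) (metis nT norm_eq_zero)
  moreover have "(LINT x|lborel. g f (T x)) = (LINT x|lborel. g f x)"
  proof -
    have "T \<in> borel_measurable borel"
      by (intro borel_measurable_continuous_onI linear_continuous_on lin[unfolded linear_conv_bounded_linear])
    moreover have "g f \<in> borel_measurable borel"
    proof -
      have "(\<lambda>x. f ((R / norm x) *\<^sub>R x)) \<in> borel_measurable (restrict_space lborel ?B)"
        by (rule measurable_compose[OF retract_measurable borel_measurable_continuous_on_restrict[OF f]])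
      then have "g f \<in> borel_measurable lborel"
        unfolding g_def by (subst borel_measurable_restrict_space_iff[OF B, symmetric]) 
      then show ?thesis by simp
    qed
    ultimately have "(LINT x|distr lborel borel T. g f x) = (LINT x|lborel. g f (T x))"
      by (intro integral_distr) auto
    then show ?thesis by (simp add: distr_lborel_orthogonal[OF T])
  qed
  ultimately show ?thesis
    unfolding vol[OF f] vol[OF fT] by simp
qed

end


subsection \<open>The iterated rough Laplacian of the tension field\<close>

lemma rotation_derivative_inner:
  fixes f g :: "'a::euclidean_space \<Rightarrow> 'b::euclidean_space"
  assumes "Cinf_on (- {0}) f" "Cinf_on (- {0}) g" "x \<noteq> 0"
  shows "rotation_derivative a (\<lambda>x. f x \<bullet> g x) x = rotation_derivative a f x \<bullet> g x + f x \<bullet> rotation_derivative a g x"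
proof -
  have x: "x \<in> - {0}" using assms by simp
  show ?thesis
    unfolding rotation_derivative_def
      frechet_derivative_eqI[OF has_derivative_inner[OF Cinf_on_has_derivative[OF assms(1) x] Cinf_on_has_derivative[OF assms(2) x]]]
    by simp
qed

lemma rotation_derivative_cong:
  assumes "Cinf_on (- {0}) f" "x \<noteq> 0" "\<And>y. y \<noteq> 0 \<Longrightarrow> f y = g y"
  shows "rotation_derivative a f x = rotation_derivative a g x"
proof -
  have "f differentiable (at x)"
    using Cinf_on_has_derivative[OF assms(1)] assms(2) by (auto simp: differentiable_def)
  then show ?thesis
    unfolding rotation_derivative_def using frechet_derivative_transform_within_open[of f x "- {0}" g] assms(2,3)
    by (simp add: open_Compl)
qed

lemma rotation_derivative_minus:
  assumes "Cinf_on (- {0}) f" "x \<noteq> 0"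
  shows "rotation_derivative a (\<lambda>x. - f x) x = - rotation_derivative a f x"
proof -
  have x: "x \<in> - {0}" using assms by simp
  show ?thesis
    unfolding rotation_derivative_def frechet_derivative_eqI[OF has_derivative_minus[OF Cinf_on_has_derivative[OF assms(1) x]]] ..
qed

lemma Cinf_on_rotation_derivative:
  assumes "Cinf_on (- {0}) V"
  shows "Cinf_on (- {0}) (rotation_derivative a V)"
  unfolding rotation_derivative_def
  by (rule Cinf_on_frechet_field[OF assms Cinf_on_bounded_linear[OF Cinf_on_open[OF assms] bounded_linear_rotation_field]])

lemma Cinf_on_rotation_connection: "Cinf_on (- {0}) F \<Longrightarrow> Cinf_on (- {0}) V \<Longrightarrow> Cinf_on (- {0}) (rotation_connection F a V)"
  unfolding rotation_connection_def by (intro Cinf_on_proj Cinf_on_rotation_derivative)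

lemma Cinf_on_rotation_laplacian:
  assumes "Cinf_on (- {0}) F" "Cinf_on (- {0}) V"
  shows "Cinf_on (- {0}) (rotation_laplacian R F V)"
  unfolding rotation_laplacian_def
  by (intro Cinf_on_scaleR Cinf_on_const Cinf_on_sum Cinf_on_rotation_connection assms Cinf_on_open[OF assms(1)])

lemma rotation_laplacian_minus:
  assumes F: "Cinf_on (- {0}) F" and V: "Cinf_on (- {0}) V" and "x \<noteq> 0"
  shows "rotation_laplacian R F (\<lambda>x. - V x) x = - rotation_laplacian R F V x"
proof -
  have 1: "rotation_connection F a (\<lambda>x. - V x) y = - rotation_connection F a V y" if "y \<noteq> 0" for a y
    using that by (simp add: rotation_connection_def rotation_derivative_minus[OF V] proj_simps)
  have "rotation_connection F a (rotation_connection F a (\<lambda>x. - V x)) x = - rotation_connection F a (rotation_connection F a V) x" for a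
  proof -
    have "rotation_derivative a (rotation_connection F a (\<lambda>x. - V x)) x = rotation_derivative a (\<lambda>x. - rotation_connection F a V x) x"
      by (rule rotation_derivative_cong[OF Cinf_on_rotation_connection[OF F Cinf_on_minus[OF V]] \<open>x \<noteq> 0\<close>]) (rule 1)
    then show ?thesis
      using rotation_derivative_minus[OF Cinf_on_rotation_connection[OF F V] \<open>x \<noteq> 0\<close>]
      by (simp add: rotation_connection_def[of F a "rotation_connection F a _"] proj_simps)
  qed
  then show ?thesis by (simp add: rotation_laplacian_def sum_negf)
qed

text \<open>The sign makes the tension field the first iterate.\<close>

primrec iterated_laplacian :: "real \<Rightarrow> ('a::euclidean_space \<Rightarrow> 'b::euclidean_space) \<Rightarrow> nat \<Rightarrow> 'a \<Rightarrow> 'b" where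
  "iterated_laplacian R F 0 = (\<lambda>x. - F x)"
| "iterated_laplacian R F (Suc k) = rotation_laplacian R F (iterated_laplacian R F k)"

lemma Cinf_on_iterated_laplacian: "Cinf_on (- {0}) F \<Longrightarrow> Cinf_on (- {0}) (iterated_laplacian R F k)"
  by (induction k) (simp_all add: Cinf_on_minus Cinf_on_rotation_laplacian)

lemma smooth_family_iterated_laplacian: "smooth_family \<epsilon> F \<Longrightarrow> smooth_family \<epsilon> (\<lambda>t. iterated_laplacian R (F t) k)"
  by (induction k) (simp_all add: smooth_family_minus smooth_family_rotation_laplacian)

lemma rotation_laplacian_orthogonal: "norm (F x) = 1 \<Longrightarrow> rotation_laplacian R F V x \<bullet> F x = 0"
  by (simp add: rotation_laplacian_def inner_sum_left rotation_connection_def[of F _ "rotation_connection F _ V"] proj_inner_self)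

text \<open>Rough Laplacians are compared on the sphere only, yet each step has to differentiate the
  previous field. The induction hypothesis supplies a smooth ambient representative of it, which is
  all that \<open>rough_laplacian_eq\<close> asks for.\<close>

lemma (in sphere_valued) iterated_laplacian_eq:
  "p \<in> M \<Longrightarrow> (rough_laplacian M N \<psi> ^^ k) (tension_field M N \<psi>) p = iterated_laplacian R F (Suc k) p"
proof (induction k arbitrary: p)
  case 0
  then show ?case using rotation_laplacian_minus[OF F F M_nz[OF 0]] by (simp add: tension_field_eq)
next
  case (Suc k)
  have "rough_laplacian M N \<psi> ((rough_laplacian M N \<psi> ^^ k) (tension_field M N \<psi>)) p = rotation_laplacian R F (iterated_laplacian R F (Suc k)) p"
    by (rule rough_laplacian_eq[OF Cinf_on_iterated_laplacian[OF F] _ Suc.prems]) (simp only: Suc.IH)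
  then show ?case by simp
qed

text \<open>For V orthogonal to F, the squared norm of a covariant derivative along a rotation
  equals a total rotation derivative minus the inner product of V with the second covariant
  derivative. The total derivatives integrate to zero.\<close>

lemma (in sphere_measure) integral_parts:
  fixes F V :: "'a \<Rightarrow> 'b::euclidean_space"
  assumes F: "Cinf_on (- {0}) F" and F1: "\<And>x. x \<noteq> 0 \<Longrightarrow> norm (F x) = 1"
    and V: "Cinf_on (- {0}) V" and VF: "\<And>x. x \<noteq> 0 \<Longrightarrow> V x \<bullet> F x = 0"
  shows "(LINT x|\<mu>. (1 / (2 * R\<^sup>2)) * (\<Sum>a\<in>Basis \<times> Basis. rotation_connection F a V x \<bullet> rotation_connection F a V x))
    = (LINT x|\<mu>. V x \<bullet> rotation_laplacian R F V x)"
proof -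
  let ?n = "\<lambda>a. rotation_connection F a V"
  have n: "Cinf_on (- {0}) (?n a)" for a by (rule Cinf_on_rotation_connection[OF F V])
  have pt: "?n a x \<bullet> ?n a x = rotation_derivative a (\<lambda>x. V x \<bullet> ?n a x) x - V x \<bullet> rotation_connection F a (?n a) x" if "x \<noteq> 0" for a x
  proof -
    have "V x \<bullet> rotation_connection F a (?n a) x = V x \<bullet> rotation_derivative a (?n a) x"
      using VF[OF that] by (simp add: rotation_connection_def[of F a "?n a"] proj_def inner_diff_right)
    moreover have "?n a x \<bullet> ?n a x = rotation_derivative a V x \<bullet> ?n a x"
      using proj_inner_self[OF F1[OF that], of "rotation_derivative a V x"]
      by (simp add: rotation_connection_def proj_def inner_diff_left inner_diff_right inner_commute)
    ultimately show ?thesis using rotation_derivative_inner[OF V n that, of a a] by simp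
  qed
  have i: "Cinf_on (- {0}) (\<lambda>x. V x \<bullet> ?n a x)" for a by (rule Cinf_on_inner[OF V n])
  have "(1 / (2 * R\<^sup>2)) * (\<Sum>a\<in>Basis \<times> Basis. ?n a x \<bullet> ?n a x)
     = (1 / (2 * R\<^sup>2)) * (\<Sum>a\<in>Basis \<times> Basis. rotation_derivative a (\<lambda>x. V x \<bullet> ?n a x) x) + V x \<bullet> rotation_laplacian R F V x"
    if "x \<in> space \<mu>" for x
    using that sphere_nz[of x] by (simp add: space_\<mu> pt sum_subtractf rotation_laplacian_def inner_sum_right right_diff_distrib)
  then have "(LINT x|\<mu>. (1 / (2 * R\<^sup>2)) * (\<Sum>a\<in>Basis \<times> Basis. ?n a x \<bullet> ?n a x))
    = (LINT x|\<mu>. (1 / (2 * R\<^sup>2)) * (\<Sum>a\<in>Basis \<times> Basis. rotation_derivative a (\<lambda>x. V x \<bullet> ?n a x) x) + V x \<bullet> rotation_laplacian R F V x)"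
    by (rule Bochner_Integration.integral_cong[OF refl])
  also have "\<dots> = (1 / (2 * R\<^sup>2)) * (\<Sum>a\<in>Basis \<times> Basis. LINT x|\<mu>. rotation_derivative a (\<lambda>x. V x \<bullet> ?n a x) x) + (LINT x|\<mu>. V x \<bullet> rotation_laplacian R F V x)"
  proof -
    have "integrable \<mu> (\<lambda>x. rotation_derivative a (\<lambda>x. V x \<bullet> ?n a x) x)" for a by (rule integrable_Cinf[OF Cinf_on_rotation_derivative[OF i]])
    moreover have "integrable \<mu> (\<lambda>x. V x \<bullet> rotation_laplacian R F V x)"
      by (rule integrable_Cinf[OF Cinf_on_inner[OF V Cinf_on_rotation_laplacian[OF F V]]])
    ultimately show ?thesis by simp
  qed
  also have "\<dots> = (LINT x|\<mu>. V x \<bullet> rotation_laplacian R F V x)" using integral_rotation_derivative[OF i] by simp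
  finally show ?thesis .
qed

locale sphere_energy = sphere_measure \<mu> R + sphere_valued R F \<psi>
  for \<mu> :: "'a::euclidean_space measure" and R and F \<psi> :: "'a \<Rightarrow> 'b::euclidean_space"
begin

text \<open>Integration by parts gives the odd energies the shape of the even ones. In both cases
  the two indices add up to r, which lets a single variation formula serve both parities.\<close>

lemma r_energy_eq:
  assumes "r \<ge> 2"
  shows "r_energy \<mu> M N r \<psi> = 1 / 2 * (LINT x|\<mu>. iterated_laplacian R F (r div 2) x \<bullet> iterated_laplacian R F ((r + 1) div 2) x)"
proof -
  define s where "s = r div 2 - 1"
  have s: "r div 2 = Suc s" using assms by (simp add: s_def)
  let ?W = "(rough_laplacian M N \<psi> ^^ s) (tension_field M N \<psi>)"
  have W: "?W p = iterated_laplacian R F (Suc s) p" if "p \<in> M" for p using that by (rule iterated_laplacian_eq)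
  show ?thesis
  proof (cases "even r")
    case True
    then have "(r + 1) div 2 = Suc s" using s by auto
    moreover have "(LINT p|\<mu>. ?W p \<bullet> ?W p) = (LINT p|\<mu>. iterated_laplacian R F (Suc s) p \<bullet> iterated_laplacian R F (Suc s) p)"
      by (rule Bochner_Integration.integral_cong) (simp_all only: space_\<mu> W)
    ultimately show ?thesis
      unfolding r_energy_def Let_def s_def[symmetric] s using True by simp
  next
    case False
    then have j: "(r + 1) div 2 = Suc (Suc s)" using s by (auto elim!: oddE)
    have "(LINT p|\<mu>. (\<Sum>j<dim (tangent_space M p). pullback_connection M N \<psi> (frame_at M p j) ?W p
             \<bullet> pullback_connection M N \<psi> (frame_at M p j) ?W p))
       = (LINT p|\<mu>. (1 / (2 * R\<^sup>2)) * (\<Sum>a\<in>Basis \<times> Basis. rotation_connection F a (iterated_laplacian R F (Suc s)) p \<bullet> rotation_connection F a (iterated_laplacian R F (Suc s)) p))"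
      by (rule Bochner_Integration.integral_cong[OF refl], rule energy_density_eq[OF Cinf_on_iterated_laplacian[OF F]])
        (simp_all only: space_\<mu> W)
    also have "\<dots> = (LINT p|\<mu>. iterated_laplacian R F (Suc s) p \<bullet> iterated_laplacian R F (Suc (Suc s)) p)"
      unfolding iterated_laplacian.simps(2)[of R F "Suc s"]
      by (rule integral_parts[OF F F1 Cinf_on_iterated_laplacian[OF F]]) (simp_all add: rotation_laplacian_orthogonal F1)
    finally show ?thesis
      unfolding r_energy_def Let_def s_def[symmetric] s j using False by simp
  qed
qed

end


subsection \<open>First variation at the canonical inclusion\<close>

lemma time_derivative_inner:
  assumes "smooth_family \<epsilon> f" "smooth_family \<epsilon> g" "\<epsilon> > 0" "x \<noteq> 0"
  shows "time_derivative (\<lambda>t x. f t x \<bullet> g t x) x = time_derivative f x \<bullet> g 0 x + f 0 x \<bullet> time_derivative g x"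
  using bounded_bilinear.has_vector_derivative[OF bounded_bilinear_inner
      has_time_derivative[OF assms(1,3,4)] has_time_derivative[OF assms(2,3,4)]]
  by (intro tderivI) (simp add: add.commute)

lemma time_derivative_proj:
  assumes "smooth_family \<epsilon> F" "smooth_family \<epsilon> Y" "\<epsilon> > 0" "x \<noteq> 0"
  shows "time_derivative (\<lambda>t x. proj (F t x) (Y t x)) x = time_derivative Y x -
    ((Y 0 x \<bullet> F 0 x) *\<^sub>R time_derivative F x + (Y 0 x \<bullet> time_derivative F x + time_derivative Y x \<bullet> F 0 x) *\<^sub>R F 0 x)"
  unfolding proj_def
  by (intro tderivI has_vector_derivative_diff bounded_bilinear.has_vector_derivative[OF bounded_bilinear_scaleR]
      bounded_bilinear.has_vector_derivative[OF bounded_bilinear_inner] has_time_derivative[OF assms(1,3,4)] has_time_derivative[OF assms(2,3,4)])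

lemma time_derivative_scale:
  assumes "smooth_family \<epsilon> f" "\<epsilon> > 0" "x \<noteq> 0"
  shows "time_derivative (\<lambda>t x. k *\<^sub>R f t x) x = k *\<^sub>R time_derivative f x"
  by (intro tderivI bounded_linear.has_vector_derivative[OF bounded_linear_scaleR_right] has_time_derivative[OF assms])

lemma time_derivative_sum:
  assumes "\<And>i. i \<in> I \<Longrightarrow> smooth_family \<epsilon> (f i)" "\<epsilon> > 0" "x \<noteq> 0"
  shows "time_derivative (\<lambda>t x. \<Sum>i\<in>I. f i t x) x = (\<Sum>i\<in>I. time_derivative (f i) x)"
  by (intro tderivI has_vector_derivative_sum has_time_derivative[OF assms])

text \<open>Rotation fields are tangent to the sphere, so f may be replaced by any explicit g with
  the same values on it. This is how the homogeneous extensions are avoided in computations at time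
  0.\<close>

lemma rotation_derivative_eq_on_sphere:
  fixes f :: "'a::euclidean_space \<Rightarrow> 'b::euclidean_space"
  assumes "Cinf_on (- {0}) f" "(g has_derivative g') (at p)" "p \<in> sphere 0 R" "R > 0"
    and "\<And>x. x \<in> sphere 0 R \<Longrightarrow> f x = g x"
  shows "rotation_derivative a f p = g' (rotation_field a p)"
proof -
  have t: "rotation_field a p \<in> tangent_space (sphere 0 R) p"
    using tangent_space_sphere[OF assms(3,4)] by (simp add: rotation_field_orthogonal)
  have "p \<in> - {0}" using assms(3,4) by auto
  then have "frechet_derivative f (at p within sphere 0 R) (rotation_field a p) = rotation_derivative a f p"
    unfolding rotation_derivative_def
    by (intro frechet_derivative_within_tangent[OF Cinf_on_has_derivative[OF assms(1)] open_UNIV _ _ assms(3) t]) auto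
  moreover have "frechet_derivative f (at p within sphere 0 R) (rotation_field a p) = g' (rotation_field a p)"
    by (rule frechet_derivative_within_tangent[OF assms(2) open_UNIV _ _ assms(3) t]) (simp_all add: assms(5))
  ultimately show ?thesis by simp
qed

text \<open>At time 0 the family is prescribed on the sphere alone; off it only unit length is
  known.\<close>

locale inclusion_variation = sphere_measure \<mu> R
  for \<mu> :: "'a::euclidean_space measure" and R +
  fixes c \<epsilon> :: real and \<phi> :: "real \<Rightarrow> 'a \<Rightarrow> 'a \<times> real"
  assumes cR: "c\<^sup>2 + R\<^sup>2 = 1" and \<epsilon>: "\<epsilon> > 0" and \<phi>: "smooth_family \<epsilon> \<phi>"
    and \<phi>_norm: "\<And>t x. \<bar>t\<bar> < \<epsilon> \<Longrightarrow> x \<noteq> 0 \<Longrightarrow> norm (\<phi> t x) = 1"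
    and \<phi>0: "\<And>x. x \<in> sphere 0 R \<Longrightarrow> \<phi> 0 x = (x, c)"
begin

abbreviation "S \<equiv> sphere (0::'a) R"

text \<open>The unit normal of the small sphere in the large one.\<close>

definition \<omega> :: "'a \<Rightarrow> 'a \<times> real" where
  "\<omega> x = ((c / R) *\<^sub>R x, - R)"

definition m :: real where "m = real DIM('a) - 1"

lemma S_inner: "p \<in> S \<Longrightarrow> p \<bullet> p = R\<^sup>2" by (simp add: dot_square_norm)

lemma \<phi>0_smooth: "Cinf_on (- {0}) (\<phi> 0)" using smooth_family_slice[OF \<phi>] \<epsilon> by simp

lemma \<omega>_smooth: "Cinf_on (- {0}) \<omega>"
  unfolding \<omega>_def by (intro Cinf_on_Pair Cinf_on_scaleR Cinf_on_const Cinf_on_ident) auto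

lemma rotation_field_smooth: "Cinf_on (- {0}) (\<lambda>x. (rotation_field a x, 0 :: real))"
  by (intro Cinf_on_Pair Cinf_on_const Cinf_on_bounded_linear bounded_linear_rotation_field) auto

lemma \<omega>_orthogonal: "p \<in> S \<Longrightarrow> (p, c) \<bullet> \<omega> p = 0"
  using R_pos by (simp add: \<omega>_def inner_prod_def S_inner power2_eq_square)

text \<open>On the sphere (p, c) and \<open>\<omega> p\<close> are orthonormal, and the inner
  products of (p, 0) with them are R^2 and c R.\<close>

lemma base_split: "p \<in> S \<Longrightarrow> (p, 0) = R\<^sup>2 *\<^sub>R (p, c) + (c * R) *\<^sub>R \<omega> p"
proof -
  have "R\<^sup>2 *\<^sub>R p + (c * c) *\<^sub>R p = p"
    using cR by (simp add: scaleR_left_distrib[symmetric] power2_eq_square add.commute)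
  then show ?thesis
    using R_pos by (simp add: \<omega>_def power2_eq_square)
qed

lemma rotation_derivative_affine:
  assumes V: "Cinf_on (- {0}) V" and V0: "\<And>x. x \<in> S \<Longrightarrow> V x = (s *\<^sub>R x, u)" and p: "p \<in> S"
  shows "rotation_derivative a V p = (s *\<^sub>R rotation_field a p, 0)"
  by (rule rotation_derivative_eq_on_sphere[OF V _ p R_pos V0]) (auto intro!: derivative_eq_intros)

text \<open>The ambient derivative is (s A p, 0), already orthogonal to (p, c), so the projection
  changes nothing.\<close>

lemma rotation_connection_affine:
  assumes V: "Cinf_on (- {0}) V" and V0: "\<And>x. x \<in> S \<Longrightarrow> V x = (s *\<^sub>R x, u)" and p: "p \<in> S"
  shows "rotation_connection (\<phi> 0) a V p = (s *\<^sub>R rotation_field a p, 0)"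
proof -
  have "rotation_derivative a V p = (s *\<^sub>R rotation_field a p, 0)" by (rule rotation_derivative_affine[OF V V0 p])
  then show ?thesis by (simp add: rotation_connection_def \<phi>0[OF p] proj_def rotation_field_orthogonal)
qed

lemma rotation_derivative_rotation_connection_affine:
  assumes V: "Cinf_on (- {0}) V" and V0: "\<And>x. x \<in> S \<Longrightarrow> V x = (s *\<^sub>R x, u)" and p: "p \<in> S"
  shows "rotation_derivative a (rotation_connection (\<phi> 0) a V) p = (s *\<^sub>R rotation_field a (rotation_field a p), 0)"
proof (rule rotation_derivative_eq_on_sphere[OF Cinf_on_rotation_connection[OF \<phi>0_smooth V] _ p R_pos])
  show "((\<lambda>x. (s *\<^sub>R rotation_field a x, 0 :: real)) has_derivative (\<lambda>v. (s *\<^sub>R rotation_field a v, 0))) (at p)"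
    by (intro has_derivative_Pair has_derivative_const has_derivative_scaleR_right
        bounded_linear_imp_has_derivative bounded_linear_rotation_field)
qed (rule rotation_connection_affine[OF V V0])

text \<open>The combinations of \<open>\<omega>\<close> and the position vector (x, c) form a class
  that the Laplacian maps into multiples of \<open>\<omega>\<close>. Only the coefficient s of x
  matters: the accelerations of the rotation fields sum to a multiple of (p, 0), whose part tangent
  to the unit sphere is c R \<open>\<omega> p\<close>.\<close>

lemma rotation_laplacian_affine:
  assumes V: "Cinf_on (- {0}) V" and V0: "\<And>x. x \<in> S \<Longrightarrow> V x = \<alpha> *\<^sub>R \<omega> x + \<beta> *\<^sub>R (x, c)" and p: "p \<in> S"
  shows "rotation_laplacian R (\<phi> 0) V p = (m / R\<^sup>2 * (c\<^sup>2 * \<alpha> + c * R * \<beta>)) *\<^sub>R \<omega> p"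
proof -
  define s where "s = \<alpha> * c / R + \<beta>"
  have V0': "V x = (s *\<^sub>R x, - \<alpha> * R + \<beta> * c)" if "x \<in> S" for x
    by (simp add: V0[OF that] \<omega>_def s_def scaleR_left_distrib)
  have "rotation_derivative a (rotation_connection (\<phi> 0) a V) p = (s *\<^sub>R rotation_field a (rotation_field a p), 0)" for a
    by (rule rotation_derivative_rotation_connection_affine[OF V V0' p])
  then have "(\<Sum>a\<in>Basis \<times> Basis. rotation_connection (\<phi> 0) a (rotation_connection (\<phi> 0) a V) p)
      = (\<Sum>a\<in>Basis \<times> Basis. proj (p, c) (s *\<^sub>R rotation_field a (rotation_field a p), 0))"
    by (simp add: rotation_connection_def[of "\<phi> 0" _ "rotation_connection (\<phi> 0) _ V"] \<phi>0[OF p])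
  also have "\<dots> = proj (p, c) (\<Sum>a\<in>Basis \<times> Basis. (s *\<^sub>R rotation_field a (rotation_field a p), 0))"
    by (simp only: proj_simps)
  also have "(\<Sum>a\<in>Basis \<times> Basis. (s *\<^sub>R rotation_field a (rotation_field a p), 0 :: real)) = (- 2 * m * s) *\<^sub>R (p, 0)"
    by (rule prod_eqI) (simp_all add: fst_sum snd_sum scaleR_sum_right[symmetric] sum_rotation_field_rotation_field m_def mult.commute)
  also have "proj (p, c) ((- 2 * m * s) *\<^sub>R (p, 0)) = (- 2 * m * s * c * R) *\<^sub>R \<omega> p"
  proof -
    have "norm (p, c) = 1"
      using cR S_inner[OF p] by (simp add: norm_eq_sqrt_inner inner_prod_def power2_eq_square add.commute)
    then have "proj (p, c) (p, c) = 0" by (rule proj_self)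
    moreover have "proj (p, c) (\<omega> p) = \<omega> p"
      using \<omega>_orthogonal[OF p] by (simp add: proj_def inner_commute del: scaleR_Pair)
    moreover have "proj (p, c) (p, 0) = R\<^sup>2 *\<^sub>R proj (p, c) (p, c) + (c * R) *\<^sub>R proj (p, c) (\<omega> p)"
      by (subst base_split[OF p]) (simp only: proj_simps)
    ultimately have "proj (p, c) (p, 0) = (c * R) *\<^sub>R \<omega> p"
      by (simp only: scaleR_zero_right add_0_left)
    then show ?thesis by (simp only: proj_simps scaleR_scaleR mult.assoc)
  qed
  finally have S: "(\<Sum>a\<in>Basis \<times> Basis. rotation_connection (\<phi> 0) a (rotation_connection (\<phi> 0) a V) p) = (- 2 * m * s * c * R) *\<^sub>R \<omega> p" .
  have "- (1 / (2 * R\<^sup>2)) * (- 2 * m * s * c * R) = m / R\<^sup>2 * (c\<^sup>2 * \<alpha> + c * R * \<beta>)"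
    using R_pos by (simp add: s_def power2_eq_square field_simps)
  then show ?thesis unfolding rotation_laplacian_def S scaleR_scaleR by (rule arg_cong)
qed

text \<open>The first Laplacian acts on minus the position vector and yields -(m / R^2) c R; every
  further one multiplies by (m / R^2) c^2.\<close>

definition normal_coeff :: "nat \<Rightarrow> real" where "normal_coeff k = - ((m / R\<^sup>2) ^ (k + 1) * R * c ^ (2 * k + 1))"

lemma iterated_laplacian_at_0: "p \<in> S \<Longrightarrow> iterated_laplacian R (\<phi> 0) (Suc k) p = normal_coeff k *\<^sub>R \<omega> p"
proof (induction k arbitrary: p)
  case 0
  have "rotation_laplacian R (\<phi> 0) (iterated_laplacian R (\<phi> 0) 0) p = (m / R\<^sup>2 * (c\<^sup>2 * 0 + c * R * (- 1))) *\<^sub>R \<omega> p"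
    by (rule rotation_laplacian_affine[OF Cinf_on_iterated_laplacian[OF \<phi>0_smooth] _ 0])
      (simp only: iterated_laplacian.simps \<phi>0 scaleR_zero_left add_0_left scaleR_minus1_left)
  then show ?case by (simp add: normal_coeff_def mult_ac)
next
  case (Suc k)
  have "rotation_laplacian R (\<phi> 0) (iterated_laplacian R (\<phi> 0) (Suc k)) p = (m / R\<^sup>2 * (c\<^sup>2 * normal_coeff k + c * R * 0)) *\<^sub>R \<omega> p"
    by (rule rotation_laplacian_affine[OF Cinf_on_iterated_laplacian[OF \<phi>0_smooth] _ Suc.prems]) (simp only: Suc.IH, simp del: scaleR_Pair)
  moreover have "m / R\<^sup>2 * (c\<^sup>2 * normal_coeff k + c * R * 0) = normal_coeff (Suc k)"
    by (simp add: normal_coeff_def power2_eq_square mult_ac)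
  ultimately show ?case by (simp only: iterated_laplacian.simps)
qed

section \<open>Linearisation of the iterated Laplacian in normal direction\<close>

definition J :: real where "J = (LINT x|\<mu>. time_derivative \<phi> x \<bullet> \<omega> x)"

text \<open>Modulo derivatives along rotations, which integrate to zero, the variation of the rough
  Laplacian in normal direction only involves the normal components of \<open>time_derivative V\<close> and \<open>time_derivative \<phi>\<close>.\<close>

lemma variation_rotation_laplacian_pointwise:
  assumes V: "smooth_family \<epsilon> V" and V1: "\<And>t x. \<bar>t\<bar> < \<epsilon> \<Longrightarrow> x \<noteq> 0 \<Longrightarrow> V t x \<bullet> \<phi> t x = \<beta>"
    and V0: "\<And>x. x \<in> S \<Longrightarrow> V 0 x = \<alpha> *\<^sub>R \<omega> x + \<beta> *\<^sub>R (x, c)" and p: "p \<in> S"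
  defines "g \<equiv> \<lambda>a x. time_derivative (\<lambda>t. rotation_connection (\<phi> t) a (V t)) x \<bullet> \<omega> x - (c / R) * (time_derivative V x \<bullet> (rotation_field a x, 0))"
  shows "time_derivative (\<lambda>t. rotation_laplacian R (\<phi> t) (V t)) p \<bullet> \<omega> p
    = - (1 / (2 * R\<^sup>2)) * (\<Sum>a\<in>Basis \<times> Basis. rotation_derivative a (g a) p)
      + m / R\<^sup>2 * (c\<^sup>2 * (time_derivative V p \<bullet> \<omega> p) - (2 * c * R * \<alpha> + R\<^sup>2 * \<beta>) * (time_derivative \<phi> p \<bullet> \<omega> p))"
proof -
  have p0: "p \<noteq> 0" using sphere_nz[OF p] .
  define s where "s = \<alpha> * c / R + \<beta>"
  have V0': "V 0 x = (s *\<^sub>R x, - \<alpha> * R + \<beta> * c)" if "x \<in> S" for x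
    by (simp add: V0[OF that] \<omega>_def s_def scaleR_left_distrib)
  have V0s: "Cinf_on (- {0}) (V 0)" using smooth_family_slice[OF V] \<epsilon> by simp
  let ?v = "time_derivative \<phi> p" and ?dV = "time_derivative V"
  let ?Z = "\<lambda>a t. rotation_connection (\<phi> t) a (V t)"
  have Z: "smooth_family \<epsilon> (?Z a)" for a by (rule smooth_family_rotation_connection[OF \<phi> V])
  have dVs: "Cinf_on (- {0}) ?dV" by (rule Cinf_on_time_derivative[OF V \<epsilon>])
  have dZs: "Cinf_on (- {0}) (time_derivative (?Z a))" for a by (rule Cinf_on_time_derivative[OF Z \<epsilon>])
  have kn: "rotation_derivative a (rotation_connection (\<phi> 0) a (V 0)) p = (s *\<^sub>R rotation_field a (rotation_field a p), 0)" for a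
    by (rule rotation_derivative_rotation_connection_affine[OF V0s V0' p])
  have kV: "rotation_derivative a (V 0) p = (s *\<^sub>R rotation_field a p, 0)" for a
    by (rule rotation_derivative_affine[OF V0s V0' p])
  have rotation_derivative\<omega>: "rotation_derivative a \<omega> p = ((c / R) *\<^sub>R rotation_field a p, 0)" for a
    by (rule rotation_derivative_affine[OF \<omega>_smooth _ p]) (simp add: \<omega>_def)
  have kdkill: "rotation_derivative a (\<lambda>x. (rotation_field a x, 0 :: real)) p = (rotation_field a (rotation_field a p), 0)" for a
  proof (rule rotation_derivative_eq_on_sphere[OF rotation_field_smooth _ p R_pos])
    show "((\<lambda>x. (rotation_field a x, 0 :: real)) has_derivative (\<lambda>v. (rotation_field a v, 0))) (at p)"
      by (intro has_derivative_Pair has_derivative_const bounded_linear_imp_has_derivative bounded_linear_rotation_field)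
  qed simp
  \<comment> \<open>Two integrations by parts on the level of densities: the rotation derivative is
    moved first from the outer covariant derivative to \<open>\<omega>\<close>, then from the
    t-derivative of V to the field (A x, 0). \<open>g a\<close> collects the two functions whose
    total derivatives are split off.\<close>
  have Q: "time_derivative (\<lambda>t. rotation_connection (\<phi> t) a (?Z a t)) p \<bullet> \<omega> p
     = rotation_derivative a (g a) p + (c / R) * (?dV p \<bullet> (rotation_field a (rotation_field a p), 0)) + s * (rotation_field a p \<bullet> rotation_field a p) * (?v \<bullet> \<omega> p)" for a
  proof -
    \<comment> \<open>Differentiating the moving projection in t adds a multiple of the velocity and
      a multiple of (p, c); the latter is orthogonal to \<open>\<omega> p\<close>.\<close>
    have "time_derivative (\<lambda>t. rotation_connection (\<phi> t) a (?Z a t)) p \<bullet> \<omega> p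
       = time_derivative (\<lambda>t. rotation_derivative a (?Z a t)) p \<bullet> \<omega> p - (rotation_derivative a (?Z a 0) p \<bullet> \<phi> 0 p) * (?v \<bullet> \<omega> p)"
      unfolding rotation_connection_def[of _ a "?Z a _"] time_derivative_proj[OF \<phi> smooth_family_rotation_derivative[OF Z] \<epsilon> p0]
      using \<omega>_orthogonal[OF p] by (simp add: \<phi>0[OF p] inner_diff_left inner_add_left del: scaleR_Pair)
    also have "rotation_derivative a (?Z a 0) p \<bullet> \<phi> 0 p = - (s * (rotation_field a p \<bullet> rotation_field a p))"
      unfolding kn \<phi>0[OF p] by (simp add: inner_prod_def rotation_field_antisym[of _ "rotation_field _ p"])
    also have "time_derivative (\<lambda>t. rotation_derivative a (?Z a t)) p = rotation_derivative a (time_derivative (?Z a)) p" by (rule time_derivative_rotation_derivative[OF Z \<epsilon> p0])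
    finally have 1: "time_derivative (\<lambda>t. rotation_connection (\<phi> t) a (?Z a t)) p \<bullet> \<omega> p
       = rotation_derivative a (time_derivative (?Z a)) p \<bullet> \<omega> p + s * (rotation_field a p \<bullet> rotation_field a p) * (?v \<bullet> \<omega> p)" by simp
    \<comment> \<open>Here the moving projection contributes nothing: at time 0 the rotation
      derivative of V is orthogonal to (p, c), and so is (A p, 0).\<close>
    have "time_derivative (?Z a) p \<bullet> (rotation_field a p, 0) = rotation_derivative a ?dV p \<bullet> (rotation_field a p, 0)"
      unfolding rotation_connection_def time_derivative_proj[OF \<phi> smooth_family_rotation_derivative[OF V] \<epsilon> p0] time_derivative_rotation_derivative[OF V \<epsilon> p0]
      by (simp add: \<phi>0[OF p] kV inner_diff_left inner_add_left rotation_field_orthogonal del: scaleR_Pair)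
    then have 2: "time_derivative (?Z a) p \<bullet> rotation_derivative a \<omega> p = (c / R) * (rotation_derivative a ?dV p \<bullet> (rotation_field a p, 0))"
      unfolding rotation_derivative\<omega> by (simp add: inner_prod_def)
    have g1: "Cinf_on (- {0}) (\<lambda>x. time_derivative (?Z a) x \<bullet> \<omega> x)" by (rule Cinf_on_inner[OF dZs \<omega>_smooth])
    have g2: "Cinf_on (- {0}) (\<lambda>x. ?dV x \<bullet> (rotation_field a x, 0))" by (rule Cinf_on_inner[OF dVs rotation_field_smooth])
    have p': "p \<in> - {0}" using p0 by simp
    have "rotation_derivative a (g a) p = rotation_derivative a (\<lambda>x. time_derivative (?Z a) x \<bullet> \<omega> x) p - (c / R) * rotation_derivative a (\<lambda>x. ?dV x \<bullet> (rotation_field a x, 0)) p"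
      unfolding g_def rotation_derivative_def
        frechet_derivative_eqI[OF has_derivative_diff[OF Cinf_on_has_derivative[OF g1 p']
              has_derivative_mult_right[OF Cinf_on_has_derivative[OF g2 p']]]] ..
    then show ?thesis
      unfolding 1 rotation_derivative_inner[OF dZs \<omega>_smooth p0] rotation_derivative_inner[OF dVs rotation_field_smooth p0] 2 kdkill
      by (simp add: algebra_simps)
  qed
  have "time_derivative (\<lambda>t. rotation_laplacian R (\<phi> t) (V t)) p \<bullet> \<omega> p
      = - (1 / (2 * R\<^sup>2)) * (\<Sum>a\<in>Basis \<times> Basis. time_derivative (\<lambda>t. rotation_connection (\<phi> t) a (?Z a t)) p \<bullet> \<omega> p)"
  proof -
    have f: "smooth_family \<epsilon> (\<lambda>t. rotation_connection (\<phi> t) a (?Z a t))" for a by (rule smooth_family_rotation_connection[OF \<phi> Z])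
    have fs: "smooth_family \<epsilon> (\<lambda>t x. \<Sum>a\<in>Basis \<times> Basis. rotation_connection (\<phi> t) a (?Z a t) x)"
      using f unfolding smooth_family_def by (intro Cinf_on_sum open_smooth_family) auto
    show ?thesis
      unfolding rotation_laplacian_def time_derivative_scale[OF fs \<epsilon> p0] time_derivative_sum[OF f \<epsilon> p0]
      by (simp add: inner_sum_left)
  qed
  also have "(\<Sum>a\<in>Basis \<times> Basis. time_derivative (\<lambda>t. rotation_connection (\<phi> t) a (?Z a t)) p \<bullet> \<omega> p)
     = (\<Sum>a\<in>Basis \<times> Basis. rotation_derivative a (g a) p) + (c / R) * (- 2 * m * (?dV p \<bullet> (p, 0))) + 2 * m * s * R\<^sup>2 * (?v \<bullet> \<omega> p)"
  proof -
    have "(\<Sum>a\<in>Basis \<times> Basis. ?dV p \<bullet> (rotation_field a (rotation_field a p), 0)) = fst (?dV p) \<bullet> (\<Sum>a\<in>Basis \<times> Basis. rotation_field a (rotation_field a p))"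
      by (simp add: inner_prod_def inner_sum_right)
    also have "\<dots> = - 2 * m * (?dV p \<bullet> (p, 0))"
      unfolding sum_rotation_field_rotation_field by (simp add: inner_prod_def m_def)
    finally have A: "(\<Sum>a\<in>Basis \<times> Basis. ?dV p \<bullet> (rotation_field a (rotation_field a p), 0)) = - 2 * m * (?dV p \<bullet> (p, 0))" .
    have B: "(\<Sum>a\<in>Basis \<times> Basis. rotation_field a p \<bullet> rotation_field a p) = 2 * m * R\<^sup>2"
      unfolding sum_rotation_field_inner by (simp add: m_def S_inner[OF p])
    have "(\<Sum>a\<in>Basis \<times> Basis. time_derivative (\<lambda>t. rotation_connection (\<phi> t) a (?Z a t)) p \<bullet> \<omega> p)
      = (\<Sum>a\<in>Basis \<times> Basis. rotation_derivative a (g a) p) + (c / R) * (\<Sum>a\<in>Basis \<times> Basis. ?dV p \<bullet> (rotation_field a (rotation_field a p), 0))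
       + s * (\<Sum>a\<in>Basis \<times> Basis. rotation_field a p \<bullet> rotation_field a p) * (?v \<bullet> \<omega> p)"
      unfolding Q sum.distrib sum_distrib_left sum_distrib_right ..
    then show ?thesis unfolding A B by (simp add: mult_ac)
  qed
  \<comment> \<open>Both constraints, |\<open>\<phi>\<close>| = 1 and V . \<open>\<phi>\<close> =
    \<open>\<beta>\<close>, hold for all small t. Their time derivatives express the component of
    the t-derivative of V along (p, c) by the normal velocity; \<open>base_split\<close> then yields
    the component along (p, 0).\<close>
  also have "?dV p \<bullet> (p, 0) = - (R\<^sup>2 * \<alpha> * (?v \<bullet> \<omega> p)) + c * R * (?dV p \<bullet> \<omega> p)"
  proof -
    have const: "d = 0" if "((\<lambda>t. f t) has_vector_derivative d) (at 0)" "\<And>t. \<bar>t\<bar> < \<epsilon> \<Longrightarrow> f t = k" for f :: "real \<Rightarrow> real" and d k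
    proof (rule vector_derivative_unique_at[OF that(1)])
      show "(f has_vector_derivative 0) (at 0)"
        by (rule has_vector_derivative_transform_within_open[of "\<lambda>_. k" _ _ "{-\<epsilon><..<\<epsilon>}"]) (use \<epsilon> that(2) in auto)
    qed
    have "?v \<bullet> \<phi> 0 p + \<phi> 0 p \<bullet> ?v = 0"
      using has_time_derivative[OF smooth_family_inner[OF \<phi> \<phi>] \<epsilon> p0] unfolding time_derivative_inner[OF \<phi> \<phi> \<epsilon> p0]
      by (rule const[where k=1]) (simp add: dot_square_norm \<phi>_norm p0)
    then have vp: "(p, c) \<bullet> ?v = 0" by (simp add: \<phi>0[OF p] inner_commute)
    have "?dV p \<bullet> \<phi> 0 p + V 0 p \<bullet> ?v = 0"
      using has_time_derivative[OF smooth_family_inner[OF V \<phi>] \<epsilon> p0] unfolding time_derivative_inner[OF V \<phi> \<epsilon> p0]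
      by (rule const[where k=\<beta>]) (simp add: V1 p0)
    then have "?dV p \<bullet> (p, c) = - (\<alpha> * (?v \<bullet> \<omega> p))"
      using vp by (simp add: \<phi>0[OF p] V0[OF p] inner_add_left inner_add_right inner_commute del: scaleR_Pair)
    then show ?thesis
      by (subst base_split[OF p]) (simp add: inner_add_right del: scaleR_Pair)
  qed
  finally show ?thesis
    using R_pos by (simp add: s_def field_simps power2_eq_square)
qed

text \<open>After integration only normal components remain, so the variations of the iterates obey
  a scalar linear recursion.\<close>

lemma integral_variation_rotation_laplacian:
  assumes V: "smooth_family \<epsilon> V" and V1: "\<And>t x. \<bar>t\<bar> < \<epsilon> \<Longrightarrow> x \<noteq> 0 \<Longrightarrow> V t x \<bullet> \<phi> t x = \<beta>"
    and V0: "\<And>x. x \<in> S \<Longrightarrow> V 0 x = \<alpha> *\<^sub>R \<omega> x + \<beta> *\<^sub>R (x, c)"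
  shows "(LINT x|\<mu>. time_derivative (\<lambda>t. rotation_laplacian R (\<phi> t) (V t)) x \<bullet> \<omega> x)
    = m / R\<^sup>2 * (c\<^sup>2 * (LINT x|\<mu>. time_derivative V x \<bullet> \<omega> x) - (2 * c * R * \<alpha> + R\<^sup>2 * \<beta>) * J)"
proof -
  define g where "g = (\<lambda>a x. time_derivative (\<lambda>t. rotation_connection (\<phi> t) a (V t)) x \<bullet> \<omega> x - (c / R) * (time_derivative V x \<bullet> (rotation_field a x, 0)))"
  have dV: "Cinf_on (- {0}) (time_derivative V)" and d\<phi>: "Cinf_on (- {0}) (time_derivative \<phi>)"
    using V \<phi> \<epsilon> by (auto intro: Cinf_on_time_derivative)
  have g: "Cinf_on (- {0}) (g a)" for a
    unfolding g_def
    by (intro Cinf_on_diff Cinf_on_mult Cinf_on_inner Cinf_on_const Cinf_on_time_derivative[OF smooth_family_rotation_connection[OF \<phi> V] \<epsilon>] dV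
        \<omega>_smooth rotation_field_smooth Cinf_on_open[OF dV])
  have i1: "integrable \<mu> (rotation_derivative a (g a))" for a by (rule integrable_Cinf[OF Cinf_on_rotation_derivative[OF g]])
  have i2: "integrable \<mu> (\<lambda>x. time_derivative V x \<bullet> \<omega> x)" by (rule integrable_Cinf[OF Cinf_on_inner[OF dV \<omega>_smooth]])
  have i3: "integrable \<mu> (\<lambda>x. time_derivative \<phi> x \<bullet> \<omega> x)" by (rule integrable_Cinf[OF Cinf_on_inner[OF d\<phi> \<omega>_smooth]])
  have "(LINT x|\<mu>. time_derivative (\<lambda>t. rotation_laplacian R (\<phi> t) (V t)) x \<bullet> \<omega> x)
    = (LINT x|\<mu>. - (1 / (2 * R\<^sup>2)) * (\<Sum>a\<in>Basis \<times> Basis. rotation_derivative a (g a) x)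
      + m / R\<^sup>2 * (c\<^sup>2 * (time_derivative V x \<bullet> \<omega> x) - (2 * c * R * \<alpha> + R\<^sup>2 * \<beta>) * (time_derivative \<phi> x \<bullet> \<omega> x)))"
    unfolding g_def
    by (intro Bochner_Integration.integral_cong refl variation_rotation_laplacian_pointwise[OF V V1 V0]) (simp_all add: space_\<mu>)
  also have "\<dots> = - (1 / (2 * R\<^sup>2)) * (\<Sum>a\<in>Basis \<times> Basis. LINT x|\<mu>. rotation_derivative a (g a) x)
    + m / R\<^sup>2 * (c\<^sup>2 * (LINT x|\<mu>. time_derivative V x \<bullet> \<omega> x) - (2 * c * R * \<alpha> + R\<^sup>2 * \<beta>) * J)"
    using i1 i2 i3 by (simp add: J_def)
  also have "(\<Sum>a\<in>Basis \<times> Basis. LINT x|\<mu>. rotation_derivative a (g a) x) = 0"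
    by (intro sum.neutral ballI integral_rotation_derivative g)
  finally show ?thesis by simp
qed

text \<open>The closed solution d of d(0) = -(m / R^2) (c^2 - R^2) and d(k+1) = (m / R^2) (c^2 d(k)
  - 2 c R \<open>normal_coeff k\<close>). The odd factor 2k + 1 counts one R^2 from the start and
  two per step.\<close>

definition normal_coeff_variation :: "nat \<Rightarrow> real" where
  "normal_coeff_variation k = - ((m / R\<^sup>2) ^ (k + 1) * (c ^ (2 * k + 2) - (2 * real k + 1) * R\<^sup>2 * c ^ (2 * k)))"

text \<open>The start differs from the later steps: minus the map has normal coefficient 0 and inner
  product -1 with the map, whereas all later iterates are tangent to the sphere along the map and
  have a normal coefficient.\<close>

lemma integral_variation_iterated_laplacian:
  "(LINT x|\<mu>. time_derivative (\<lambda>t. iterated_laplacian R (\<phi> t) (Suc k)) x \<bullet> \<omega> x) = normal_coeff_variation k * J"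
proof (induction k)
  case 0
  have "(LINT x|\<mu>. time_derivative (\<lambda>t. rotation_laplacian R (\<phi> t) (iterated_laplacian R (\<phi> t) 0)) x \<bullet> \<omega> x)
    = m / R\<^sup>2 * (c\<^sup>2 * (LINT x|\<mu>. time_derivative (\<lambda>t. iterated_laplacian R (\<phi> t) 0) x \<bullet> \<omega> x) - (2 * c * R * 0 + R\<^sup>2 * - 1) * J)"
  proof (rule integral_variation_rotation_laplacian[OF smooth_family_iterated_laplacian[OF \<phi>]])
    show "iterated_laplacian R (\<phi> t) 0 x \<bullet> \<phi> t x = - 1" if "\<bar>t\<bar> < \<epsilon>" "x \<noteq> 0" for t x
      using \<phi>_norm[OF that] by (simp add: dot_square_norm)
    show "iterated_laplacian R (\<phi> 0) 0 x = 0 *\<^sub>R \<omega> x + - 1 *\<^sub>R (x, c)" if "x \<in> S" for x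
      using \<phi>0[OF that] by (simp only: iterated_laplacian.simps scaleR_zero_left add_0_left scaleR_minus1_left)
  qed
  also have "(LINT x|\<mu>. time_derivative (\<lambda>t. iterated_laplacian R (\<phi> t) 0) x \<bullet> \<omega> x) = - J"
  proof -
    have "time_derivative (\<lambda>t. iterated_laplacian R (\<phi> t) 0) x = - time_derivative \<phi> x" if "x \<in> space \<mu>" for x
    proof -
      have "x \<noteq> 0" using that sphere_nz[of x] by (simp add: space_\<mu>)
      from has_vector_derivative_minus[OF has_time_derivative[OF \<phi> \<epsilon> this]] show ?thesis
        by (intro tderivI) simp
    qed
    then have "(LINT x|\<mu>. time_derivative (\<lambda>t. iterated_laplacian R (\<phi> t) 0) x \<bullet> \<omega> x) = (LINT x|\<mu>. - (time_derivative \<phi> x \<bullet> \<omega> x))"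
      by (intro Bochner_Integration.integral_cong) simp_all
    then show ?thesis by (simp add: J_def)
  qed
  finally show ?case by (simp add: normal_coeff_variation_def power2_eq_square algebra_simps)
next
  case (Suc k)
  have "(LINT x|\<mu>. time_derivative (\<lambda>t. rotation_laplacian R (\<phi> t) (iterated_laplacian R (\<phi> t) (Suc k))) x \<bullet> \<omega> x)
    = m / R\<^sup>2 * (c\<^sup>2 * (LINT x|\<mu>. time_derivative (\<lambda>t. iterated_laplacian R (\<phi> t) (Suc k)) x \<bullet> \<omega> x) - (2 * c * R * normal_coeff k + R\<^sup>2 * 0) * J)"
  proof (rule integral_variation_rotation_laplacian[OF smooth_family_iterated_laplacian[OF \<phi>]])
    show "iterated_laplacian R (\<phi> t) (Suc k) x \<bullet> \<phi> t x = 0" if "\<bar>t\<bar> < \<epsilon>" "x \<noteq> 0" for t x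
      using \<phi>_norm[OF that] by (simp add: rotation_laplacian_orthogonal)
    show "iterated_laplacian R (\<phi> 0) (Suc k) x = normal_coeff k *\<^sub>R \<omega> x + 0 *\<^sub>R (x, c)" if "x \<in> S" for x
      using iterated_laplacian_at_0[OF that, of k] by (simp only: scaleR_zero_left add_0_right)
  qed
  also have "\<dots> = m / R\<^sup>2 * (c\<^sup>2 * normal_coeff_variation k - 2 * c * R * normal_coeff k) * J"
    unfolding Suc.IH by (simp add: algebra_simps)
  also have "m / R\<^sup>2 * (c\<^sup>2 * normal_coeff_variation k - 2 * c * R * normal_coeff k) = normal_coeff_variation (Suc k)"
  proof -
    define q where "q = m / R\<^sup>2"
    show ?thesis
      unfolding normal_coeff_variation_def normal_coeff_def q_def[symmetric] by (simp add: power2_eq_square algebra_simps)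
  qed
  finally show ?case by (simp only: iterated_laplacian.simps)
qed

text \<open>At time 0 each factor is a multiple of \<open>\<omega>\<close>, so the product rule
  needs only the integrals already known.\<close>

lemma energy_derivative:
  "((\<lambda>t. 1 / 2 * (LINT x|\<mu>. iterated_laplacian R (\<phi> t) (Suc i) x \<bullet> iterated_laplacian R (\<phi> t) (Suc j) x)) has_real_derivative
     (m / R\<^sup>2) ^ (i + j + 2) * R * c ^ (2 * (i + j) + 1) * (1 - (real (i + j) + 2) * R\<^sup>2) * J) (at 0)"
proof -
  let ?W = "\<lambda>k t. iterated_laplacian R (\<phi> t) (Suc k)"
  have W: "smooth_family \<epsilon> (?W k)" for k by (rule smooth_family_iterated_laplacian[OF \<phi>])
  have dW: "integrable \<mu> (\<lambda>x. time_derivative (?W k) x \<bullet> \<omega> x)" for k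
    by (rule integrable_Cinf[OF Cinf_on_inner[OF Cinf_on_time_derivative[OF W \<epsilon>] \<omega>_smooth]])
  have "((\<lambda>t. LINT x|\<mu>. ?W i t x \<bullet> ?W j t x) has_real_derivative
      (LINT x|\<mu>. time_derivative (\<lambda>t x. ?W i t x \<bullet> ?W j t x) x)) (at 0)"
    by (rule has_derivative_integral[OF smooth_family_inner[OF W W] \<epsilon>])
  also have "(LINT x|\<mu>. time_derivative (\<lambda>t x. ?W i t x \<bullet> ?W j t x) x)
      = (LINT x|\<mu>. normal_coeff j * (time_derivative (?W i) x \<bullet> \<omega> x) + normal_coeff i * (time_derivative (?W j) x \<bullet> \<omega> x))"
  proof (rule Bochner_Integration.integral_cong[OF refl])
    fix x assume "x \<in> space \<mu>"
    then have x: "x \<in> S" by (simp only: space_\<mu>)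
    have x0: "x \<noteq> 0" using x by (rule sphere_nz)
    show "time_derivative (\<lambda>t x. ?W i t x \<bullet> ?W j t x) x = normal_coeff j * (time_derivative (?W i) x \<bullet> \<omega> x) + normal_coeff i * (time_derivative (?W j) x \<bullet> \<omega> x)"
      unfolding time_derivative_inner[OF W W \<epsilon> x0] iterated_laplacian_at_0[OF x] by (simp add: inner_commute)
  qed
  also have "\<dots> = (normal_coeff j * normal_coeff_variation i + normal_coeff i * normal_coeff_variation j) * J"
    using dW[of i] dW[of j] by (simp add: integral_variation_iterated_laplacian del: iterated_laplacian.simps) (simp add: algebra_simps)
  also have "normal_coeff j * normal_coeff_variation i + normal_coeff i * normal_coeff_variation j
    = 2 * ((m / R\<^sup>2) ^ (i + j + 2) * R * c ^ (2 * (i + j) + 1) * (1 - (real (i + j) + 2) * R\<^sup>2))"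
  proof -
    define q where "q = m / R\<^sup>2"
    define u w a b where "u = c ^ i" and "w = c ^ j" and "a = q ^ (i + 1)" and "b = q ^ (j + 1)"
    have e: "c ^ (2 * i) = u * u" "c ^ (2 * j) = w * w" "c ^ (2 * i + 1) = c * (u * u)" "c ^ (2 * j + 1) = c * (w * w)"
      "c ^ (2 * i + 2) = c\<^sup>2 * (u * u)" "c ^ (2 * j + 2) = c\<^sup>2 * (w * w)"
      "c ^ (2 * (i + j) + 1) = c * (u * u) * (w * w)" "q ^ (i + j + 2) = a * b"
      by (simp_all add: u_def w_def a_def b_def mult_2 power_add power2_eq_square)
    have "normal_coeff j * normal_coeff_variation i + normal_coeff i * normal_coeff_variation j = a * b * R * (c * (u * u) * (w * w)) * (2 * c\<^sup>2 - (2 * real i + 2 * real j + 2) * R\<^sup>2)"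
      unfolding normal_coeff_def normal_coeff_variation_def q_def[symmetric] a_def[symmetric] b_def[symmetric] e by (simp add: algebra_simps)
    \<comment> \<open>Eliminating c^2 adds one more R^2 per factor, which completes i + j + 1 to i +
      j + 2, the order of the energy.\<close>
    also have "2 * c\<^sup>2 - (2 * real i + 2 * real j + 2) * R\<^sup>2 = 2 * (1 - (real (i + j) + 2) * R\<^sup>2)"
      using cR by (simp add: algebra_simps)
    finally show ?thesis
      unfolding q_def[symmetric] e by (simp only: mult_ac)
  qed
  finally have "((\<lambda>t. 1 / 2 * (LINT x|\<mu>. ?W i t x \<bullet> ?W j t x)) has_real_derivative
    1 / 2 * (2 * ((m / R\<^sup>2) ^ (i + j + 2) * R * c ^ (2 * (i + j) + 1) * (1 - (real (i + j) + 2) * R\<^sup>2)) * J)) (at 0)"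
    by (rule DERIV_cmult)
  then show ?thesis by (simp only: mult.assoc) (simp add: mult.assoc)
qed

end


subsection \<open>Variations of the canonical inclusion\<close>

lemma sphere_measure_sphere_volume:
  "R > 0 \<Longrightarrow> sphere_measure (sphere_volume R :: 'a::euclidean_space measure) R"
  by (intro sphere_measure.intro sphere_measure_axioms.intro finite_measure_sphere_volume
      space_sphere_volume sets_sphere_volume sphere_volume_invariant)

text \<open>Derivatives of a variation are only defined along the sphere; extending it by homogeneity of
  degree zero gives a smooth family on the punctured space.\<close>

lemma smooth_variation_extension:
  fixes \<Phi> :: "real \<Rightarrow> 'a::euclidean_space \<Rightarrow> 'b::euclidean_space"
  assumes "smooth_variation (sphere 0 R) (sphere 0 1) \<phi> \<Phi>" and R: "R > 0"
  obtains \<epsilon> where "\<epsilon> > 0" "smooth_family \<epsilon> (\<lambda>t x. \<Phi> t ((R / norm x) *\<^sub>R x))"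
    "\<And>t x. \<bar>t\<bar> < \<epsilon> \<Longrightarrow> x \<noteq> 0 \<Longrightarrow> norm (\<Phi> t ((R / norm x) *\<^sub>R x)) = 1"
proof -
  let ?M = "sphere (0::'a) R"
  obtain \<epsilon> where \<epsilon>: "\<epsilon> > 0" and sm: "smooth_map (?M \<times> {-\<epsilon><..<\<epsilon>}) (sphere 0 1) (\<lambda>(x, t). \<Phi> t x)"
    using assms(1) unfolding smooth_variation_def by blast
  let ?\<Omega> = "(- {0::'a}) \<times> {-\<epsilon><..<\<epsilon>}"
  \<comment> \<open>The radial retraction in space, with time left unchanged.\<close>
  define \<rho> where "\<rho> = (\<lambda>z :: 'a \<times> real. ((R * inverse (norm (fst z))) *\<^sub>R fst z, snd z))"
  have \<rho>: "Cinf_on ?\<Omega> \<rho>"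
    unfolding \<rho>_def
    by (intro Cinf_on_Pair Cinf_on_scaleR Cinf_on_mult Cinf_on_const Cinf_on_inverse_norm Cinf_on_fst Cinf_on_snd open_smooth_family) auto
  have \<rho>M: "\<rho> z \<in> ?M \<times> {-\<epsilon><..<\<epsilon>}" if "z \<in> ?\<Omega>" for z
    using that R by (cases z) (simp add: \<rho>_def)
  have n: "norm (\<Phi> t ((R / norm x) *\<^sub>R x)) = 1" if "\<bar>t\<bar> < \<epsilon>" "x \<noteq> 0" for t x
  proof -
    have "\<rho> (x, t) \<in> ?M \<times> {-\<epsilon><..<\<epsilon>}" using that by (intro \<rho>M) auto
    moreover have "(\<lambda>(x, t). \<Phi> t x) ` (?M \<times> {-\<epsilon><..<\<epsilon>}) \<subseteq> sphere 0 1"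
      using sm by (simp only: smooth_map_def)
    ultimately have "(\<lambda>(x, t). \<Phi> t x) (\<rho> (x, t)) \<in> sphere 0 1"
      by (rule subsetD[OF _ imageI, rotated])
    then show ?thesis by (simp add: \<rho>_def divide_inverse)
  qed
  have "smooth_family \<epsilon> (\<lambda>t x. \<Phi> t ((R / norm x) *\<^sub>R x))"
    unfolding smooth_family_def
  proof (rule Cinf_on_local[OF open_smooth_family])
    fix z assume z: "z \<in> ?\<Omega>"
    have so: "smooth_on (?M \<times> {-\<epsilon><..<\<epsilon>}) (\<lambda>(x, t). \<Phi> t x)" using sm by (simp only: smooth_map_def)
    obtain U G where G: "\<rho> z \<in> U" "Cinf_on U G"
      "\<And>y. y \<in> (?M \<times> {-\<epsilon><..<\<epsilon>}) \<inter> U \<Longrightarrow> G y = (\<lambda>(x, t). \<Phi> t x) y"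
      by (rule smooth_onE[OF so \<rho>M[OF z]]) (rule that, assumption, assumption, blast)
    \<comment> \<open>Smoothness on the product of sphere and interval provides an extension G near
      the retracted point only. On V the family is G after the retraction, and the local pieces are
      glued.\<close>
    define V where "V = ?\<Omega> \<inter> \<rho> -` U"
    have oV: "open V"
      unfolding V_def by (rule continuous_open_preimage[OF Cinf_on_continuous[OF \<rho>] open_smooth_family Cinf_on_open[OF G(2)]])
    have V: "V \<subseteq> ?\<Omega>" by (auto simp: V_def)
    have "Cinf_on V (\<lambda>z. G (\<rho> z))"
      by (rule Cinf_on_compose[OF G(2) Cinf_on_subset[OF \<rho> oV V]]) (simp add: V_def)
    then have "Cinf_on V (\<lambda>z. \<Phi> (snd z) ((R / norm (fst z)) *\<^sub>R fst z))"
    proof (rule Cinf_on_cong)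
      fix y assume "y \<in> V"
      then have "\<rho> y \<in> (?M \<times> {-\<epsilon><..<\<epsilon>}) \<inter> U" using \<rho>M V by (auto simp: V_def)
      from G(3)[OF this] show "G (\<rho> y) = \<Phi> (snd y) ((R / norm (fst y)) *\<^sub>R fst y)"
        by (simp add: \<rho>_def divide_inverse)
    qed
    then show "\<exists>V. z \<in> V \<and> V \<subseteq> ?\<Omega> \<and> Cinf_on V (\<lambda>z. \<Phi> (snd z) ((R / norm (fst z)) *\<^sub>R fst z))"
      using V z G(1) by (intro exI[of _ V]) (auto simp: V_def)
  qed
  then show ?thesis using that \<epsilon> n by blast
qed

context
  fixes R c :: real
  assumes R: "R > 0" and cR: "c\<^sup>2 + R\<^sup>2 = 1"
begin

private abbreviation (input) "M \<equiv> sphere (0::'a::euclidean_space) R"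
private abbreviation (input) "N \<equiv> sphere (0::'a::euclidean_space \<times> real) 1"
private abbreviation (input) "\<mu> \<equiv> sphere_volume R :: 'a::euclidean_space measure"

definition normal_integral :: "(real \<Rightarrow> 'a::euclidean_space \<Rightarrow> 'a \<times> real) \<Rightarrow> real" where
  "normal_integral \<Phi> = (LINT x|\<mu>. time_derivative (\<lambda>t x. \<Phi> t ((R / norm x) *\<^sub>R x)) x \<bullet> ((c / R) *\<^sub>R x, - R))"

text \<open>The variation and its extension agree on the sphere, so the formulas for the extended
  family transfer to it. The tension field at time 0 comes from the same family.\<close>

lemma first_variation:
  fixes \<Phi> :: "real \<Rightarrow> 'a::euclidean_space \<Rightarrow> 'a \<times> real"
  assumes \<Phi>: "smooth_variation M N (\<lambda>x. (x, c)) \<Phi>" and r: "r \<ge> 2"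
  shows "((\<lambda>t. r_energy \<mu> M N r (\<Phi> t)) has_real_derivative
      ((real DIM('a) - 1) / R\<^sup>2) ^ r * R * c ^ (2 * (r - 2) + 1) * (1 - real r * R\<^sup>2) * normal_integral \<Phi>) (at 0)"
    and "p \<in> M \<Longrightarrow> tension_field M N (\<Phi> 0) p = (- ((real DIM('a) - 1) / R\<^sup>2 * R * c)) *\<^sub>R ((c / R) *\<^sub>R p, - R)"
proof -
  let ?\<phi> = "\<lambda>t x. \<Phi> t ((R / norm x) *\<^sub>R x)"
  obtain \<epsilon> where ext: "\<epsilon> > 0" "smooth_family \<epsilon> ?\<phi>" "\<And>t x. \<bar>t\<bar> < \<epsilon> \<Longrightarrow> x \<noteq> 0 \<Longrightarrow> norm (?\<phi> t x) = 1"
    using smooth_variation_extension[OF \<Phi> R] by blast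
  have M: "?\<phi> t x = \<Phi> t x" if "x \<in> M" for t x using that R by simp
  interpret inclusion_variation "sphere_volume R :: 'a measure" R c \<epsilon> ?\<phi>
  proof (intro inclusion_variation.intro inclusion_variation_axioms.intro sphere_measure_sphere_volume R)
    show "?\<phi> 0 x = (x, c)" if "x \<in> M" for x
      using \<Phi> that unfolding M[OF that] smooth_variation_def by blast
  qed (use ext cR in auto)
  have se: "sphere_energy (sphere_volume R :: 'a measure) R (?\<phi> t) (\<Phi> t)" if "\<bar>t\<bar> < \<epsilon>" for t
  proof (intro sphere_energy.intro sphere_valued.intro)
    show "sphere_measure (sphere_volume R :: 'a measure) R" by (rule sphere_measure_sphere_volume[OF R])
    show "Cinf_on (- {0}) (?\<phi> t)" by (rule smooth_family_slice[OF ext(2) that])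
  qed (use R ext(3) that M in auto)
  obtain i j where ij: "r div 2 = Suc i" "(r + 1) div 2 = Suc j" "r = i + j + 2"
  proof
    show "r div 2 = Suc (r div 2 - 1)" "(r + 1) div 2 = Suc ((r + 1) div 2 - 1)"
      "r = (r div 2 - 1) + ((r + 1) div 2 - 1) + 2" using r by presburger+
  qed
  have "((\<lambda>t. 1 / 2 * (LINT x|sphere_volume R. iterated_laplacian R (?\<phi> t) (Suc i) x \<bullet> iterated_laplacian R (?\<phi> t) (Suc j) x)) has_real_derivative
     (m / R\<^sup>2) ^ (i + j + 2) * R * c ^ (2 * (i + j) + 1) * (1 - (real (i + j) + 2) * R\<^sup>2) * J) (at 0)"
    by (rule energy_derivative)
  then have "((\<lambda>t. r_energy \<mu> M N r (\<Phi> t)) has_real_derivative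
     (m / R\<^sup>2) ^ (i + j + 2) * R * c ^ (2 * (i + j) + 1) * (1 - (real (i + j) + 2) * R\<^sup>2) * J) (at 0)"
  \<comment> \<open>The energies are identified for small t only, which is enough for the derivative
    at 0.\<close>
  proof (rule has_field_derivative_transform_within_open[where S="{-\<epsilon><..<\<epsilon>}"])
    show "1 / 2 * (LINT x|sphere_volume R. iterated_laplacian R (?\<phi> t) (Suc i) x \<bullet> iterated_laplacian R (?\<phi> t) (Suc j) x) = r_energy \<mu> M N r (\<Phi> t)"
      if "t \<in> {-\<epsilon><..<\<epsilon>}" for t
      using sphere_energy.r_energy_eq[OF se r, of t] that unfolding ij(1,2) by (simp add: abs_less_iff)
  qed (use ext(1) in auto)
  then show "((\<lambda>t. r_energy \<mu> M N r (\<Phi> t)) has_real_derivative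
      ((real DIM('a) - 1) / R\<^sup>2) ^ r * R * c ^ (2 * (r - 2) + 1) * (1 - real r * R\<^sup>2) * normal_integral \<Phi>) (at 0)"
    unfolding ij(3) m_def J_def \<omega>_def normal_integral_def by (simp add: add.commute)
  show "tension_field M N (\<Phi> 0) p = (- ((real DIM('a) - 1) / R\<^sup>2 * R * c)) *\<^sub>R ((c / R) *\<^sub>R p, - R)" if "p \<in> M"
  proof -
    interpret s: sphere_energy "sphere_volume R :: 'a measure" R "?\<phi> 0" "\<Phi> 0" by (rule se) (use ext(1) in simp)
    have "tension_field M N (\<Phi> 0) p = iterated_laplacian R (?\<phi> 0) (Suc 0) p"
      using s.iterated_laplacian_eq[OF that, of 0] by (simp only: funpow_0)
    also have "\<dots> = normal_coeff 0 *\<^sub>R \<omega> p" by (rule iterated_laplacian_at_0[OF that])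
    finally show ?thesis by (simp only: normal_coeff_def m_def \<omega>_def add_0 mult_0_right power_one_right)
  qed
qed

text \<open>The position vector and the unit normal are orthonormal, so (x, c) moved by t times the
  normal has squared norm 1 + t^2, and rescaling returns it to the unit sphere. The scaling factor
  is stationary at 0, so the initial velocity is exactly the unit normal and
  \<open>normal_integral\<close> equals the volume.\<close>

lemma normal_variation:
  defines "\<Phi> \<equiv> \<lambda>t (x :: 'a::euclidean_space). (1 + t * t) powr (- 1 / 2) *\<^sub>R ((x, c) + t *\<^sub>R ((c / R) *\<^sub>R x, - R))"
  shows "smooth_variation M N (\<lambda>x. (x, c)) \<Phi>" and "normal_integral \<Phi> > 0"
proof -
  define \<omega> where "\<omega> = (\<lambda>x :: 'a. ((c / R) *\<^sub>R x, - R))"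
  have pos: "1 + t * t > 0" for t :: real by (simp add: add_pos_nonneg)
  have xx: "x \<bullet> x = R\<^sup>2" if "x \<in> M" for x using that by (simp add: dot_square_norm)
  have in1: "(x, c) \<bullet> (x, c) = 1" "(x, c) \<bullet> \<omega> x = 0" "\<omega> x \<bullet> \<omega> x = 1" if "x \<in> M" for x
    using R cR by (simp_all add: \<omega>_def inner_prod_def xx[OF that] power2_eq_square)
  have n: "\<Phi> t x \<in> N" if "x \<in> M" for x t
  proof -
    have "((x, c) + t *\<^sub>R \<omega> x) \<bullet> ((x, c) + t *\<^sub>R \<omega> x) = 1 + t * t"
      using in1[OF that] by (simp add: inner_add_left inner_add_right inner_commute del: inner_Pair scaleR_Pair)
    then have "norm ((x, c) + t *\<^sub>R \<omega> x) = sqrt (1 + t * t)" by (simp only: norm_eq_sqrt_inner)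
    moreover have "norm (\<Phi> t x) = (1 + t * t) powr (- 1 / 2) * norm ((x, c) + t *\<^sub>R \<omega> x)"
      unfolding \<Phi>_def \<omega>_def norm_scaleR by simp
    ultimately show ?thesis
      using pos[of t] by (simp add: powr_minus powr_half_sqrt)
  qed
  have "Cinf_on UNIV (\<lambda>z :: 'a \<times> real. \<Phi> (snd z) (fst z))"
    unfolding \<Phi>_def
    by (intro Cinf_on_scaleR Cinf_on_powr Cinf_on_add Cinf_on_mult Cinf_on_Pair Cinf_on_const Cinf_on_fst Cinf_on_snd
        Cinf_on_minus open_UNIV pos)
  then have "smooth_on (M \<times> {-1<..<1}) (\<lambda>(x, t). \<Phi> t x)" by (rule smooth_onI) auto
  then show "smooth_variation M N (\<lambda>x. (x, c)) \<Phi>"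
    unfolding smooth_variation_def smooth_map_def using n
    by (intro conjI exI[of _ 1]) (auto simp: \<Phi>_def)
  have d: "time_derivative (\<lambda>t x. \<Phi> t ((R / norm x) *\<^sub>R x)) x \<bullet> \<omega> x = 1" if "x \<in> M" for x
  proof -
    have "((\<lambda>t. (1 + t * t) powr (- 1 / 2)) has_real_derivative 0) (at 0)"
      by (auto intro!: derivative_eq_intros)
    then have "((\<lambda>t. (1 + t * t) powr (- 1 / 2) *\<^sub>R ((x, c) + t *\<^sub>R \<omega> x)) has_vector_derivative
        (1 + 0 * 0) powr (- 1 / 2) *\<^sub>R \<omega> x + 0 *\<^sub>R ((x, c) + 0 *\<^sub>R \<omega> x)) (at (0::real))"
      by (intro has_vector_derivative_scaleR) (auto intro!: derivative_eq_intros)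
    then have "((\<lambda>t. \<Phi> t ((R / norm x) *\<^sub>R x)) has_vector_derivative \<omega> x) (at 0)"
      using that R by (simp add: \<Phi>_def \<omega>_def)
    from tderivI[of "\<lambda>t x. \<Phi> t ((R / norm x) *\<^sub>R x)", OF this] show ?thesis using in1(3)[OF that] by simp
  qed
  have "normal_integral \<Phi> = (LINT x|(sphere_volume R :: 'a measure). 1)"
    unfolding normal_integral_def
    by (rule Bochner_Integration.integral_cong[OF refl])
      (use d in \<open>simp add: space_sphere_volume[OF R] \<omega>_def\<close>)
  also have "\<dots> = measure (sphere_volume R) (sphere (0::'a) R)" by (simp add: space_sphere_volume[OF R])
  finally show "normal_integral \<Phi> > 0" using measure_sphere_volume_pos[OF R, where 'a='a] by simp
qed

lemma isometric_immersion_inclusion: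
  "isometric_immersion M N (\<lambda>x. (x, c))"
proof -
  have "Cinf_on UNIV (\<lambda>x :: 'a. (x, c))"
    by (intro Cinf_on_Pair Cinf_on_ident Cinf_on_const open_UNIV)
  then have "smooth_on M (\<lambda>x :: 'a. (x, c))" by (rule smooth_onI) auto
  moreover have "(x, c) \<in> N" if "x \<in> M" for x :: 'a
    using that cR by (simp add: norm_Pair add.commute)
  ultimately have "smooth_map M N (\<lambda>x :: 'a. (x, c))" unfolding smooth_map_def by blast
  moreover have d: "frechet_derivative (\<lambda>x. (x, c)) (at p within M) v = (v, 0)"
    if "p \<in> M" "v \<in> tangent_space M p" for p v :: 'a
  proof (rule frechet_derivative_within_tangent[OF _ open_UNIV _ _ that])
    show "((\<lambda>x. (x, c)) has_derivative (\<lambda>v. (v, 0))) (at p)" by (auto intro!: derivative_eq_intros)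
  qed auto
  ultimately show ?thesis
    unfolding isometric_immersion_def by (intro conjI ballI) (simp_all only: d inner_Pair inner_zero_right add_0_right)
qed

text \<open>Being non-harmonic means that c is nonzero, which is also what permits cancelling the
  power of c in the first variation. The dimension hypothesis makes m positive, so the remaining
  prefactor does not vanish.\<close>

lemma proper_r_harmonic_inclusion:
  assumes n: "DIM('a::euclidean_space) \<ge> 2" and r: "r \<ge> 2" and c: "c \<ge> 0"
  shows "proper_r_harmonic_submanifold \<mu> M N r (\<lambda>x :: 'a. (x, c)) \<longleftrightarrow> real r * R\<^sup>2 = 1"
proof -
  let ?i = "\<lambda>x :: 'a. (x, c)"
  let ?A = "((real DIM('a) - 1) / R\<^sup>2) ^ r * R * c ^ (2 * (r - 2) + 1) * (1 - real r * R\<^sup>2)"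
  have iso: "isometric_immersion M N ?i" by (rule isometric_immersion_inclusion)
  then have sm: "smooth_map M N ?i" by (simp add: isometric_immersion_def)
  have const: "smooth_variation M N ?i (\<lambda>t. ?i)"
  proof -
    have "Cinf_on UNIV (\<lambda>z :: 'a \<times> real. (fst z, c))"
      by (intro Cinf_on_Pair Cinf_on_fst Cinf_on_const open_UNIV)
    then have "smooth_on (M \<times> {-1<..<1 :: real}) (\<lambda>(x, t). ?i x)" by (rule smooth_onI) auto
    then show ?thesis
      using sm unfolding smooth_variation_def smooth_map_def
      by (intro conjI exI[of _ 1]) auto
  qed
  have harm: "harmonic_map M N ?i \<longleftrightarrow> c = 0"
  proof -
    obtain p :: 'a where p: "p \<in> M" using R vector_choose_size[of R] by (metis less_imp_le mem_sphere_0)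
    \<comment> \<open>The constant variation turns the formula at time 0 into one for the inclusion
      itself.\<close>
    have t: "tension_field M N ?i q = (- ((real DIM('a) - 1) / R\<^sup>2 * R * c)) *\<^sub>R ((c / R) *\<^sub>R q, - R)" if "q \<in> M" for q
      using first_variation(2)[OF const r that] .
    have "tension_field M N ?i p \<noteq> 0" if "c \<noteq> 0"
      using n R that unfolding t[OF p] by (simp add: zero_prod_def)
    moreover have "tension_field M N ?i q = 0" if "c = 0" "q \<in> M" for q
      unfolding t[OF that(2)] using that(1) by (simp add: zero_prod_def)
    ultimately show ?thesis using sm p unfolding harmonic_map_def by blast
  qed
  show ?thesis
  proof
    assume proper: "proper_r_harmonic_submanifold \<mu> M N r ?i"
    then have "c \<noteq> 0" using harm by (simp add: proper_r_harmonic_submanifold_def)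
    obtain \<Phi> where \<Phi>: "smooth_variation M N ?i \<Phi>" "normal_integral \<Phi> > 0"
      using normal_variation by blast
    have "((\<lambda>t. r_energy \<mu> M N r (\<Phi> t)) has_real_derivative 0) (at 0)"
      using proper \<Phi>(1) by (simp add: proper_r_harmonic_submanifold_def r_harmonic_map_def)
    then have "?A * normal_integral \<Phi> = 0"
      using first_variation(1)[OF \<Phi>(1) r] by (rule DERIV_unique[rotated])
    then show "real r * R\<^sup>2 = 1"
      using \<Phi>(2) R n \<open>c \<noteq> 0\<close> by simp
  next
    assume r1: "real r * R\<^sup>2 = 1"
    \<comment> \<open>The equator has R = 1, which would force r = 1.\<close>
    have "c \<noteq> 0"
    proof
      assume "c = 0"
      then have "real r = 1" using r1 cR by simp
      then show False using r by simp
    qed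
    moreover have "r_harmonic_map \<mu> M N r ?i"
      unfolding r_harmonic_map_def
    proof (intro conjI allI impI sm)
      fix \<Phi> assume "smooth_variation M N ?i \<Phi>"
      from first_variation(1)[OF this r]
      show "((\<lambda>t. r_energy \<mu> M N r (\<Phi> t)) has_real_derivative 0) (at 0)" using r1 by simp
    qed
    ultimately show "proper_r_harmonic_submanifold \<mu> M N r ?i"
      using iso harm by (simp add: proper_r_harmonic_submanifold_def)
  qed
qed

end

theorem theorem1p1:
  fixes R :: real and r :: nat
  assumes "CARD('n::finite) \<ge> 2" and "r \<ge> 2" and "0 < R" and "R \<le> 1"
  shows "proper_r_harmonic_submanifold (sphere_volume R)
           (sphere (0 :: real ^ 'n) R) (sphere (0 :: (real ^ 'n) \<times> real) 1) r
           (canonical_inclusion R)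
         \<longleftrightarrow> R = 1 / sqrt (real r)"
proof -
  define c where "c = sqrt (1 - R\<^sup>2)"
  \<comment> \<open>A nonnegative radicand is needed for c^2 = 1 - R^2, as \<open>sqrt\<close> is
    also defined on negative reals.\<close>
  have "R\<^sup>2 \<le> 1" using assms by (simp add: power_le_one)
  then have c: "c \<ge> 0" "c\<^sup>2 + R\<^sup>2 = 1" by (simp_all add: c_def)
  have "canonical_inclusion R = (\<lambda>x :: real ^ 'n. (x, c))"
    by (simp add: fun_eq_iff canonical_inclusion_def c_def)
  moreover have "real r * R\<^sup>2 = 1 \<longleftrightarrow> R = 1 / sqrt (real r)"
  proof
    assume "real r * R\<^sup>2 = 1"
    then have "sqrt (real r) * R = 1"
      using assms(3) by (metis real_sqrt_mult real_sqrt_one real_sqrt_pow2_iff real_sqrt_abs abs_of_pos)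
    then show "R = 1 / sqrt (real r)" using assms(2) by (simp add: field_simps)
  next
    assume "R = 1 / sqrt (real r)"
    then show "real r * R\<^sup>2 = 1" using assms(2) by (simp add: power_divide)
  qed
  ultimately show ?thesis
    using proper_r_harmonic_inclusion[OF assms(3) c(2), where 'a="real ^ 'n"] assms(1,2) c(1) by simp
qed

end
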